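(* There exists a Martin-Löf random set $X \subseteq \omega$ that is Turing incomplete (i.e., $\emptyset' \not\le_T X$) and such that every $K$-trivial set $A$ satisfies $A \le_T X$.
   Context: Sets are subsets of $\omega$, identified with elements of Cantor space $2^\omega$ with the fair-coin measure $\lambda$. A set $X$ is Martin-Löf random if there is no uniformly computable sequence $(\mathcal U_n)_{n}$ of effectively open ($\Sigma^0_1$) subsets of $2^\omega$ with $\lambda(\mathcal U_n) \le 2^{-n}$ for all $n$ and $X \in \bigcap_n \mathcal U_n$. Let $K$ denote prefix-free Kolmogorov complexity. A set $A$ is $K$-trivial if there is a constant $c$ such that $K(A\upharpoonright n) \le K(n) + c$ for all $n$, where $A \upharpoonright n$ is the string of the first $n$ bits of $A$. $\emptyset'$ denotes the halting problem and $\le_T$ Turing reducibility. *)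

theory Defs
  imports "HOL-Probability.Probability" "HOL-Library.Nat_Bijection"
    "HOL-Library.Extended_Nat" "HOL-Library.Sublist"
begin

section \<open>Computability relative to an oracle\<close>

text \<open>
  Partial recursive functions with an oracle, generated from basic functions by composition,
  primitive recursion and minimisation. All functions are unary; several arguments are
  passed as one number through the Cantor pairing bijection \<^const>\<open>prod_encode\<close>.
\<close>

datatype code =
    Zero
  | Succ
  | Fst
  | Snd
  | Oracle
  | Tuple code code
  | Comp code code
  | Prec code code
  | Mu code

text \<open>
  \<open>eval X c n y\<close> means that the computation of program \<open>c\<close> with oracle \<open>X\<close> on input \<open>n\<close> halts
  with output \<open>y\<close>.
\<close>

inductive eval :: "nat set \<Rightarrow> code \<Rightarrow> nat \<Rightarrow> nat \<Rightarrow> bool" for X :: "nat set" where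
  eval_Zero: "eval X Zero n 0"
| eval_Succ: "eval X Succ n (Suc n)"
| eval_Fst: "eval X Fst (prod_encode (a, b)) a"
| eval_Snd: "eval X Snd (prod_encode (a, b)) b"
| eval_Oracle: "eval X Oracle n (of_bool (n \<in> X))"
| eval_Tuple: "eval X f n a \<Longrightarrow> eval X g n b \<Longrightarrow> eval X (Tuple f g) n (prod_encode (a, b))"
| eval_Comp: "eval X g n m \<Longrightarrow> eval X f m k \<Longrightarrow> eval X (Comp f g) n k"
| eval_Prec_0: "eval X f a k \<Longrightarrow> eval X (Prec f g) (prod_encode (a, 0)) k"
| eval_Prec_Suc:
    "eval X (Prec f g) (prod_encode (a, n)) m \<Longrightarrow>
     eval X g (prod_encode (a, prod_encode (n, m))) k \<Longrightarrow>
     eval X (Prec f g) (prod_encode (a, Suc n)) k"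
| eval_Mu:
    "eval X f (prod_encode (a, m)) 0 \<Longrightarrow>
     (\<And>i. i < m \<Longrightarrow> \<exists>k. eval X f (prod_encode (a, i)) (Suc k)) \<Longrightarrow>
     eval X (Mu f) a m"

lemma eval_deterministic: "eval X c n y \<Longrightarrow> eval X c n z \<Longrightarrow> y = z"
proof (induction arbitrary: z rule: eval.induct)
  case (eval_Comp g n m f k)
  from eval_Comp.prems show ?case
    by cases (use eval_Comp.IH in blast)
next
  case (eval_Tuple f n a g b)
  from eval_Tuple.prems show ?case
    by cases (use eval_Tuple.IH in blast)
next
  case (eval_Prec_0 f a k g)
  from eval_Prec_0.prems show ?case
    by cases (use eval_Prec_0.IH in \<open>auto simp: prod_encode_eq\<close>)
next
  case (eval_Prec_Suc f g a n m k)
  from eval_Prec_Suc.prems show ?case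
    by cases (use eval_Prec_Suc.IH in \<open>auto simp: prod_encode_eq\<close>)
next
  case (eval_Mu f a m)
  from eval_Mu.prems show ?case
  proof cases
    case eval_Mu': eval_Mu
    have "\<not> z < m"
    proof
      assume "z < m"
      then obtain k where "\<And>w. eval X f (prod_encode (a, z)) w \<Longrightarrow> Suc k = w"
        using eval_Mu.IH(2) by blast
      with eval_Mu'(1) show False by blast
    qed
    moreover have "\<not> m < z"
      using eval_Mu'(2) eval_Mu.IH(1) by blast
    ultimately show ?thesis by simp
  qed
qed (auto elim: eval.cases simp: prod_encode_eq)

definition turing_reducible :: "nat set \<Rightarrow> nat set \<Rightarrow> bool" (infix "\<le>\<^sub>T" 50) where
  "A \<le>\<^sub>T X \<longleftrightarrow> (\<exists>c. \<forall>n. eval X c n (of_bool (n \<in> A)))"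

definition comp_enumerable :: "nat set \<Rightarrow> bool" where
  "comp_enumerable W \<longleftrightarrow> (\<exists>c. \<forall>n. n \<in> W \<longleftrightarrow> (\<exists>y. eval {} c n y))"

primrec goedel_number :: "code \<Rightarrow> nat" where
  "goedel_number Zero = prod_encode (0, 0)"
| "goedel_number Succ = prod_encode (1, 0)"
| "goedel_number Fst = prod_encode (2, 0)"
| "goedel_number Snd = prod_encode (3, 0)"
| "goedel_number Oracle = prod_encode (4, 0)"
| "goedel_number (Tuple f g) = prod_encode (5, prod_encode (goedel_number f, goedel_number g))"
| "goedel_number (Comp f g) = prod_encode (6, prod_encode (goedel_number f, goedel_number g))"
| "goedel_number (Prec f g) = prod_encode (7, prod_encode (goedel_number f, goedel_number g))"
| "goedel_number (Mu f) = prod_encode (8, goedel_number f)"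

lemma goedel_number_eq_iff: "goedel_number c = goedel_number d \<longleftrightarrow> c = d"
proof (induction c arbitrary: d)
qed (case_tac d; simp add: prod_encode_eq)+

text \<open>Numbers that are not the number of a program count as indices of the empty function.\<close>

definition halting_problem :: "nat set" where
  "halting_problem = {goedel_number c | c. \<exists>y. eval {} c (goedel_number c) y}"

section \<open>Martin-Loef randomness\<close>

text \<open>The computable bijection between finite binary strings and natural numbers (bijective
  base 2, least significant digit first).\<close>

primrec string_code :: "bool list \<Rightarrow> nat" where
  "string_code [] = 0"
| "string_code (b # \<sigma>) = 2 * string_code \<sigma> + (if b then 2 else 1)"

lemma bij_string_code: "bij string_code"
proof (rule bijI)
  show "inj string_code"
  proof (rule injI)
    show "string_code \<sigma> = string_code \<tau> \<Longrightarrow> \<sigma> = \<tau>" for \<sigma> \<tau>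
    proof (induction \<sigma> arbitrary: \<tau>)
      case Nil
      then show ?case by (cases \<tau>) (auto split: if_splits)
    next
      case (Cons b \<sigma>)
      then show ?case
        by (cases \<tau>) (simp_all split: if_splits, presburger+)
    qed
  qed
  have "\<exists>\<sigma>. n = string_code \<sigma>" for n
  proof (induction n rule: less_induct)
    case (less n)
    show ?case
    proof (cases "n = 0")
      case True
      then show ?thesis by (intro exI[of _ "[]"]) simp
    next
      case False
      then have "(n - 1) div 2 < n" by linarith
      from less.IH[OF this] obtain \<sigma> where "(n - 1) div 2 = string_code \<sigma>" by blast
      moreover have "n = 2 * ((n - 1) div 2) + (if even n then 2 else 1)"
        using False by simp presburger
      ultimately show ?thesis by (intro exI[of _ "even n # \<sigma>"]) simp
    qed
  qed
  then show "surj string_code" by (simp add: surj_def)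
qed

text \<open>Points of Cantor space are represented by characteristic functions.\<close>

definition coin_measure :: "(nat \<Rightarrow> bool) measure" where
  "coin_measure = (\<Pi>\<^sub>M i\<in>UNIV. measure_pmf (bernoulli_pmf (1 / 2)))"

definition cylinder :: "bool list \<Rightarrow> (nat \<Rightarrow> bool) set" where
  "cylinder \<sigma> = {x. \<forall>i<length \<sigma>. x i = \<sigma> ! i}"

text \<open>Uniformly effectively open sets: a single computably enumerable set \<open>W\<close> lists, for every
  \<open>n\<close>, the strings whose cylinders make up the \<open>n\<close>-th set.\<close>

definition uniformly_Sigma01 :: "(nat \<Rightarrow> (nat \<Rightarrow> bool) set) \<Rightarrow> bool" where
  "uniformly_Sigma01 U \<longleftrightarrow>
    (\<exists>W. comp_enumerable W \<and>
      (\<forall>n. U n = (\<Union>\<sigma>\<in>{\<sigma>. prod_encode (n, string_code \<sigma>) \<in> W}. cylinder \<sigma>)))"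

definition Martin_Loef_test :: "(nat \<Rightarrow> (nat \<Rightarrow> bool) set) \<Rightarrow> bool" where
  "Martin_Loef_test U \<longleftrightarrow> uniformly_Sigma01 U \<and> (\<forall>n. measure coin_measure (U n) \<le> (1 / 2) ^ n)"

definition Martin_Loef_random :: "nat set \<Rightarrow> bool" where
  "Martin_Loef_random X \<longleftrightarrow> \<not> (\<exists>U. Martin_Loef_test U \<and> (\<lambda>i. i \<in> X) \<in> (\<Inter>n. U n))"

section \<open>Prefix-free Kolmogorov complexity\<close>

definition computable_machine :: "(bool list \<Rightarrow> bool list option) \<Rightarrow> bool" where
  "computable_machine M \<longleftrightarrow>
    (\<exists>c. \<forall>\<sigma> \<tau>. M \<sigma> = Some \<tau> \<longleftrightarrow> eval {} c (string_code \<sigma>) (string_code \<tau>))"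

definition prefix_free :: "bool list set \<Rightarrow> bool" where
  "prefix_free D \<longleftrightarrow> (\<forall>\<sigma>\<in>D. \<forall>\<tau>\<in>D. prefix \<sigma> \<tau> \<longrightarrow> \<sigma> = \<tau>)"

definition prefix_free_machine :: "(bool list \<Rightarrow> bool list option) \<Rightarrow> bool" where
  "prefix_free_machine M \<longleftrightarrow> computable_machine M \<and> prefix_free (dom M)"

text \<open>The infimum of the empty set is \<open>\<infinity>\<close>.\<close>

definition machine_complexity :: "(bool list \<Rightarrow> bool list option) \<Rightarrow> bool list \<Rightarrow> enat" where
  "machine_complexity M \<tau> = (INF \<sigma>\<in>{\<sigma>. M \<sigma> = Some \<tau>}. enat (length \<sigma>))"

definition optimal_prefix_free_machine :: "(bool list \<Rightarrow> bool list option) \<Rightarrow> bool" where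
  "optimal_prefix_free_machine U \<longleftrightarrow>
    prefix_free_machine U \<and>
    (\<forall>M. prefix_free_machine M \<longrightarrow>
      (\<exists>c::nat. \<forall>\<tau>. machine_complexity U \<tau> \<le> machine_complexity M \<tau> + enat c))"

text \<open>
  As usual one optimal prefix-free machine is fixed once and for all. Complexities with respect
  to different optimal machines differ by at most an additive constant.
\<close>

definition reference_machine :: "bool list \<Rightarrow> bool list option" where
  "reference_machine = (SOME U. optimal_prefix_free_machine U)"

definition K :: "bool list \<Rightarrow> enat" where
  "K = machine_complexity reference_machine"

definition initial_segment :: "nat set \<Rightarrow> nat \<Rightarrow> bool list" where
  "initial_segment A n = map (\<lambda>i. i \<in> A) [0..<n]"

text \<open>The complexity of a number \<open>n\<close> is that of the string \<open>0\<^sup>n\<close>; any other computable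
  representation of \<open>n\<close> changes it by at most an additive constant.\<close>

definition K_nat :: "nat \<Rightarrow> enat" where
  "K_nat n = K (replicate n False)"

definition K_trivial :: "nat set \<Rightarrow> bool" where
  "K_trivial A \<longleftrightarrow> (\<exists>c::nat. \<forall>n. K (initial_segment A n) \<le> K_nat n + enat c)"

end

theory Submission imports Defs begin

text \<open>
  Let \<open>P\<close> be the complement of a universal Martin-Loef test component \<open>U\<close>. Moving through \<open>P\<close> along
  strings on which the conditional measure of \<open>P\<close> stays above some bound, but returning infinitely
  often to values between 1/2 and 3/4, one obtains \<open>X\<close> in \<open>P\<close> that is sufficiently generic: every
  closed set out of a given countable family either omits \<open>X\<close> or has positive lower density at \<open>X\<close>.

  Positive density makes \<open>X\<close> incomplete. If program \<open>e\<close> computed a certain enumerable set from \<open>X\<close>,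
  then the closed set of oracles for which \<open>e\<close> is never wrong would have density above some \<open>2\<^sup>-\<^sup>j\<close> at
  \<open>X\<close>. For each prefix \<open>\<sigma>\<close> of \<open>X\<close>, the number \<open>\<langle>e, \<langle>j, \<sigma>\<rangle>\<rangle>\<close> is enumerated only if \<open>e\<close> answers 0 for more than
  the proportion \<open>1 - 2\<^sup>-\<^sup>j\<close> of the extensions of \<open>\<sigma>\<close>; so it is not enumerated, and \<open>X\<close> lies in a
  subset of that proportion. Iterating this captures \<open>X\<close> in a Martin-Loef test.

  Density below 1 makes \<open>X\<close> compute a K-trivial set \<open>A\<close>. Write \<open>U\<close> as the union of disjoint cylinders
  given by a decidable set of strings \<open>\<rho>\<close>. Since \<open>\<rho>\<close> describes its own code number \<open>c\<close>, the complexity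
  of \<open>A\<close> restricted to \<open>c\<close> is at most \<open>|\<rho>| + d\<close>, so \<open>A\<close> is a path through an enumerable tree such that
  the sum over all \<open>\<rho>\<close> of \<open>2\<^sup>-\<^sup>|\<^sup>\<rho>\<^sup>|\<close> times the size of level \<open>c\<close> is at most \<open>2\<^sup>d\<close>. Let \<open>X\<close> believe in a node at
  level \<open>x + 1\<close> if that node has an extension of some length \<open>y\<close> in the tree and the \<open>\<rho>\<close> with code
  between \<open>x\<close> and \<open>y\<close> fill an eighth of some cylinder around \<open>X\<close>. Then \<open>X\<close> believes in all prefixes
  of \<open>A\<close>. The oracles believing in both children of a node, for varying nodes, form a Solovay test,
  because a level with \<open>n\<close> nodes lies above at most \<open>n\<close> branchings; hence \<open>X\<close> believes in both children
  for finitely many nodes only.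
\<close>

section \<open>Computable functions and decidable predicates\<close>

abbreviation p1 :: "nat \<Rightarrow> nat" where "p1 n \<equiv> fst (prod_decode n)"
abbreviation p2 :: "nat \<Rightarrow> nat" where "p2 n \<equiv> snd (prod_decode n)"

definition computable :: "nat set \<Rightarrow> (nat \<Rightarrow> nat) \<Rightarrow> bool" where
  "computable X f \<longleftrightarrow> (\<exists>c. \<forall>n. eval X c n (f n))"

definition decidable :: "nat set \<Rightarrow> (nat \<Rightarrow> bool) \<Rightarrow> bool" where
  "decidable X P \<longleftrightarrow> computable X (\<lambda>n. of_bool (P n))"

lemma eval_Fst': "eval X Fst n (p1 n)"
  by (metis eval_Fst prod.collapse prod_decode_inverse)

lemma eval_Snd': "eval X Snd n (p2 n)"
  by (metis eval_Snd prod.collapse prod_decode_inverse)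

lemma comp_compose: "computable X f \<Longrightarrow> computable X g \<Longrightarrow> computable X (\<lambda>n. f (g n))"
  unfolding computable_def using eval_Comp by blast

text \<open>The identity is not a basic program; it arises by pairing the two projections again,
  because every number codes a pair.\<close>

lemma comp_id: "computable X (\<lambda>n. n)"
proof -
  have "eval X (Tuple Fst Snd) n n" for n
    using eval_Tuple[OF eval_Fst' eval_Snd', of X n] by simp
  then show ?thesis unfolding computable_def by blast
qed

lemma comp_p1: "computable X f \<Longrightarrow> computable X (\<lambda>n. p1 (f n))"
  using comp_compose[of X p1 f] eval_Fst' unfolding computable_def by blast

lemma comp_p2: "computable X f \<Longrightarrow> computable X (\<lambda>n. p2 (f n))"
  using comp_compose[of X p2 f] eval_Snd' unfolding computable_def by blast

lemma comp_Suc: "computable X f \<Longrightarrow> computable X (\<lambda>n. Suc (f n))"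
  using comp_compose[of X Suc f] eval_Succ unfolding computable_def by blast

lemma comp_pair: "computable X f \<Longrightarrow> computable X g \<Longrightarrow> computable X (\<lambda>n. prod_encode (f n, g n))"
  unfolding computable_def using eval_Tuple by blast

lemma comp_const: "computable X (\<lambda>n. k)"
proof (induction k)
  case 0
  then show ?case unfolding computable_def using eval_Zero by blast
qed (rule comp_Suc)

text \<open>The whole input \<open>n\<close> serves as the parameter of the recursion, so that start
  value, step and number of rounds may all depend on it. Parameter, counter and previous value are
  packed as in \<open>eval_Prec_Suc\<close>.\<close>

lemma comp_rec:
  assumes a: "computable X a" and b: "computable X b"
    and g: "computable X (\<lambda>m. g (p1 m) (p1 (p2 m)) (p2 (p2 m)))"
  shows "computable X (\<lambda>n. rec_nat (a n) (g n) (b n))"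
proof -
  from a obtain ca where ca: "\<And>n. eval X ca n (a n)" unfolding computable_def by blast
  from g obtain cg where cg: "\<And>m. eval X cg m (g (p1 m) (p1 (p2 m)) (p2 (p2 m)))"
    unfolding computable_def by blast
  have "eval X (Prec ca cg) (prod_encode (n, k)) (rec_nat (a n) (g n) k)" for n k
  proof (induction k)
    case 0
    then show ?case using eval_Prec_0[OF ca] by simp
  next
    case (Suc k)
    from eval_Prec_Suc[OF Suc] cg[of "prod_encode (n, prod_encode (k, rec_nat (a n) (g n) k))"]
    show ?case by simp
  qed
  then have "computable X (\<lambda>m. rec_nat (a (p1 m)) (g (p1 m)) (p2 m))"
    unfolding computable_def by (metis prod.collapse prod_decode_inverse)
  from comp_compose[OF this comp_pair[OF comp_id b]] show ?thesis by simp
qed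

section \<open>Closure under arithmetic operations\<close>

lemma comp_add: "computable X f \<Longrightarrow> computable X g \<Longrightarrow> computable X (\<lambda>n. f n + g n)"
proof -
  assume fg: "computable X f" "computable X g"
  have "rec_nat a (\<lambda>k r. Suc r) b = a + b" for a b :: nat by (induction b) auto
  moreover have "computable X (\<lambda>n. rec_nat (f n) (\<lambda>k r. Suc r) (g n))"
    by (intro comp_rec fg comp_Suc comp_p2 comp_id)
  ultimately show ?thesis by simp
qed

lemma comp_mult: "computable X f \<Longrightarrow> computable X g \<Longrightarrow> computable X (\<lambda>n. f n * g n)"
proof -
  assume fg: "computable X f" "computable X g"
  have "rec_nat 0 (\<lambda>k r. r + a) b = a * b" for a b :: nat by (induction b) auto
  moreover have "computable X (\<lambda>n. rec_nat 0 (\<lambda>k r. r + f n) (g n))"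
    by (intro comp_rec fg comp_add comp_const comp_p2 comp_p1 comp_id comp_compose[OF fg(1)])
  ultimately show ?thesis by simp
qed

lemma comp_power: "computable X f \<Longrightarrow> computable X g \<Longrightarrow> computable X (\<lambda>n. f n ^ g n)"
proof -
  assume fg: "computable X f" "computable X g"
  have "rec_nat 1 (\<lambda>k r. r * a) b = a ^ b" for a b :: nat by (induction b) auto
  moreover have "computable X (\<lambda>n. rec_nat 1 (\<lambda>k r. r * f n) (g n))"
    by (intro comp_rec fg comp_mult comp_const comp_p2 comp_p1 comp_id comp_compose[OF fg(1)])
  ultimately show ?thesis by simp
qed

text \<open>A recursion that returns its counter gives the predecessor; iterating the predecessor
  gives truncated subtraction.\<close>

lemma comp_diff: "computable X f \<Longrightarrow> computable X g \<Longrightarrow> computable X (\<lambda>n. f n - g n)"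
proof -
  assume fg: "computable X f" "computable X g"
  have "rec_nat 0 (\<lambda>k r. k) b = b - 1" for b :: nat by (induction b) auto
  moreover have "computable X (\<lambda>n. rec_nat 0 (\<lambda>k r. k) (p2 (p2 n)))"
    by (intro comp_rec comp_const comp_p2 comp_p1 comp_id)
  ultimately have 1: "computable X (\<lambda>n. p2 (p2 n) - 1)" by simp
  have "rec_nat a (\<lambda>k r. r - 1) b = a - b" for a b :: nat by (induction b) auto
  moreover have "computable X (\<lambda>n. rec_nat (f n) (\<lambda>k r. r - 1) (g n))"
    by (rule comp_rec[OF fg]) (rule 1)
  ultimately show ?thesis by simp
qed

lemma comp_of_bool: "decidable X P \<Longrightarrow> computable X (\<lambda>n. of_bool (P n))"
  by (simp add: decidable_def)

section \<open>Boolean combinations and bounded quantifiers\<close>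

lemma dec_compose: "decidable X P \<Longrightarrow> computable X g \<Longrightarrow> decidable X (\<lambda>n. P (g n))"
  unfolding decidable_def by (rule comp_compose)

lemma dec_const: "decidable X (\<lambda>n. b)"
  unfolding decidable_def by (rule comp_const)

lemma dec_not: "decidable X P \<Longrightarrow> decidable X (\<lambda>n. \<not> P n)"
proof -
  assume "decidable X P"
  then have "computable X (\<lambda>n. 1 - of_bool (P n))" by (intro comp_diff comp_of_bool comp_const)
  moreover have "1 - of_bool b = (of_bool (\<not> b) :: nat)" for b by simp
  ultimately show ?thesis by (simp only: decidable_def)
qed

lemma dec_conj: "decidable X P \<Longrightarrow> decidable X Q \<Longrightarrow> decidable X (\<lambda>n. P n \<and> Q n)"
  unfolding decidable_def of_bool_conj by (rule comp_mult)

lemma dec_disj: "decidable X P \<Longrightarrow> decidable X Q \<Longrightarrow> decidable X (\<lambda>n. P n \<or> Q n)"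
  using dec_not[OF dec_conj[OF dec_not dec_not], of X P Q] by simp

lemma dec_imp: "decidable X P \<Longrightarrow> decidable X Q \<Longrightarrow> decidable X (\<lambda>n. P n \<longrightarrow> Q n)"
  using dec_disj[OF dec_not, of X P Q] by simp

lemma dec_le: "computable X f \<Longrightarrow> computable X g \<Longrightarrow> decidable X (\<lambda>n. f n \<le> g n)"
proof -
  assume "computable X f" "computable X g"
  then have "computable X (\<lambda>n. 1 - (f n - g n))" by (intro comp_diff comp_const)
  moreover have "1 - (a - b) = of_bool (a \<le> b)" for a b :: nat by auto
  ultimately show ?thesis by (simp only: decidable_def)
qed

lemma dec_less: "computable X f \<Longrightarrow> computable X g \<Longrightarrow> decidable X (\<lambda>n. f n < g n)"
  using dec_not[OF dec_le, of X g f] by (simp add: not_le)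

lemma dec_eq: "computable X f \<Longrightarrow> computable X g \<Longrightarrow> decidable X (\<lambda>n. f n = g n)"
  using dec_conj[OF dec_le dec_le, of X f g g f] by (simp add: eq_iff)

lemma comp_if:
  assumes "decidable X P" "computable X f" "computable X g"
  shows "computable X (\<lambda>n. if P n then f n else g n)"
proof -
  have "computable X (\<lambda>n. of_bool (P n) * f n + of_bool (\<not> P n) * g n)"
    by (intro comp_add comp_mult comp_of_bool dec_not assms)
  moreover have "of_bool b * x + of_bool (\<not> b) * y = (if b then x else y)" for b and x y :: nat
    by simp
  ultimately show ?thesis by simp
qed

lemma comp_sum:
  assumes "computable X b" "computable X (\<lambda>m. g (p1 m) (p2 m))"
  shows "computable X (\<lambda>n. \<Sum>k<b n. g n k)"
proof -
  have "rec_nat 0 (\<lambda>k r. r + h k) m = (\<Sum>k<m. h k)" for h :: "nat \<Rightarrow> nat" and m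
    by (induction m) auto
  moreover have "computable X (\<lambda>n. g (p1 n) (p1 (p2 n)))"
    using comp_compose[OF assms(2) comp_pair[OF comp_p1 comp_p1[OF comp_p2]], OF comp_id comp_id]
    by simp
  then have "computable X (\<lambda>n. rec_nat 0 (\<lambda>k r. r + g n k) (b n))"
    by (intro comp_rec comp_const assms(1) comp_add comp_p2 comp_id)
  ultimately show ?thesis by simp
qed

lemma dec_bex:
  assumes "computable X b" "decidable X (\<lambda>m. P (p1 m) (p2 m))"
  shows "decidable X (\<lambda>n. \<exists>k<b n. P n k)"
proof -
  have "decidable X (\<lambda>n. (0::nat) < (\<Sum>k<b n. of_bool (P n k)))"
    by (intro dec_less comp_const comp_sum comp_of_bool assms)
  moreover have "(0 < (\<Sum>k<m. of_bool (Q k) :: nat)) \<longleftrightarrow> (\<exists>k<m. Q k)" for Q and m :: nat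
    by (auto simp: sum_eq_0_iff simp flip: neq0_conv)
  ultimately show ?thesis by simp
qed

lemma dec_ball:
  assumes "computable X b" "decidable X (\<lambda>m. P (p1 m) (p2 m))"
  shows "decidable X (\<lambda>n. \<forall>k<b n. P n k)"
  using dec_not[OF dec_bex[OF assms(1) dec_not[OF assms(2)]]] by simp

lemma dec_bex_le:
  assumes "computable X b" "decidable X (\<lambda>m. P (p1 m) (p2 m))"
  shows "decidable X (\<lambda>n. \<exists>k\<le>b n. P n k)"
  using dec_bex[OF comp_Suc[OF assms(1)] assms(2)] by (simp add: less_Suc_eq_le)

lemma dec_ball_le:
  assumes "computable X b" "decidable X (\<lambda>m. P (p1 m) (p2 m))"
  shows "decidable X (\<lambda>n. \<forall>k\<le>b n. P n k)"
  using dec_ball[OF comp_Suc[OF assms(1)] assms(2)] by (simp add: less_Suc_eq_le)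

text \<open>The quotient counts the \<open>k\<close> with \<open>Suc k * b \<le> a\<close>, all of
  which are below \<open>a\<close>; the conjunct \<open>0 < b\<close> reproduces the value 0 of a
  division by 0.\<close>

lemma comp_div:
  assumes "computable X f" "computable X g"
  shows "computable X (\<lambda>n. f n div g n)"
proof -
  have "a div b = (\<Sum>k<a. of_bool (0 < b \<and> Suc k * b \<le> a))" for a b :: nat
  proof (cases "b = 0")
    case False
    have "(k < a \<and> Suc k * b \<le> a) = (k < a div b)" for k
    proof -
      have "Suc k * b \<le> a \<longleftrightarrow> k < a div b"
        using False by (metis Suc_le_eq less_eq_div_iff_mult_less_eq neq0_conv)
      moreover have "k < a div b \<Longrightarrow> k < a"
        by (meson div_le_dividend order_less_le_trans)
      ultimately show ?thesis by blast
    qed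
    then have "{k. k < a \<and> Suc k * b \<le> a} = {..<a div b}" by auto
    moreover have "(\<Sum>k<a. of_bool (0 < b \<and> Suc k * b \<le> a)) = card {k. k < a \<and> Suc k * b \<le> a}"
      using False by (simp add: of_bool_def sum.If_cases Int_def lessThan_def del: mult_Suc)
    ultimately show ?thesis by simp
  qed simp
  moreover have "computable X (\<lambda>n. \<Sum>k<f n. of_bool (0 < g n \<and> Suc k * g n \<le> f n))"
    by (intro comp_sum assms comp_of_bool dec_conj dec_less dec_le comp_const comp_mult comp_Suc
        comp_p2 comp_p1 comp_id comp_compose[OF assms(1)] comp_compose[OF assms(2)])
  ultimately show ?thesis by simp
qed

lemma comp_mod:
  assumes "computable X f" "computable X g"
  shows "computable X (\<lambda>n. f n mod g n)"
  using comp_diff[OF assms(1) comp_mult[OF assms(2) comp_div[OF assms]]]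
  by (simp add: minus_mult_div_eq_mod)

lemma dec_even: "computable X f \<Longrightarrow> decidable X (\<lambda>n. even (f n))"
  using dec_eq[OF comp_mod comp_const, of X f "\<lambda>n. 2" 0] comp_const[of X 2]
  by (simp add: even_iff_mod_2_eq_zero)

lemma dec_oracle: "computable X f \<Longrightarrow> decidable X (\<lambda>n. f n \<in> X)"
  using comp_compose[of X "\<lambda>n. of_bool (n \<in> X)" f] eval_Oracle
  unfolding decidable_def computable_def by blast

section \<open>Unbounded search\<close>

lemma comp_Least:
  assumes "decidable X (\<lambda>m. P (p1 m) (p2 m))" and ex: "\<And>n. \<exists>k. P n k"
  shows "computable X (\<lambda>n. LEAST k. P n k)"
proof -
  from dec_not[OF assms(1)] obtain c where
    c: "\<And>m. eval X c m (of_bool (\<not> P (p1 m) (p2 m)))"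
    unfolding decidable_def computable_def by blast
  have "eval X (Mu c) n (LEAST k. P n k)" for n
  proof (rule eval_Mu)
    show "eval X c (prod_encode (n, LEAST k. P n k)) 0"
      using c[of "prod_encode (n, LEAST k. P n k)"] LeastI_ex[OF ex[of n]] by simp
    show "\<exists>k. eval X c (prod_encode (n, i)) (Suc k)" if "i < (LEAST k. P n k)" for i
      using c[of "prod_encode (n, i)"] not_less_Least[OF that] by auto
  qed
  then show ?thesis unfolding computable_def by blast
qed

text \<open>No witness is assumed to exist: the equivalence also describes the domain of the
  program. Enumerable sets and partial machines are obtained from it.\<close>

lemma partial_search:
  assumes "decidable X (\<lambda>m. P (p1 m) (p2 m))" and g: "computable X g"
  shows "\<exists>c. \<forall>n y. eval X c n y \<longleftrightarrow> (\<exists>s. P n s) \<and> y = g (LEAST s. P n s)"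
proof -
  from dec_not[OF assms(1)] obtain c where
    c: "\<And>m. eval X c m (of_bool (\<not> P (p1 m) (p2 m)))"
    unfolding decidable_def computable_def by blast
  from g obtain d where d: "\<And>m. eval X d m (g m)" unfolding computable_def by blast
  have 1: "eval X (Mu c) n (LEAST k. P n k)" if "\<exists>k. P n k" for n
  proof (rule eval_Mu)
    show "eval X c (prod_encode (n, LEAST k. P n k)) 0"
      using c[of "prod_encode (n, LEAST k. P n k)"] LeastI_ex[OF that] by simp
    show "\<exists>k. eval X c (prod_encode (n, i)) (Suc k)" if "i < (LEAST k. P n k)" for i
      using c[of "prod_encode (n, i)"] not_less_Least[OF that] by auto
  qed
  have 2: "\<exists>k. P n k" if "eval X (Mu c) n y" for n y
    using that
  proof cases
    case eval_Mu
    from eval_deterministic[OF eval_Mu(1) c] have "P n y" by (simp split: if_splits)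
    then show ?thesis by blast
  qed
  have "eval X (Comp d (Mu c)) n y \<longleftrightarrow> (\<exists>s. P n s) \<and> y = g (LEAST s. P n s)" for n y
  proof
    assume "eval X (Comp d (Mu c)) n y"
    then obtain m where m: "eval X (Mu c) n m" "eval X d m y" by cases
    from 2[OF m(1)] have ex: "\<exists>s. P n s" .
    from eval_deterministic[OF m(1) 1[OF ex]] eval_deterministic[OF m(2) d] ex
    show "(\<exists>s. P n s) \<and> y = g (LEAST s. P n s)" by simp
  next
    assume "(\<exists>s. P n s) \<and> y = g (LEAST s. P n s)"
    then show "eval X (Comp d (Mu c)) n y" using eval_Comp[OF 1 d] by blast
  qed
  then show ?thesis by blast
qed

lemma comp_enumerable_dec_ex:
  assumes "decidable {} (\<lambda>m. P (p1 m) (p2 m))"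
  shows "comp_enumerable {n. \<exists>s. P n s}"
proof -
  from partial_search[OF assms comp_id] obtain c where
    "\<And>n y. eval {} c n y \<longleftrightarrow> (\<exists>s. P n s) \<and> y = (LEAST s. P n s)" by blast
  then show ?thesis unfolding comp_enumerable_def by (intro exI[of _ c]) auto
qed

lemma turing_reducible_iff_dec: "A \<le>\<^sub>T X \<longleftrightarrow> decidable X (\<lambda>n. n \<in> A)"
  unfolding turing_reducible_def decidable_def computable_def ..

lemmas comp_intros = comp_const comp_id comp_p1 comp_p2 comp_Suc comp_pair comp_add comp_mult
  comp_power comp_diff comp_of_bool dec_const dec_not dec_conj dec_disj dec_imp dec_le dec_less dec_eq
  comp_if comp_sum dec_bex dec_ball dec_bex_le dec_ball_le comp_div comp_mod dec_even

section \<open>Strings\<close>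

definition dstr :: "nat \<Rightarrow> bool list" where
  "dstr = inv string_code"

lemma dstr_string_code [simp]: "dstr (string_code \<sigma>) = \<sigma>"
  unfolding dstr_def using bij_string_code by (simp add: bij_is_inj)

lemma string_code_dstr [simp]: "string_code (dstr n) = n"
  unfolding dstr_def using bij_string_code by (simp add: bij_is_surj surj_f_inv_f)

lemma string_code_inject [simp]: "string_code \<sigma> = string_code \<tau> \<longleftrightarrow> \<sigma> = \<tau>"
  using bij_string_code by (simp add: bij_is_inj inj_eq)

lemma dstr_inject [simp]: "dstr m = dstr n \<longleftrightarrow> m = n"
  by (metis string_code_dstr)

text \<open>One plus the code of \<sigma> is the binary numeral whose digits, from the least
  significant upwards, are the bits of \<sigma>, topped by a leading 1. Length, bits and truncation
  are read off this numeral below.\<close>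

lemma Suc_string_code_Cons: "Suc (string_code (b # \<sigma>)) = 2 * Suc (string_code \<sigma>) + of_bool b"
  by simp

lemma string_code_ge: "2 ^ length \<sigma> \<le> Suc (string_code \<sigma>)"
  by (induction \<sigma>) auto

lemma string_code_less: "Suc (string_code \<sigma>) < 2 ^ Suc (length \<sigma>)"
  by (induction \<sigma>) auto

lemma length_le_string_code: "length \<sigma> \<le> string_code \<sigma>"
  using string_code_ge[of \<sigma>] less_exp[of "length \<sigma>"] by linarith

lemma length_dstr_le: "length (dstr n) \<le> n"
  using length_le_string_code[of "dstr n"] by simp

lemma string_code_append: "string_code (\<sigma> @ \<tau>) = string_code \<sigma> + 2 ^ length \<sigma> * string_code \<tau>"
  by (induction \<sigma>) auto

lemma nth_string_code:
  "i < length \<sigma> \<Longrightarrow> \<sigma> ! i \<longleftrightarrow> odd (Suc (string_code \<sigma>) div 2 ^ i)"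
proof (induction \<sigma> arbitrary: i)
  case (Cons b \<sigma>)
  show ?case
  proof (cases i)
    case (Suc j)
    have "Suc (string_code (b # \<sigma>)) div 2 ^ i = Suc (string_code (b # \<sigma>)) div 2 div 2 ^ j"
      unfolding Suc by (simp add: div_mult2_eq)
    also have "Suc (string_code (b # \<sigma>)) div 2 = Suc (string_code \<sigma>)" by simp
    finally show ?thesis using Cons Suc by simp
  qed simp
qed simp

text \<open>Keeping the \<open>m\<close> lowest digits is reduction modulo \<open>2 ^ m\<close>; the
  summand \<open>2 ^ m\<close> restores the leading 1.\<close>

lemma string_code_take:
  "m \<le> length \<sigma> \<Longrightarrow> Suc (string_code (take m \<sigma>)) = 2 ^ m + Suc (string_code \<sigma>) mod 2 ^ m"
proof (induction \<sigma> arbitrary: m)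
  case (Cons b \<sigma>)
  show ?case
  proof (cases m)
    case (Suc j)
    have "Suc (string_code (b # \<sigma>)) mod 2 ^ m =
        2 * (Suc (string_code (b # \<sigma>)) div 2 mod 2 ^ j) + Suc (string_code (b # \<sigma>)) mod 2"
      unfolding Suc power_Suc by (rule mod_mult2_eq)
    also have "Suc (string_code (b # \<sigma>)) div 2 = Suc (string_code \<sigma>)" by simp
    also have "Suc (string_code (b # \<sigma>)) mod 2 = of_bool b" by simp
    finally show ?thesis using Cons Suc Suc_string_code_Cons[of b "take j \<sigma>"] by simp
  qed simp
qed simp

lemma string_code_replicate_False: "Suc (string_code (replicate n False)) = 2 ^ n"
  by (induction n) auto

section \<open>Initial segments of points of Cantor space\<close>

abbreviation pre :: "(nat \<Rightarrow> bool) \<Rightarrow> nat \<Rightarrow> bool list" where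
  "pre Z m \<equiv> map Z [0..<m]"

lemma take_pre [simp]: "take m (pre Z n) = pre Z (min m n)"
  by (simp add: take_map min_def)

lemma prefix_pre: "m \<le> n \<Longrightarrow> prefix (pre Z m) (pre Z n)"
  by (metis take_is_prefix take_pre min.absorb1)

lemma prefix_iff_take: "prefix \<sigma> \<tau> \<longleftrightarrow> take (length \<sigma>) \<tau> = \<sigma>"
  by (metis append_eq_conv_conj prefix_def take_is_prefix)

lemma prefix_pre_iff: "prefix \<sigma> (pre Z n) \<longleftrightarrow> length \<sigma> \<le> n \<and> \<sigma> = pre Z (length \<sigma>)"
proof
  assume p: "prefix \<sigma> (pre Z n)"
  then have "take (length \<sigma>) (pre Z n) = \<sigma>" "length \<sigma> \<le> n"
    using prefix_length_le[OF p] by (simp_all add: prefix_iff_take)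
  then show "length \<sigma> \<le> n \<and> \<sigma> = pre Z (length \<sigma>)" by (simp add: min.absorb1)
next
  assume "length \<sigma> \<le> n \<and> \<sigma> = pre Z (length \<sigma>)"
  then show "prefix \<sigma> (pre Z n)" by (metis prefix_pre)
qed

lemma initial_segment_eq_pre: "initial_segment A n = pre (\<lambda>i. i \<in> A) n"
  by (simp add: initial_segment_def)

lemma in_cylinder_iff: "Z \<in> cylinder \<sigma> \<longleftrightarrow> pre Z (length \<sigma>) = \<sigma>"
proof -
  have "pre Z (length \<sigma>) = \<sigma> \<longleftrightarrow> (\<forall>i<length \<sigma>. Z i = \<sigma> ! i)"
    by (subst list_eq_iff_nth_eq) simp
  then show ?thesis by (simp add: cylinder_def)
qed

section \<open>Computable operations on strings\<close>

definition scomputable :: "nat set \<Rightarrow> (nat \<Rightarrow> bool list) \<Rightarrow> bool" where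
  "scomputable X f \<longleftrightarrow> computable X (\<lambda>n. string_code (f n))"

text \<open>In contrast to \<open>!\<close>, the value beyond the end is fixed to be False, which
  makes the relation decidable for all indices.\<close>

definition bit_at :: "bool list \<Rightarrow> nat \<Rightarrow> bool" where
  "bit_at \<sigma> i \<longleftrightarrow> i < length \<sigma> \<and> \<sigma> ! i"

lemma comp_string_code: "scomputable X f \<Longrightarrow> computable X (\<lambda>n. string_code (f n))"
  by (simp add: scomputable_def)

lemma scomp_dstr: "computable X a \<Longrightarrow> scomputable X (\<lambda>n. dstr (a n))"
  by (simp add: scomputable_def)

lemma scomp_const: "scomputable X (\<lambda>n. \<sigma>)"
  unfolding scomputable_def by (rule comp_const)

lemma comp_compose_string:
  "computable X (\<lambda>m. F (dstr m)) \<Longrightarrow> scomputable X f \<Longrightarrow> computable X (\<lambda>n. F (f n))"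
  using comp_compose[of X "\<lambda>m. F (dstr m)" "\<lambda>n. string_code (f n)"] by (simp add: scomputable_def)

lemma comp_length:
  assumes "scomputable X f"
  shows "computable X (\<lambda>n. length (f n))"
proof (rule comp_compose_string[OF _ assms])
  \<comment> \<open>For a string of length \<open>l\<close>, one plus the code lies in the interval
    from \<open>2 ^ l\<close> to just below \<open>2 ^ Suc l\<close>, so the length counts the
    exponents \<open>Suc k\<close> that fit.\<close>
  have "length (dstr c) = (\<Sum>k<c. of_bool (2 ^ Suc k \<le> Suc c))" for c
  proof -
    have less: "k < length (dstr c) \<Longrightarrow> k < c" for k
      using length_dstr_le[of c] by linarith
    have "2 ^ Suc k \<le> Suc c \<longleftrightarrow> k < length (dstr c)" for k
    proof
      assume "2 ^ Suc k \<le> Suc c"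
      also have "Suc c < 2 ^ Suc (length (dstr c))" using string_code_less[of "dstr c"] by simp
      finally show "k < length (dstr c)" by simp
    next
      assume "k < length (dstr c)"
      then have "(2::nat) ^ Suc k \<le> 2 ^ length (dstr c)" by (intro power_increasing) auto
      also have "\<dots> \<le> Suc c" using string_code_ge[of "dstr c"] by simp
      finally show "2 ^ Suc k \<le> Suc c" .
    qed
    then have "{k. k < c \<and> 2 ^ Suc k \<le> Suc c} = {..<length (dstr c)}" using less by auto
    moreover have "(\<Sum>k<c. of_bool (2 ^ Suc k \<le> Suc c)) = card {k. k < c \<and> 2 ^ Suc k \<le> Suc c}"
      by (simp add: of_bool_def sum.If_cases Int_def lessThan_def del: power_Suc)
    ultimately show ?thesis by simp
  qed
  moreover have "computable X (\<lambda>c. \<Sum>k<c. of_bool (2 ^ Suc k \<le> Suc c))"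
    by (intro comp_intros)
  ultimately show "computable X (\<lambda>m. length (dstr m))" by simp
qed

lemma scomp_take:
  assumes "scomputable X f" "computable X a"
  shows "scomputable X (\<lambda>n. take (a n) (f n))"
proof -
  have "string_code (take m \<sigma>) =
      (if m \<le> length \<sigma> then 2 ^ m + Suc (string_code \<sigma>) mod 2 ^ m - 1 else string_code \<sigma>)" for m \<sigma>
    using string_code_take[of m \<sigma>] by (metis diff_Suc_1 linorder_le_cases take_all)
  moreover have "computable X (\<lambda>n. if a n \<le> length (f n)
      then 2 ^ a n + Suc (string_code (f n)) mod 2 ^ a n - 1 else string_code (f n))"
    by (intro comp_intros comp_length comp_string_code assms)
  ultimately show ?thesis by (simp only: scomputable_def)
qed

lemma scomp_append:
  assumes "scomputable X f" "scomputable X g"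
  shows "scomputable X (\<lambda>n. f n @ g n)"
  unfolding scomputable_def string_code_append
  by (intro comp_intros comp_length comp_string_code assms)

lemma scomp_drop:
  assumes "scomputable X f" "computable X a"
  shows "scomputable X (\<lambda>n. drop (a n) (f n))"
proof -
  have "string_code (drop m \<sigma>) =
      (string_code \<sigma> - string_code (take m \<sigma>)) div 2 ^ length (take m \<sigma>)" for m \<sigma>
    using string_code_append[of "take m \<sigma>" "drop m \<sigma>"] by simp
  moreover have "computable X (\<lambda>n.
      (string_code (f n) - string_code (take (a n) (f n))) div 2 ^ length (take (a n) (f n)))"
    by (intro comp_intros comp_length comp_string_code scomp_take assms)
  ultimately show ?thesis by (simp only: scomputable_def)
qed

lemma scomp_replicate:
  assumes "computable X a"
  shows "scomputable X (\<lambda>n. replicate (a n) False)"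
proof -
  have "string_code (replicate m False) = 2 ^ m - 1" for m
    using string_code_replicate_False[of m] by (metis diff_Suc_1)
  moreover have "computable X (\<lambda>n. 2 ^ a n - 1)" by (intro comp_intros assms)
  ultimately show ?thesis by (simp only: scomputable_def)
qed

lemma dec_bit_at:
  assumes "scomputable X f" "computable X i"
  shows "decidable X (\<lambda>n. bit_at (f n) (i n))"
proof -
  have "bit_at \<sigma> j \<longleftrightarrow> j < length \<sigma> \<and> \<not> even (Suc (string_code \<sigma>) div 2 ^ j)" for \<sigma> j
    unfolding bit_at_def using nth_string_code by blast
  moreover have "decidable X (\<lambda>n. i n < length (f n) \<and> \<not> even (Suc (string_code (f n)) div 2 ^ i n))"
    by (intro comp_intros comp_length comp_string_code assms)
  ultimately show ?thesis by simp
qed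

lemma dec_string_eq:
  assumes "scomputable X f" "scomputable X g"
  shows "decidable X (\<lambda>n. f n = g n)"
  using dec_eq[OF assms[THEN comp_string_code]] by simp

lemma dec_prefix:
  assumes "scomputable X f" "scomputable X g"
  shows "decidable X (\<lambda>n. prefix (f n) (g n))"
  unfolding prefix_iff_take by (intro dec_string_eq scomp_take comp_length assms)

lemma string_code_pre: "Suc (string_code (pre Z m)) = 2 ^ m + (\<Sum>i<m. of_bool (Z i) * 2 ^ i)"
proof (induction m)
  case (Suc m)
  have "string_code (pre Z (Suc m)) = string_code (pre Z m) + 2 ^ m * string_code [Z m]"
    using string_code_append[of "pre Z m" "[Z m]"] by simp
  with Suc show ?case by simp
qed simp

lemma scomp_initial_segment:
  assumes "computable X a"
  shows "scomputable X (\<lambda>n. initial_segment X (a n))"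
proof -
  have "string_code (initial_segment X m) = 2 ^ m + (\<Sum>i<m. of_bool (i \<in> X) * 2 ^ i) - 1" for m
    unfolding initial_segment_eq_pre using string_code_pre[of "\<lambda>i. i \<in> X" m] by (metis diff_Suc_1)
  moreover have "computable X (\<lambda>n. 2 ^ a n + (\<Sum>i<a n. of_bool (i \<in> X) * 2 ^ i) - 1)"
    by (intro comp_intros dec_oracle assms)
  ultimately show ?thesis by (simp only: scomputable_def)
qed

lemmas scomp_intros = comp_length scomp_dstr scomp_const scomp_take scomp_append scomp_drop
  scomp_replicate dec_bit_at dec_string_eq dec_prefix comp_string_code

section \<open>Approximating computations by stages\<close>

abbreviation memb :: "nat \<Rightarrow> nat \<Rightarrow> bool" where "memb F t \<equiv> t \<in> set_decode F"

text \<open>An entry codes the claim that program number \<open>c\<close> maps \<open>n\<close> to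
  \<open>y\<close>.\<close>

abbreviation entry :: "nat \<Rightarrow> nat \<Rightarrow> nat \<Rightarrow> nat" where
  "entry c n y \<equiv> prod_encode (c, prod_encode (n, y))"

lemma dec_memb: "computable X f \<Longrightarrow> computable X g \<Longrightarrow> decidable X (\<lambda>n. memb (f n) (g n))"
  unfolding set_decode_def by simp (intro comp_intros)

text \<open>\<open>just \<alpha> s F c n y\<close>: a rule of \<^const>\<open>eval\<close> derives that program number \<open>c\<close> maps \<open>n\<close> to \<open>y\<close>
  from facts in the finite set coded by \<open>F\<close>, intermediate values being below \<open>s\<close> and oracle
  answers being read off the string \<open>\<alpha>\<close>.\<close>

definition just :: "bool list \<Rightarrow> nat \<Rightarrow> nat \<Rightarrow> nat \<Rightarrow> nat \<Rightarrow> nat \<Rightarrow> bool" where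
  "just \<alpha> s F c n y \<longleftrightarrow>
    c = prod_encode (0, 0) \<and> y = 0 \<or>
    c = prod_encode (1, 0) \<and> y = Suc n \<or>
    c = prod_encode (2, 0) \<and> y = p1 n \<or>
    c = prod_encode (3, 0) \<and> y = p2 n \<or>
    c = prod_encode (4, 0) \<and> n < length \<alpha> \<and> (bit_at \<alpha> n \<and> y = 1 \<or> \<not> bit_at \<alpha> n \<and> y = 0) \<or>
    p1 c = 5 \<and> memb F (entry (p1 (p2 c)) n (p1 y)) \<and> memb F (entry (p2 (p2 c)) n (p2 y)) \<or>
    p1 c = 6 \<and> (\<exists>m<s. memb F (entry (p2 (p2 c)) n m) \<and> memb F (entry (p1 (p2 c)) m y)) \<or>
    p1 c = 7 \<and> p2 n = 0 \<and> memb F (entry (p1 (p2 c)) (p1 n) y) \<or>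
    p1 c = 7 \<and> 0 < p2 n \<and> (\<exists>m<s. memb F (entry c (prod_encode (p1 n, p2 n - 1)) m) \<and>
      memb F (entry (p2 (p2 c)) (prod_encode (p1 n, prod_encode (p2 n - 1, m))) y)) \<or>
    p1 c = 8 \<and> memb F (entry (p2 c) (prod_encode (n, y)) 0) \<and>
      (\<forall>i<y. \<exists>k<s. memb F (entry (p2 c) (prod_encode (n, i)) (Suc k)))"

text \<open>A stage is a finite set of entries coded by binary digits. Stage \<open>Suc s\<close>
  consists of the entries with code at most \<open>s\<close> that follow by one rule from stage
  \<open>s\<close>.\<close>

primrec stg :: "bool list \<Rightarrow> nat \<Rightarrow> nat" where
  "stg \<alpha> 0 = 0"
| "stg \<alpha> (Suc s) =
    (\<Sum>t<Suc s. of_bool (just \<alpha> s (stg \<alpha> s) (p1 t) (p1 (p2 t)) (p2 (p2 t))) * 2 ^ t)"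

definition ev :: "bool list \<Rightarrow> nat \<Rightarrow> nat \<Rightarrow> nat \<Rightarrow> nat \<Rightarrow> bool" where
  "ev \<alpha> s c n y \<longleftrightarrow> memb (stg \<alpha> s) (entry c n y)"

text \<open>The closure rules are applied with all arguments packed as projections of a single
  number, and the general case follows by substitution. Later predicates with several arguments are
  treated in the same way.\<close>

lemma dec_just:
  assumes "scomputable X o'" "computable X s" "computable X F" "computable X c" "computable X n" "computable X y"
  shows "decidable X (\<lambda>m. just (o' m) (s m) (F m) (c m) (n m) (y m))"
proof -
  let ?F = "\<lambda>m. p1 (p2 m)" and ?c = "\<lambda>m. p1 (p2 (p2 m))" and ?n = "\<lambda>m. p1 (p2 (p2 (p2 m)))"
    and ?y = "\<lambda>m. p1 (p2 (p2 (p2 (p2 m))))" and ?o = "\<lambda>m. dstr (p2 (p2 (p2 (p2 (p2 m)))))"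
  have "decidable X (\<lambda>m. just (?o m) (p1 m) (?F m) (?c m) (?n m) (?y m))"
    unfolding just_def by (intro comp_intros scomp_intros dec_memb)
  from dec_compose[OF this, of "\<lambda>m. prod_encode (s m, prod_encode (F m, prod_encode (c m,
    prod_encode (n m, prod_encode (y m, string_code (o' m))))))"]
  show ?thesis by (simp add: assms comp_pair comp_string_code)
qed

lemma comp_stg:
  assumes "scomputable X o'" "computable X s"
  shows "computable X (\<lambda>n. stg (o' n) (s n))"
proof -
  define g where "g n k r = (\<Sum>t<Suc k. of_bool (just (dstr (p1 n)) k r (p1 t) (p1 (p2 t)) (p2 (p2 t))) * 2 ^ t :: nat)"
    for n k r
  have "computable X (\<lambda>m. g (p1 m) (p1 (p2 m)) (p2 (p2 m)))"
    unfolding g_def by (intro comp_intros dec_just scomp_intros)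
  then have "computable X (\<lambda>n. rec_nat 0 (g n) (p2 n))" by (intro comp_rec comp_intros)
  moreover have "rec_nat 0 (g n) k = stg (dstr (p1 n)) k" for n k
    by (induction k) (simp_all add: g_def del: sum.lessThan_Suc)
  ultimately have "computable X (\<lambda>n. stg (dstr (p1 n)) (p2 n))" by simp
  from comp_compose[OF this, of "\<lambda>n. prod_encode (string_code (o' n), s n)"]
  show ?thesis by (simp add: assms comp_pair comp_string_code)
qed

lemma dec_ev:
  assumes "scomputable X o'" "computable X s" "computable X c" "computable X n" "computable X y"
  shows "decidable X (\<lambda>m. ev (o' m) (s m) (c m) (n m) (y m))"
  unfolding ev_def by (intro dec_memb comp_stg comp_intros assms)

lemma memb_stg_Suc:
  "memb (stg \<alpha> (Suc s)) t \<longleftrightarrow>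
    t < Suc s \<and> just \<alpha> s (stg \<alpha> s) (p1 t) (p1 (p2 t)) (p2 (p2 t))"
proof -
  let ?J = "\<lambda>t. just \<alpha> s (stg \<alpha> s) (p1 t) (p1 (p2 t)) (p2 (p2 t))"
  have "stg \<alpha> (Suc s) = set_encode {t. t < Suc s \<and> ?J t}"
    unfolding set_encode_def stg.simps
    using sum.inter_filter[of "{..<Suc s}" "\<lambda>t. 2 ^ t :: nat" ?J]
    by (simp add: of_bool_def if_distrib[of "\<lambda>x. x * _"] del: sum.lessThan_Suc cong: if_cong)
  then show ?thesis by (simp add: set_encode_inverse del: stg.simps)
qed

lemma ev_0 [simp]: "\<not> ev \<alpha> 0 c n y"
  by (simp add: ev_def)

lemma ev_Suc: "ev \<alpha> (Suc s) c n y \<longleftrightarrow> entry c n y \<le> s \<and> just \<alpha> s (stg \<alpha> s) c n y"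
  unfolding ev_def memb_stg_Suc by (simp add: less_Suc_eq_le)

lemma entry_ge: "c \<le> entry c n y" "n \<le> entry c n y" "y \<le> entry c n y"
  by (auto intro: le_prod_encode_1 le_prod_encode_2 order.trans[OF _ le_prod_encode_2])

text \<open>A derived entry has a code below the stage, and the code of a pair bounds its
  components. Hence searches for programs, inputs and outputs can be bounded by the stage.\<close>

lemma ev_bound: "ev \<alpha> s c n y \<Longrightarrow> c < s \<and> n < s \<and> y < s"
  using entry_ge(1)[of c n y] entry_ge(2)[of n c y] entry_ge(3)[of y c n] by (cases s) (auto simp: ev_Suc less_Suc_eq_le intro: order.trans)

text \<open>All rules use \<open>F\<close> and the bound \<open>s\<close> only positively, and the
  oracle clause demands \<open>n < length \<alpha>\<close>, so a longer string gives the same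
  answers.\<close>

lemma just_mono:
  assumes "just \<alpha> s F c n y" "prefix \<alpha> \<alpha>'" "s \<le> s'" "\<And>t. memb F t \<Longrightarrow> memb F' t"
  shows "just \<alpha>' s' F' c n y"
proof -
  have bit: "n < length \<alpha> \<and> (bit_at \<alpha> n \<and> y = 1 \<or> \<not> bit_at \<alpha> n \<and> y = 0) \<longrightarrow>
      n < length \<alpha>' \<and> (bit_at \<alpha>' n \<and> y = 1 \<or> \<not> bit_at \<alpha>' n \<and> y = 0)"
    using assms(2) by (auto simp: prefix_def bit_at_def nth_append)
  have "just \<alpha> s F c n y \<longrightarrow> just \<alpha>' s F c n y"
    unfolding just_def using bit by (intro disj_mono) simp_all
  moreover have "just \<alpha>' s F c n y \<longrightarrow> just \<alpha>' s' F' c n y"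
    unfolding just_def using assms(3,4)
    by (intro disj_mono conj_mono ex_mono all_mono imp_mono) (simp_all del: set_decode_def)
  ultimately show ?thesis using assms(1) by blast
qed

lemma stg_mono:
  assumes "memb (stg \<alpha> s) t" "prefix \<alpha> \<alpha>'" "s \<le> s'"
  shows "memb (stg \<alpha>' s') t"
  using assms
proof (induction s arbitrary: s' t)
  case (Suc s)
  then obtain r where r: "s' = Suc r" "s \<le> r" by (cases s') auto
  from Suc.prems(1) have "t < Suc s" "just \<alpha> s (stg \<alpha> s) (p1 t) (p1 (p2 t)) (p2 (p2 t))"
    unfolding memb_stg_Suc by auto
  moreover have "memb (stg \<alpha>' r) t'" if "memb (stg \<alpha> s) t'" for t'
    using Suc.IH[OF that Suc.prems(2) r(2)] .
  ultimately show ?case unfolding r(1) memb_stg_Suc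
    using just_mono[OF _ Suc.prems(2) r(2)] r(2) by auto
qed simp

lemma ev_mono: "ev \<alpha> s c n y \<Longrightarrow> prefix \<alpha> \<alpha>' \<Longrightarrow> s \<le> s' \<Longrightarrow> ev \<alpha>' s' c n y"
  unfolding ev_def by (rule stg_mono)

lemma ev_intro:
  assumes "just \<alpha> s (stg \<alpha> s) c n y"
  shows "ev \<alpha> (Suc (s + entry c n y)) c n y"
proof -
  let ?r = "s + entry c n y"
  have "memb (stg \<alpha> s) t \<Longrightarrow> memb (stg \<alpha> ?r) t" for t by (erule stg_mono) simp_all
  then have "just \<alpha> ?r (stg \<alpha> ?r) c n y"
    by (intro just_mono[OF assms]) simp_all
  then show ?thesis unfolding ev_Suc by simp
qed

text \<open>The induction runs over stages rather than programs, because the rule for primitive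
  recursion appeals to the same program at a smaller argument.\<close>

lemma ev_sound: "ev (initial_segment X m) s (goedel_number c) n y \<Longrightarrow> eval X c n y"
proof (induction s arbitrary: c n y)
  case (Suc s)
  let ?F = "stg (initial_segment X m) s"
  have IH: "eval X c n y" if "memb ?F (entry (goedel_number c) n y)" for c n y
    using Suc.IH that by (simp add: ev_def)
  have J: "just (initial_segment X m) s ?F (goedel_number c) n y"
    using Suc.prems by (simp add: ev_Suc)
  show ?case
  proof (cases c)
    case Zero
    with J show ?thesis by (auto simp: just_def prod_encode_eq intro: eval_Zero)
  next
    case Succ
    with J show ?thesis by (auto simp: just_def prod_encode_eq intro: eval_Succ)
  next
    case Fst
    with J show ?thesis by (auto simp: just_def prod_encode_eq intro: eval_Fst')
  next
    case Snd
    with J show ?thesis by (auto simp: just_def prod_encode_eq intro: eval_Snd')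
  next
    case Oracle
    with J have "y = of_bool (n \<in> X)"
      by (auto simp: just_def prod_encode_eq bit_at_def initial_segment_def)
    with Oracle show ?thesis by (simp only: eval_Oracle)
  next
    case (Tuple f g)
    with J have "eval X f n (p1 y)" "eval X g n (p2 y)"
      by (auto simp: just_def prod_encode_eq intro!: IH)
    from eval_Tuple[OF this] Tuple show ?thesis by simp
  next
    case (Comp f g)
    with J obtain k where "eval X g n k" "eval X f k y"
      by (auto simp: just_def prod_encode_eq dest!: IH)
    from eval_Comp[OF this] Comp show ?thesis by simp
  next
    case (Prec f g)
    have n: "prod_encode (p1 n, p2 n) = n" by simp
    show ?thesis
    proof (cases "p2 n")
      case 0
      with J Prec have "eval X f (p1 n) y" by (auto simp: just_def prod_encode_eq dest!: IH)
      from eval_Prec_0[OF this] n Prec 0 show ?thesis by metis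
    next
      case (Suc k)
      have P: "goedel_number (Prec f g) = prod_encode (7, prod_encode (goedel_number f, goedel_number g))"
        by simp
      from J Suc obtain r where
        "memb ?F (entry (goedel_number (Prec f g)) (prod_encode (p1 n, k)) r)"
        "memb ?F (entry (goedel_number g) (prod_encode (p1 n, prod_encode (k, r))) y)"
        unfolding Prec just_def by (auto simp: prod_encode_eq)
      from eval_Prec_Suc[OF this[THEN IH]] n Prec Suc show ?thesis by metis
    qed
  next
    case (Mu f)
    with J have "eval X f (prod_encode (n, y)) 0" "\<forall>i<y. \<exists>k. eval X f (prod_encode (n, i)) (Suc k)"
      by (auto simp: just_def prod_encode_eq intro: IH)
    with Mu show ?thesis by (auto intro: eval_Mu)
  qed
qed simp

lemma ev_complete_aux:
  assumes "just (initial_segment X m) s (stg (initial_segment X m) s) c n y"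
  shows "\<exists>s. ev (initial_segment X s) s c n y"
proof -
  from ev_intro[OF assms] obtain t where t: "ev (initial_segment X m) t c n y" by blast
  have "ev (initial_segment X (m + t)) (m + t) c n y"
    by (rule ev_mono[OF t]) (auto simp: initial_segment_eq_pre intro: prefix_pre)
  then show ?thesis by blast
qed

lemma ev_initial_segment_mono:
  "ev (initial_segment X s) s c n y \<Longrightarrow> s \<le> t \<Longrightarrow> ev (initial_segment X t) t c n y"
  by (erule ev_mono) (auto simp: initial_segment_eq_pre intro: prefix_pre)

text \<open>The finitely many premises of a rule are all present at the sum of their stages, where
  \<open>ev_bound\<close> also bounds the intermediate values. Stage and length of the oracle string
  are kept equal throughout.\<close>

lemma ev_complete: "eval X c n y \<Longrightarrow> \<exists>s. ev (initial_segment X s) s (goedel_number c) n y"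
proof (induction rule: eval.induct)
  case (eval_Zero n)
  show ?case by (rule ev_complete_aux[of X 0 0]) (simp add: just_def)
next
  case (eval_Succ n)
  show ?case by (rule ev_complete_aux[of X 0 0]) (simp add: just_def)
next
  case (eval_Fst a b)
  show ?case by (rule ev_complete_aux[of X 0 0]) (simp add: just_def)
next
  case (eval_Snd a b)
  show ?case by (rule ev_complete_aux[of X 0 0]) (simp add: just_def)
next
  case (eval_Oracle n)
  show ?case
    by (rule ev_complete_aux[of X "Suc n" 0])
      (simp add: just_def bit_at_def initial_segment_def del: upt_Suc)
next
  case (eval_Tuple f n a g b)
  then obtain s t where "ev (initial_segment X s) s (goedel_number f) n a"
    "ev (initial_segment X t) t (goedel_number g) n b" by blast
  then have "ev (initial_segment X (s + t)) (s + t) (goedel_number f) n a"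
    "ev (initial_segment X (s + t)) (s + t) (goedel_number g) n b"
    by (auto intro: ev_initial_segment_mono)
  then show ?case
    by (intro ev_complete_aux[of X "s + t" "s + t"]) (simp add: just_def ev_def)
next
  case (eval_Comp g n k f y)
  then obtain s t where "ev (initial_segment X s) s (goedel_number g) n k"
    "ev (initial_segment X t) t (goedel_number f) k y" by blast
  then have *: "ev (initial_segment X (s + t)) (s + t) (goedel_number g) n k"
    "ev (initial_segment X (s + t)) (s + t) (goedel_number f) k y"
    by (auto intro: ev_initial_segment_mono)
  show ?case
    using * ev_bound[OF *(1)]
    by (intro ev_complete_aux[of X "s + t" "s + t"]) (auto simp: just_def ev_def)
next
  case (eval_Prec_0 f a k g)
  then obtain s where "ev (initial_segment X s) s (goedel_number f) a k" by blast
  then show ?case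
    by (intro ev_complete_aux[of X "s" "s"]) (simp add: just_def ev_def)
next
  case (eval_Prec_Suc f g a n k y)
  then obtain s t where "ev (initial_segment X s) s (goedel_number (Prec f g)) (prod_encode (a, n)) k"
    "ev (initial_segment X t) t (goedel_number g) (prod_encode (a, prod_encode (n, k))) y" by blast
  then have *: "ev (initial_segment X (s + t)) (s + t) (goedel_number (Prec f g)) (prod_encode (a, n)) k"
    "ev (initial_segment X (s + t)) (s + t) (goedel_number g) (prod_encode (a, prod_encode (n, k))) y"
    by (auto intro: ev_initial_segment_mono)
  show ?case
    using * ev_bound[OF *(1)]
    by (intro ev_complete_aux[of X "s + t" "s + t"]) (auto simp: just_def ev_def)
next
  case (eval_Mu f a m)
  then obtain s where s: "ev (initial_segment X s) s (goedel_number f) (prod_encode (a, m)) 0" by blast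
  from eval_Mu have "\<forall>i. \<exists>k t. i < m \<longrightarrow>
    ev (initial_segment X t) t (goedel_number f) (prod_encode (a, i)) (Suc k)" by blast
  then obtain k t where kt: "\<And>i. i < m \<Longrightarrow>
    ev (initial_segment X (t i)) (t i) (goedel_number f) (prod_encode (a, i)) (Suc (k i))" by metis
  define r where "r = s + (\<Sum>i<m. t i)"
  have "t i \<le> r" if "i < m" for i
    unfolding r_def using member_le_sum[of i "{..<m}" t] that by simp
  then have 1: "ev (initial_segment X r) r (goedel_number f) (prod_encode (a, i)) (Suc (k i))" if "i < m" for i
    using kt that ev_initial_segment_mono by blast
  moreover have 2: "ev (initial_segment X r) r (goedel_number f) (prod_encode (a, m)) 0"
    using s ev_initial_segment_mono unfolding r_def by force
  moreover have "k i < r" if "i < m" for i using ev_bound[OF 1[OF that]] by simp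
  ultimately show ?case
    by (intro ev_complete_aux[of X r r]) (auto simp: just_def ev_def)
qed

lemma eval_iff_ev: "eval X c n y \<longleftrightarrow> (\<exists>s. ev (initial_segment X s) s (goedel_number c) n y)"
  using ev_sound ev_complete by blast

definition ev0 :: "nat \<Rightarrow> nat \<Rightarrow> nat \<Rightarrow> nat \<Rightarrow> bool" where
  "ev0 s c n y \<longleftrightarrow> ev (replicate s False) s c n y"

lemma initial_segment_empty: "initial_segment {} s = replicate s False"
  by (simp add: initial_segment_def map_replicate_const)

lemma eval_empty_iff_ev0: "eval {} c n y \<longleftrightarrow> (\<exists>s. ev0 s (goedel_number c) n y)"
  unfolding eval_iff_ev initial_segment_empty ev0_def ..

lemma ev0_mono: "ev0 s c n y \<Longrightarrow> s \<le> t \<Longrightarrow> ev0 t c n y"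
  using ev_initial_segment_mono[of "{}"] by (simp add: initial_segment_empty ev0_def)

lemma ev0_bound: "ev0 s c n y \<Longrightarrow> c < s \<and> n < s \<and> y < s"
  unfolding ev0_def by (rule ev_bound)

lemma ev0_sound: "ev0 s (goedel_number c) n y \<Longrightarrow> eval {} c n y"
  unfolding eval_empty_iff_ev0 by blast

lemma dec_ev0:
  assumes "computable X s" "computable X c" "computable X n" "computable X y"
  shows "decidable X (\<lambda>m. ev0 (s m) (c m) (n m) (y m))"
  unfolding ev0_def by (intro dec_ev scomp_intros assms)

section \<open>Measure on Cantor space\<close>

interpretation flips: product_prob_space "\<lambda>_::nat. measure_pmf (bernoulli_pmf (1 / 2))" UNIV
  by unfold_locales

interpretation coin: prob_space coin_measure
  unfolding coin_measure_def by (rule prob_space_PiM) (rule prob_space_measure_pmf)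

lemma space_coin_measure [simp]: "space coin_measure = UNIV"
  unfolding coin_measure_def by (simp add: space_PiM PiE_UNIV_domain)

lemma measurable_coordinate [measurable]: "(\<lambda>Z. Z i) \<in> measurable coin_measure (count_space UNIV)"
proof -
  have "(\<lambda>Z. Z i) \<in> measurable coin_measure (measure_pmf (bernoulli_pmf (1 / 2)))"
    unfolding coin_measure_def by simp
  then show ?thesis by (simp add: measurable_def)
qed

lemma measurable_pre [measurable]: "(\<lambda>Z. pre Z m) \<in> measurable coin_measure (count_space UNIV)"
proof (induction m)
  case (Suc m)
  note [measurable] = Suc
  have "(\<lambda>Z. pre Z m @ [Z m]) \<in> measurable coin_measure (count_space UNIV)" by measurable
  then show ?case by simp
qed simp

lemma sets_coin_measure [measurable]: "{Z. P (pre Z m)} \<in> sets coin_measure"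
proof -
  have "{Z \<in> space coin_measure. P (pre Z m)} \<in> sets coin_measure" by measurable
  then show ?thesis by simp
qed

lemma cylinder_eq: "cylinder \<sigma> = {Z. pre Z (length \<sigma>) = \<sigma>}"
  by (auto simp: in_cylinder_iff)

lemma sets_cylinder [measurable]: "cylinder \<sigma> \<in> sets coin_measure"
  unfolding cylinder_eq by measurable

lemma measure_cylinder: "measure coin_measure (cylinder \<sigma>) = (1 / 2) ^ length \<sigma>"
proof -
  let ?M = "\<lambda>_::nat. measure_pmf (bernoulli_pmf (1 / 2))"
  have "cylinder \<sigma> = prod_emb UNIV ?M {..<length \<sigma>} (Pi\<^sub>E {..<length \<sigma>} (\<lambda>i. {\<sigma> ! i}))"
    by (auto simp: cylinder_def prod_emb_def PiE_def Pi_def)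
  then have "measure coin_measure (cylinder \<sigma>) =
      (\<Prod>i<length \<sigma>. measure (measure_pmf (bernoulli_pmf (1 / 2))) {\<sigma> ! i})"
    unfolding coin_measure_def by (simp only: flips.measure_PiM_emb[OF subset_UNIV] finite_lessThan
        sets_measure_pmf UNIV_I Pow_UNIV)
  also have "\<dots> = (\<Prod>i<length \<sigma>. 1 / 2)"
    by (intro prod.cong refl) (simp add: measure_pmf_single pmf_bernoulli_half)
  finally show ?thesis by simp
qed

lemma comparable_if_cylinders_meet:
  "cylinder \<sigma> \<inter> cylinder \<tau> \<noteq> {} \<Longrightarrow> prefix \<sigma> \<tau> \<or> prefix \<tau> \<sigma>"
  by (auto simp: in_cylinder_iff) (metis prefix_pre nle_le)

lemma cylinder_mono: "prefix \<sigma> \<tau> \<Longrightarrow> cylinder \<tau> \<subseteq> cylinder \<sigma>"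
  by (auto simp: cylinder_def prefix_def nth_append)

lemma pre_in_cylinder [simp]: "Z \<in> cylinder (pre Z m)"
  by (simp add: in_cylinder_iff)

lemma in_cylinder_prefix: "Z \<in> cylinder \<sigma> \<Longrightarrow> length \<sigma> \<le> m \<Longrightarrow> prefix \<sigma> (pre Z m)"
  by (metis in_cylinder_iff prefix_pre)

lemma measure_UN_cylinder:
  assumes "finite F" "prefix_free F"
  shows "measure coin_measure (\<Union>\<sigma>\<in>F. cylinder \<sigma>) = (\<Sum>\<sigma>\<in>F. (1 / 2) ^ length \<sigma>)"
proof -
  have "disjoint_family_on cylinder F"
    unfolding disjoint_family_on_def
    using comparable_if_cylinders_meet assms(2) unfolding prefix_free_def by metis
  then show ?thesis
    using assms(1) by (subst coin.finite_measure_finite_Union) (auto simp: measure_cylinder)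
qed

lemma finite_strings_length: "finite {\<sigma> :: bool list. length \<sigma> = m \<and> P \<sigma>}"
  by (rule finite_subset[OF _ finite_lists_length_eq[of UNIV m]]) auto

lemma finite_strings_length_le: "finite {\<sigma> :: bool list. \<sigma> \<in> A \<and> length \<sigma> \<le> m}"
  by (rule finite_subset[OF _ finite_lists_length_le[of UNIV m]]) auto

lemma prefix_eq_length: "prefix \<sigma> \<tau> \<Longrightarrow> length \<sigma> = length \<tau> \<Longrightarrow> \<sigma> = \<tau>"
  by (auto simp: prefix_def)

text \<open>Counting strings of one length computes the measure of a clopen set. Comparisons of such
  measures with dyadic bounds thereby become decidable statements about natural numbers.\<close>

lemma measure_level:
  "measure coin_measure {Z. P (pre Z m)} = card {\<sigma>. length \<sigma> = m \<and> P \<sigma>} / 2 ^ m"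
proof -
  let ?F = "{\<sigma>. length \<sigma> = m \<and> P \<sigma>}"
  have "{Z. P (pre Z m)} = (\<Union>\<sigma>\<in>?F. cylinder \<sigma>)"
  proof
    show "{Z. P (pre Z m)} \<subseteq> (\<Union>\<sigma>\<in>?F. cylinder \<sigma>)"
      by (auto intro!: exI[of _ "pre _ m"])
  qed (auto simp: in_cylinder_iff)
  moreover have "prefix_free ?F"
    unfolding prefix_free_def by (auto intro: prefix_eq_length)
  ultimately show ?thesis
    using measure_UN_cylinder[OF finite_strings_length[of m P]] by (simp add: power_one_over)
qed

section \<open>Open sets generated by sets of strings\<close>

definition ext_closed :: "(bool list \<Rightarrow> bool) \<Rightarrow> bool" where
  "ext_closed H \<longleftrightarrow> (\<forall>\<sigma> \<tau>. H \<sigma> \<longrightarrow> prefix \<sigma> \<tau> \<longrightarrow> H \<tau>)"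

definition opn :: "(bool list \<Rightarrow> bool) \<Rightarrow> (nat \<Rightarrow> bool) set" where
  "opn H = {Z. \<exists>m. H (pre Z m)}"

lemma ext_closedD: "ext_closed H \<Longrightarrow> H \<sigma> \<Longrightarrow> prefix \<sigma> \<tau> \<Longrightarrow> H \<tau>"
  unfolding ext_closed_def by blast

lemma ext_closed_pre: "ext_closed H \<Longrightarrow> H (pre Z m) \<Longrightarrow> m \<le> n \<Longrightarrow> H (pre Z n)"
  by (erule ext_closedD) (auto intro: prefix_pre)

lemma opn_eq_UN: "opn H = (\<Union>m. {Z. H (pre Z m)})"
  unfolding opn_def by auto

lemma sets_opn [measurable]: "opn H \<in> sets coin_measure"
  unfolding opn_eq_UN by measurable

lemma UN_cylinder_eq_opn: "(\<Union>\<sigma>\<in>{\<sigma>. H \<sigma>}. cylinder \<sigma>) = opn H"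
proof
  show "opn H \<subseteq> (\<Union>\<sigma>\<in>{\<sigma>. H \<sigma>}. cylinder \<sigma>)"
    unfolding opn_def using pre_in_cylinder by blast
  show "(\<Union>\<sigma>\<in>{\<sigma>. H \<sigma>}. cylinder \<sigma>) \<subseteq> opn H"
    unfolding opn_def by (clarsimp simp: cylinder_eq) metis
qed

lemma measure_UN_le:
  assumes "\<And>m::nat. A m \<in> sets coin_measure" "incseq A" "\<And>m. measure coin_measure (A m) \<le> c"
  shows "measure coin_measure (\<Union>m. A m) \<le> c"
  using coin.finite_Lim_measure_incseq[of A] assms
  by (intro LIMSEQ_le_const2[of "\<lambda>m. measure coin_measure (A m)"]) auto

lemma measure_opn_le:
  assumes "ext_closed H" "\<And>m. measure coin_measure {Z. H (pre Z m)} \<le> c"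
  shows "measure coin_measure (opn H) \<le> c"
  unfolding opn_eq_UN using assms
  by (intro measure_UN_le) (auto simp: incseq_def intro: ext_closed_pre)

lemma measure_level_le_opn: "measure coin_measure {Z. H (pre Z m)} \<le> measure coin_measure (opn H)"
  by (intro coin.finite_measure_mono sets_opn) (auto simp: opn_def)

text \<open>Enumeration stops before the measure exceeds the bound.\<close>

definition trim :: "real \<Rightarrow> (bool list \<Rightarrow> bool) \<Rightarrow> bool list \<Rightarrow> bool" where
  "trim r H \<sigma> \<longleftrightarrow> (\<exists>m\<le>length \<sigma>. H (take m \<sigma>) \<and> real (card {\<tau>. length \<tau> = m \<and> H \<tau>}) \<le> r * 2 ^ m)"

lemma ext_closed_trim: "ext_closed (trim r H)"
  unfolding ext_closed_def
proof (intro allI impI)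
  fix \<sigma> \<tau> assume "trim r H \<sigma>" "prefix \<sigma> \<tau>"
  then obtain m where "m \<le> length \<sigma>" "H (take m \<sigma>)" "real (card {\<tau>. length \<tau> = m \<and> H \<tau>}) \<le> r * 2 ^ m"
    unfolding trim_def by blast
  then show "trim r H \<tau>" using \<open>prefix \<sigma> \<tau>\<close>
    unfolding trim_def by (intro exI[of _ m]) (auto simp: prefix_def)
qed

text \<open>The levels of \<open>H\<close> increase, so everything accepted up to length
  \<open>m\<close> is contained in the last accepted level, whose measure is at most
  \<open>r\<close>.\<close>

lemma measure_trim:
  assumes "ext_closed H" "0 \<le> r"
  shows "measure coin_measure (opn (trim r H)) \<le> r"
proof (rule measure_opn_le[OF ext_closed_trim])
  fix m
  let ?I = "{i. i \<le> m \<and> real (card {\<tau>. length \<tau> = i \<and> H \<tau>}) \<le> r * 2 ^ i}"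
  show "measure coin_measure {Z. trim r H (pre Z m)} \<le> r"
  proof (cases "?I = {}")
    case True
    then have "{Z. trim r H (pre Z m)} = {}" by (auto simp: trim_def)
    with assms(2) show ?thesis by simp
  next
    case False
    let ?i = "Max ?I"
    have i: "?i \<in> ?I" using False by (intro Max_in) auto
    have "{Z. trim r H (pre Z m)} \<subseteq> {Z. H (pre Z ?i)}"
    proof safe
      fix Z assume "trim r H (pre Z m)"
      then obtain j where j: "j \<le> m" "H (pre Z j)" "real (card {\<tau>. length \<tau> = j \<and> H \<tau>}) \<le> r * 2 ^ j"
        by (auto simp: trim_def min_def)
      then have "j \<le> ?i" by (intro Max_ge) auto
      with j(2) show "H (pre Z ?i)" using ext_closed_pre[OF assms(1)] by blast
    qed
    then have "measure coin_measure {Z. trim r H (pre Z m)} \<le> measure coin_measure {Z. H (pre Z ?i)}"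
      by (intro coin.finite_measure_mono) auto
    also have "\<dots> \<le> r" using i unfolding measure_level by (simp add: divide_le_eq)
    finally show ?thesis .
  qed
qed

text \<open>If the whole open set obeys the bound, trimming removes nothing.\<close>

lemma trim_intro:
  assumes "measure coin_measure (opn H) \<le> r" "H \<sigma>"
  shows "trim r H \<sigma>"
proof -
  have "measure coin_measure {Z. H (pre Z (length \<sigma>))} \<le> r"
    using measure_level_le_opn[of H "length \<sigma>"] assms(1) by linarith
  with assms(2) show ?thesis
    unfolding trim_def by (intro exI[of _ "length \<sigma>"]) (simp add: measure_level divide_le_eq)
qed

section \<open>Minimal strings and measures of unions\<close>

lemma prefix_free_minimal:
  "prefix_free {\<sigma>. G \<sigma> \<and> (\<forall>\<tau>. strict_prefix \<tau> \<sigma> \<longrightarrow> \<not> G \<tau>)}"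
  unfolding prefix_free_def strict_prefix_def by blast

lemma minimal_prefix_exists:
  "G \<sigma> \<Longrightarrow> \<exists>\<rho>. prefix \<rho> \<sigma> \<and> G \<rho> \<and> (\<forall>\<tau>. strict_prefix \<tau> \<rho> \<longrightarrow> \<not> G \<tau>)"
proof (induction "length \<sigma>" arbitrary: \<sigma> rule: less_induct)
  case less
  show ?case
  proof (cases "\<exists>\<tau>. strict_prefix \<tau> \<sigma> \<and> G \<tau>")
    case True
    then obtain \<tau> where "strict_prefix \<tau> \<sigma>" "G \<tau>" by blast
    with less.hyps[of \<tau>] show ?thesis
      by (meson prefix_length_less prefix_order.dual_order.trans strict_prefix_def)
  qed (use less.prems in blast)
qed

text \<open>The minimal strings of \<open>G\<close> generate the same open set and are pairwise
  incomparable, so the members of \<open>F\<close> extending different ones are disjoint families.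
  Adding up the hypothesis over them counts no member of \<open>F\<close> twice.\<close>

lemma maximal_inequality:
  fixes F :: "bool list set"
  assumes "finite F" "0 < a"
    and G: "\<And>\<sigma>. G \<sigma> \<Longrightarrow> (1 / 2) ^ length \<sigma> \<le> a * (\<Sum>\<rho>\<in>{\<rho>\<in>F. prefix \<sigma> \<rho>}. (1 / 2) ^ length \<rho>)"
  shows "measure coin_measure (opn G) \<le> a * (\<Sum>\<rho>\<in>F. (1 / 2) ^ length \<rho>)"
proof -
  let ?w = "\<lambda>\<rho>::bool list. (1 / 2 :: real) ^ length \<rho>"
  define A where "A = {\<sigma>. G \<sigma> \<and> (\<forall>\<tau>. strict_prefix \<tau> \<sigma> \<longrightarrow> \<not> G \<tau>)}"
  have pf: "prefix_free A" unfolding A_def by (rule prefix_free_minimal)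
  \<comment> \<open>A string of \<open>G\<close> needs positive weight of \<open>F\<close> above it,
    hence is a prefix of some member of the finite set \<open>F\<close>.\<close>
  have "A \<subseteq> (\<Union>\<rho>\<in>F. set (prefixes \<rho>))"
  proof
    fix \<sigma> assume "\<sigma> \<in> A"
    then have "G \<sigma>" by (simp add: A_def)
    from G[OF this] have "{\<rho>\<in>F. prefix \<sigma> \<rho>} \<noteq> {}"
      by (metis (no_types, lifting) mult_zero_right not_le sum.empty zero_less_divide_1_iff
          zero_less_numeral zero_less_power)
    then show "\<sigma> \<in> (\<Union>\<rho>\<in>F. set (prefixes \<rho>))" by auto
  qed
  then have fin: "finite A" using assms(1) by (meson finite_UN finite_set finite_subset)
  have "opn G \<subseteq> (\<Union>\<sigma>\<in>A. cylinder \<sigma>)"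
  proof
    fix Z assume "Z \<in> opn G"
    then obtain m where "G (pre Z m)" unfolding opn_def by blast
    from minimal_prefix_exists[of G, OF this] obtain \<rho> where
      "prefix \<rho> (pre Z m)" "\<rho> \<in> A" unfolding A_def by blast
    then show "Z \<in> (\<Union>\<sigma>\<in>A. cylinder \<sigma>)" using cylinder_mono by fastforce
  qed
  then have "measure coin_measure (opn G) \<le> measure coin_measure (\<Union>\<sigma>\<in>A. cylinder \<sigma>)"
    using fin by (intro coin.finite_measure_mono) auto
  also have "\<dots> = (\<Sum>\<sigma>\<in>A. ?w \<sigma>)" by (rule measure_UN_cylinder[OF fin pf])
  also have "\<dots> \<le> (\<Sum>\<sigma>\<in>A. a * (\<Sum>\<rho>\<in>{\<rho>\<in>F. prefix \<sigma> \<rho>}. ?w \<rho>))"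
    by (intro sum_mono G) (simp add: A_def)
  also have "\<dots> = a * (\<Sum>\<rho>\<in>(\<Union>\<sigma>\<in>A. {\<rho>\<in>F. prefix \<sigma> \<rho>}). ?w \<rho>)"
  proof -
    have "{\<rho>\<in>F. prefix \<sigma> \<rho>} \<inter> {\<rho>\<in>F. prefix \<tau> \<rho>} = {}" if "\<sigma> \<in> A" "\<tau> \<in> A" "\<sigma> \<noteq> \<tau>" for \<sigma> \<tau>
    proof -
      have "\<not> prefix \<sigma> \<tau>" "\<not> prefix \<tau> \<sigma>" using that pf unfolding prefix_free_def by blast+
      then show ?thesis using prefix_same_cases by blast
    qed
    then show ?thesis
      using assms(1) fin by (subst sum.UNION_disjoint) (auto simp: sum_distrib_left)
  qed
  also have "\<dots> \<le> a * (\<Sum>\<rho>\<in>F. ?w \<rho>)"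
    using assms(1,2) by (intro mult_left_mono sum_mono2) auto
  finally show ?thesis .
qed

text \<open>Continuity from below along the length of strings reduces a countable union to finite
  ones.\<close>

lemma measure_UN_strings_le:
  fixes S :: "bool list set"
  assumes "\<And>\<sigma>. A \<sigma> \<in> sets coin_measure"
    and "\<And>m. measure coin_measure (\<Union>\<sigma>\<in>{\<sigma>. \<sigma> \<in> S \<and> length \<sigma> \<le> m}. A \<sigma>) \<le> c"
  shows "measure coin_measure (\<Union>\<sigma>\<in>S. A \<sigma>) \<le> c"
proof -
  have "(\<Union>\<sigma>\<in>S. A \<sigma>) = (\<Union>m. \<Union>\<sigma>\<in>{\<sigma>. \<sigma> \<in> S \<and> length \<sigma> \<le> m}. A \<sigma>)" by auto
  moreover have "measure coin_measure (\<Union>m. \<Union>\<sigma>\<in>{\<sigma>. \<sigma> \<in> S \<and> length \<sigma> \<le> m}. A \<sigma>) \<le> c"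
  proof (rule measure_UN_le)
    show "(\<Union>\<sigma>\<in>{\<sigma>. \<sigma> \<in> S \<and> length \<sigma> \<le> m}. A \<sigma>) \<in> sets coin_measure" for m
      by (rule sets.finite_UN[OF finite_strings_length_le assms(1)])
    show "incseq (\<lambda>m. \<Union>\<sigma>\<in>{\<sigma>. \<sigma> \<in> S \<and> length \<sigma> \<le> m}. A \<sigma>)"
      unfolding incseq_def by (intro allI impI UN_mono) auto
  qed (rule assms(2))
  ultimately show ?thesis by simp
qed

text \<open>Incomparable strings have disjoint cylinders, so a bound \<open>c\<close> on the
  proportion in each cylinder is a bound on the proportion in their union.\<close>

lemma measure_UN_prefix_free_le:
  assumes "prefix_free S" and A: "\<And>\<sigma>. A \<sigma> \<in> sets coin_measure"
    and "0 \<le> c" "\<And>\<sigma>. \<sigma> \<in> S \<Longrightarrow> measure coin_measure (A \<sigma>) \<le> c * (1 / 2) ^ length \<sigma>"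
  shows "measure coin_measure (\<Union>\<sigma>\<in>S. A \<sigma>) \<le> c * measure coin_measure (\<Union>\<sigma>\<in>S. cylinder \<sigma>)"
proof (rule measure_UN_strings_le[OF A])
  fix m
  let ?S = "{\<sigma>. \<sigma> \<in> S \<and> length \<sigma> \<le> m}"
  have fin: "finite ?S" by (rule finite_strings_length_le)
  have pf: "prefix_free ?S" using assms(1) by (auto simp: prefix_free_def)
  have "measure coin_measure (\<Union>\<sigma>\<in>?S. A \<sigma>) \<le> (\<Sum>\<sigma>\<in>?S. measure coin_measure (A \<sigma>))"
    using fin A by (intro coin.finite_measure_subadditive_finite) auto
  also have "\<dots> \<le> (\<Sum>\<sigma>\<in>?S. c * (1 / 2) ^ length \<sigma>)" using assms(4) by (intro sum_mono) auto
  also have "\<dots> = c * measure coin_measure (\<Union>\<sigma>\<in>?S. cylinder \<sigma>)"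
    by (simp add: measure_UN_cylinder[OF fin pf] sum_distrib_left)
  also have "\<dots> \<le> c * measure coin_measure (\<Union>\<sigma>\<in>S. cylinder \<sigma>)"
  proof (intro mult_left_mono coin.finite_measure_mono assms(3))
    show "(\<Union>\<sigma>\<in>S. cylinder \<sigma>) \<in> sets coin_measure"
      using sets_opn[of "\<lambda>\<sigma>. \<sigma> \<in> S"] UN_cylinder_eq_opn[of "\<lambda>\<sigma>. \<sigma> \<in> S"] by simp
  qed auto
  finally show "measure coin_measure (\<Union>\<sigma>\<in>?S. A \<sigma>) \<le> c * measure coin_measure (\<Union>\<sigma>\<in>S. cylinder \<sigma>)" .
qed

section \<open>Martin-Loef and Solovay tests\<close>

text \<open>This is the form in which tests are applied: membership in the enumerated set of strings
  is given by a decidable relation with an unbounded witness \<open>s\<close>.\<close>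

lemma Martin_Loef_random_avoids:
  assumes X: "Martin_Loef_random X"
    and D: "decidable {} (\<lambda>m. D (p1 (p1 m)) (dstr (p2 (p1 m))) (p2 m))"
    and le: "\<And>n. measure coin_measure (opn (\<lambda>\<sigma>. \<exists>s. D n \<sigma> s)) \<le> (1 / 2) ^ n"
  shows "\<exists>n. (\<lambda>i. i \<in> X) \<notin> opn (\<lambda>\<sigma>. \<exists>s. D n \<sigma> s)"
proof -
  let ?U = "\<lambda>n. opn (\<lambda>\<sigma>. \<exists>s. D n \<sigma> s)"
  let ?W = "{w. \<exists>s. D (p1 w) (dstr (p2 w)) s}"
  have "comp_enumerable ?W" using D by (rule comp_enumerable_dec_ex)
  moreover have "?U n = (\<Union>\<sigma>\<in>{\<sigma>. prod_encode (n, string_code \<sigma>) \<in> ?W}. cylinder \<sigma>)" for n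
    using UN_cylinder_eq_opn[of "\<lambda>\<sigma>. \<exists>s. D n \<sigma> s"] by simp
  ultimately have "uniformly_Sigma01 ?U" unfolding uniformly_Sigma01_def by blast
  with le have "Martin_Loef_test ?U" by (simp add: Martin_Loef_test_def)
  with X show ?thesis unfolding Martin_Loef_random_def by blast
qed

text \<open>Strings of length \<open>l\<close> have codes below \<open>2 ^ Suc l\<close>, so a
  bounded sum counts them.\<close>

lemma comp_card_strings:
  assumes "computable X b" "decidable X (\<lambda>m. P (p1 m) (dstr (p2 m)))"
  shows "computable X (\<lambda>n. card {\<sigma>. length \<sigma> = b n \<and> P n \<sigma>})"
proof -
  have "card {\<sigma>. length \<sigma> = l \<and> Q \<sigma>} =
      (\<Sum>c<2 ^ Suc l. of_bool (length (dstr c) = l \<and> Q (dstr c)))" for l Q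
  proof -
    let ?A = "{c \<in> {..<2 ^ Suc l}. length (dstr c) = l \<and> Q (dstr c)}"
    have "c < 2 ^ Suc l" if "length (dstr c) = l" for c
      using string_code_less[of "dstr c"] that by simp
    then have "{\<sigma>. length \<sigma> = l \<and> Q \<sigma>} = dstr ` ?A"
      by (auto simp: image_iff) (metis dstr_string_code)
    moreover have "inj_on dstr ?A" by (simp add: inj_on_def)
    ultimately have "card {\<sigma>. length \<sigma> = l \<and> Q \<sigma>} = card ?A" by (simp add: card_image)
    also have "\<dots> = (\<Sum>c<2 ^ Suc l. of_bool (length (dstr c) = l \<and> Q (dstr c)))"
      by (simp add: of_bool_def sum.If_cases Int_def)
    finally show ?thesis .
  qed
  moreover have "computable X (\<lambda>n. \<Sum>c<2 ^ Suc (b n). of_bool (length (dstr c) = b n \<and> P n (dstr c)))"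
    by (intro comp_intros scomp_intros assms comp_compose[OF assms(1)])
  ultimately show ?thesis by simp
qed

text \<open>By Markov's inequality, at least \<open>k * 2 ^ n\<close> of the events happen with
  probability at most \<open>C / (k * 2 ^ n)\<close>. Since \<open>C \<le> k\<close>, these sets
  form a Martin-Loef test, and a point in infinitely many events would lie in all of them.\<close>

lemma Solovay_finite:
  fixes H :: "nat \<Rightarrow> bool list \<Rightarrow> bool" and C :: real
  assumes X: "Martin_Loef_random X"
    and D: "decidable {} (\<lambda>m. H (p1 m) (dstr (p2 m)))"
    and ext: "\<And>i. ext_closed (H i)"
    and le: "\<And>N m. (\<Sum>i<N. measure coin_measure {Z. H i (pre Z m)}) \<le> C"
  shows "finite {i. (\<lambda>i. i \<in> X) \<in> opn (H i)}"
proof (rule ccontr)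
  assume inf: "infinite {i. (\<lambda>i. i \<in> X) \<in> opn (H i)}"
  let ?Z = "\<lambda>i. i \<in> X"
  obtain k :: nat where k: "C \<le> k" "0 < k"
    using real_arch_simple[of "max C 1"] by (metis max.bounded_iff of_nat_0_less_iff zero_less_one order.strict_trans2)
  \<comment> \<open>Only events with index below the length of the string are counted, which makes
    \<open>T\<close> decidable.\<close>
  define T where "T n \<sigma> \<longleftrightarrow> k * 2 ^ n \<le> (\<Sum>i<length \<sigma>. of_bool (H i \<sigma>) :: nat)" for n \<sigma>
  have H': "decidable {} (\<lambda>m. H (p2 m) (dstr (p2 (p1 (p1 m)))))"
    using dec_compose[OF D, of "\<lambda>m. prod_encode (p2 m, p2 (p1 (p1 m)))"]
    by (simp add: comp_intros)
  have dec: "decidable {} (\<lambda>m. T (p1 (p1 m)) (dstr (p2 (p1 m))))"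
    unfolding T_def by (intro comp_intros scomp_intros H')
  have extT: "ext_closed (T n)" for n
    unfolding ext_closed_def
  proof (intro allI impI)
    fix \<sigma> \<tau> assume "T n \<sigma>" and p: "prefix \<sigma> \<tau>"
    have "(\<Sum>i<length \<sigma>. of_bool (H i \<sigma>) :: nat) \<le> (\<Sum>i<length \<sigma>. of_bool (H i \<tau>))"
      using ext_closedD[OF ext _ p] by (intro sum_mono) auto
    also have "\<dots> \<le> (\<Sum>i<length \<tau>. of_bool (H i \<tau>))"
      using prefix_length_le[OF p] by (intro sum_mono2) auto
    finally show "T n \<tau>" using \<open>T n \<sigma>\<close> unfolding T_def by linarith
  qed
  have "measure coin_measure {Z. T n (pre Z m)} \<le> (1 / 2) ^ n" for n m
  proof -
    let ?S = "{\<sigma> :: bool list. length \<sigma> = m}" and ?A = "{\<sigma>. length \<sigma> = m \<and> T n \<sigma>}"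
    have fin: "finite ?S" "finite ?A" using finite_strings_length[of m "\<lambda>_. True"] finite_strings_length by auto
    \<comment> \<open>Markov's inequality by double counting of pairs of a string and an
      event.\<close>
    have "card ?A * (k * 2 ^ n) = (\<Sum>\<sigma>\<in>?A. k * 2 ^ n)" by simp
    also have "\<dots> \<le> (\<Sum>\<sigma>\<in>?A. \<Sum>i<m. of_bool (H i \<sigma>))"
      by (intro sum_mono) (auto simp: T_def)
    also have "\<dots> \<le> (\<Sum>\<sigma>\<in>?S. \<Sum>i<m. of_bool (H i \<sigma>))" using fin by (intro sum_mono2) auto
    also have "\<dots> = (\<Sum>i<m. \<Sum>\<sigma>\<in>?S. of_bool (H i \<sigma>))" by (rule sum.swap)
    also have "\<dots> = (\<Sum>i<m. card {\<sigma>. length \<sigma> = m \<and> H i \<sigma>})"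
      using fin by (intro sum.cong refl) (simp add: of_bool_def sum.If_cases Int_def)
    finally have "real (card ?A * (k * 2 ^ n)) \<le> real (\<Sum>i<m. card {\<sigma>. length \<sigma> = m \<and> H i \<sigma>})"
      by (simp only: of_nat_le_iff)
    also have "\<dots> = 2 ^ m * (\<Sum>i<m. measure coin_measure {Z. H i (pre Z m)})"
      by (simp add: measure_level sum_distrib_left)
    also have "\<dots> \<le> 2 ^ m * real k" using le[where N = m and m = m] k(1) by (intro mult_left_mono) auto
    finally have "real k * (card ?A * 2 ^ n) \<le> real k * 2 ^ m" by (simp add: mult_ac)
    then have "card ?A * (2::real) ^ n \<le> 2 ^ m" using k(2) by simp
    then show ?thesis by (simp add: measure_level divide_simps mult_ac)
  qed
  then have le': "measure coin_measure (opn (T n)) \<le> (1 / 2) ^ n" for n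
    by (rule measure_opn_le[OF extT])
  have "\<exists>n. ?Z \<notin> opn (\<lambda>\<sigma>. \<exists>s::nat. T n \<sigma>)"
    by (rule Martin_Loef_random_avoids[OF X, where D = "\<lambda>n \<sigma> s. T n \<sigma>"])
      (use dec le' in auto)
  then obtain n where n: "\<And>m. \<not> T n (pre ?Z m)" unfolding opn_def by auto
  from infinite_arbitrarily_large[OF inf] obtain F where
    F: "finite F" "card F = k * 2 ^ n" "F \<subseteq> {i. ?Z \<in> opn (H i)}" by blast
  then have "\<forall>i\<in>F. \<exists>m. H i (pre ?Z m)" unfolding opn_def by blast
  then obtain f where f: "\<And>i. i \<in> F \<Longrightarrow> H i (pre ?Z (f i))" by metis
  \<comment> \<open>This length exceeds all the chosen indices and all the lengths at which their
    events are witnessed.\<close>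
  define m where "m = Suc (\<Sum>i\<in>F. i + f i)"
  have "i + f i < m" if "i \<in> F" for i
    unfolding m_def using member_le_sum[OF that, of "\<lambda>i. i + f i"] F(1) by simp
  then have m: "i < m" "f i \<le> m" if "i \<in> F" for i using that by fastforce+
  have "card F = (\<Sum>i\<in>F. of_bool (H i (pre ?Z m)))"
    using ext_closed_pre[OF ext f m(2)] by simp
  also have "\<dots> \<le> (\<Sum>i<m. of_bool (H i (pre ?Z m)))"
    using m(1) by (intro sum_mono2) auto
  finally have "T n (pre ?Z m)" using F(2) by (simp add: T_def)
  with n show False by blast
qed

text \<open>A universal test: of the test enumerated by program \<open>e\<close> the component with index \<open>e + 2\<close> is
  taken, trimmed to measure \<open>2\<^sup>-\<^sup>(\<^sup>e\<^sup>+\<^sup>2\<^sup>)\<close>.\<close>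

definition listed :: "nat \<Rightarrow> bool list \<Rightarrow> bool" where
  "listed e \<sigma> \<longleftrightarrow> (\<exists>k\<le>length \<sigma>. \<exists>y<length \<sigma>.
    ev0 (length \<sigma>) e (prod_encode (e + 2, string_code (take k \<sigma>))) y)"

definition nonrandom :: "bool list \<Rightarrow> bool" where
  "nonrandom \<sigma> \<longleftrightarrow> (\<exists>e\<le>length \<sigma>. trim ((1 / 2) ^ (e + 2)) (listed e) \<sigma>)"

lemma ext_closed_listed: "ext_closed (listed e)"
  unfolding ext_closed_def listed_def
proof (intro allI impI, elim exE conjE)
  fix \<sigma> \<tau> k y
  assume p: "prefix \<sigma> \<tau>" and "k \<le> length \<sigma>" "y < length \<sigma>"
    "ev0 (length \<sigma>) e (prod_encode (e + 2, string_code (take k \<sigma>))) y"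
  moreover have "take k \<sigma> = take k \<tau>" using p \<open>k \<le> length \<sigma>\<close> by (auto simp: prefix_def)
  ultimately show "\<exists>k\<le>length \<tau>. \<exists>y<length \<tau>.
      ev0 (length \<tau>) e (prod_encode (e + 2, string_code (take k \<tau>))) y"
    using prefix_length_le[OF p] ev0_mono by (metis le_trans less_le_trans)
qed

lemma ext_closed_nonrandom: "ext_closed nonrandom"
  unfolding ext_closed_def nonrandom_def
  using ext_closedD[OF ext_closed_trim] by (meson prefix_length_le le_trans)

lemma dec_listed: "computable X f \<Longrightarrow> scomputable X g \<Longrightarrow> decidable X (\<lambda>n. listed (f n) (g n))"
proof -
  assume fg: "computable X f" "scomputable X g"
  have "decidable X (\<lambda>n. listed (p1 n) (dstr (p2 n)))"
    unfolding listed_def by (intro comp_intros scomp_intros dec_ev0)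
  from dec_compose[OF this, of "\<lambda>n. prod_encode (f n, string_code (g n))"] fg
  show ?thesis by (simp add: comp_pair comp_string_code)
qed

lemma dec_nonrandom: "scomputable X g \<Longrightarrow> decidable X (\<lambda>n. nonrandom (g n))"
proof -
  assume g: "scomputable X g"
  \<comment> \<open>Clearing denominators turns the condition in \<open>trim\<close> into one
    between natural numbers, which can be decided.\<close>
  have "real a \<le> (1 / 2) ^ (e + 2) * 2 ^ m \<longleftrightarrow> a * 2 ^ (e + 2) \<le> 2 ^ m" for a e m :: nat
  proof -
    have "real a \<le> (1 / 2) ^ (e + 2) * 2 ^ m \<longleftrightarrow> real (a * 2 ^ (e + 2)) \<le> real (2 ^ m)"
      by (simp add: divide_simps power_one_over)
    then show ?thesis by (simp only: of_nat_le_iff)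
  qed
  then have eq: "nonrandom \<sigma> \<longleftrightarrow> (\<exists>e\<le>length \<sigma>. \<exists>m\<le>length \<sigma>. listed e (take m \<sigma>) \<and>
      card {\<tau>. length \<tau> = m \<and> listed e \<tau>} * 2 ^ (e + 2) \<le> 2 ^ m)" for \<sigma>
    unfolding nonrandom_def trim_def by simp
  have "decidable X (\<lambda>n. nonrandom (dstr n))"
    unfolding eq by (intro comp_intros scomp_intros dec_listed comp_card_strings)
  from dec_compose[OF this comp_string_code[OF g]] show ?thesis by simp
qed

text \<open>The bounds \<open>(1 / 2) ^ (e + 2)\<close> sum to at most 1/2, which is the reason for
  the shift by 2.\<close>

lemma measure_nonrandom: "measure coin_measure (opn nonrandom) \<le> 1 / 2"
proof (rule measure_opn_le[OF ext_closed_nonrandom])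
  fix m
  let ?A = "\<lambda>e. opn (trim ((1 / 2) ^ (e + 2)) (listed e))"
  have "{Z. nonrandom (pre Z m)} \<subseteq> (\<Union>e<Suc m. ?A e)"
    unfolding nonrandom_def opn_def by fastforce
  then have "measure coin_measure {Z. nonrandom (pre Z m)} \<le> measure coin_measure (\<Union>e<Suc m. ?A e)"
    by (intro coin.finite_measure_mono sets.finite_UN sets_opn) auto
  also have "\<dots> \<le> (\<Sum>e<Suc m. measure coin_measure (?A e))"
    by (intro coin.finite_measure_subadditive_finite) auto
  also have "\<dots> \<le> (\<Sum>e<Suc m. (1 / 2) ^ (e + 2))"
    by (intro sum_mono measure_trim ext_closed_listed) simp
  also have "\<dots> = 1 / 4 * (\<Sum>e<Suc m. (1 / 2) ^ e)"
    by (simp add: sum_distrib_left power_add del: sum.lessThan_Suc)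
  also have "\<dots> \<le> 1 / 4 * 2"
    by (intro mult_left_mono) (simp_all add: sum_gp_strict del: sum.lessThan_Suc)
  finally show "measure coin_measure {Z. nonrandom (pre Z m)} \<le> 1 / 2" by simp
qed

text \<open>A test capturing \<open>X\<close> is enumerated by some program. Its component used in
  \<open>nonrandom\<close> already obeys the measure bound, so trimming keeps all of it and
  \<open>X\<close> falls into the universal component.\<close>

lemma Martin_Loef_random_if_avoids_nonrandom:
  assumes "(\<lambda>i. i \<in> X) \<notin> opn nonrandom"
  shows "Martin_Loef_random X"
  unfolding Martin_Loef_random_def
proof
  let ?Z = "\<lambda>i. i \<in> X"
  assume "\<exists>U. Martin_Loef_test U \<and> ?Z \<in> (\<Inter>n. U n)"
  then obtain V where V: "Martin_Loef_test V" "?Z \<in> (\<Inter>n. V n)" by (elim exE conjE)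
  from V(1) obtain W where W: "comp_enumerable W"
      "\<forall>n. V n = (\<Union>\<sigma>\<in>{\<sigma>. prod_encode (n, string_code \<sigma>) \<in> W}. cylinder \<sigma>)"
    unfolding Martin_Loef_test_def uniformly_Sigma01_def by (elim exE conjE)
  define U where "U n = (\<Union>\<sigma>\<in>{\<sigma>. prod_encode (n, string_code \<sigma>) \<in> W}. cylinder \<sigma>)" for n
  have VU: "V = U" using W(2) by (simp add: U_def fun_eq_iff)
  have U: "measure coin_measure (U n) \<le> (1 / 2) ^ n" "?Z \<in> U n" for n
    using V unfolding VU Martin_Loef_test_def by auto
  from W(1) obtain c where c: "\<And>n. n \<in> W \<longleftrightarrow> (\<exists>y. eval {} c n y)"
    unfolding comp_enumerable_def by blast
  let ?e = "goedel_number c"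
  from U(2)[of "?e + 2"] obtain \<sigma> where \<sigma>: "prod_encode (?e + 2, string_code \<sigma>) \<in> W" "?Z \<in> cylinder \<sigma>"
    unfolding U_def by blast
  then obtain s y where sy: "ev0 s ?e (prod_encode (?e + 2, string_code \<sigma>)) y"
    unfolding c eval_empty_iff_ev0 by blast
  define m where "m = length \<sigma> + s + ?e"
  have "listed ?e (pre ?Z m)" unfolding listed_def
  proof (intro exI conjI)
    have "take (length \<sigma>) (pre ?Z m) = \<sigma>" using \<sigma>(2) by (simp add: in_cylinder_iff m_def)
    then show "ev0 (length (pre ?Z m)) ?e
        (prod_encode (?e + 2, string_code (take (length \<sigma>) (pre ?Z m)))) y"
      using ev0_mono[OF sy, of m] by (simp add: m_def)
  qed (use ev0_bound[OF sy] in \<open>auto simp: m_def\<close>)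
  moreover have "measure coin_measure (opn (listed ?e)) \<le> (1 / 2) ^ (?e + 2)"
  proof -
    have "opn (listed ?e) \<subseteq> U (?e + 2)"
    proof
      fix Y assume "Y \<in> opn (listed ?e)"
      then obtain n k y where "ev0 n ?e (prod_encode (?e + 2, string_code (take k (pre Y n)))) y"
        unfolding opn_def listed_def by auto
      then have "prod_encode (?e + 2, string_code (pre Y (min k n))) \<in> W"
        unfolding c eval_empty_iff_ev0 take_pre by blast
      then show "Y \<in> U (?e + 2)" unfolding U_def using pre_in_cylinder by blast
    qed
    moreover have "U (?e + 2) \<in> sets coin_measure"
      unfolding U_def UN_cylinder_eq_opn by (rule sets_opn)
    ultimately have "measure coin_measure (opn (listed ?e)) \<le> measure coin_measure (U (?e + 2))"
      by (intro coin.finite_measure_mono)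
    with U(1)[of "?e + 2"] show ?thesis by linarith
  qed
  ultimately have "trim ((1 / 2) ^ (?e + 2)) (listed ?e) (pre ?Z m)" by (intro trim_intro)
  then have "nonrandom (pre ?Z m)" unfolding nonrandom_def by (intro exI[of _ ?e]) (simp add: m_def)
  with assms show False unfolding opn_def by blast
qed

text \<open>Otherwise \<sigma> followed by zeros would be random; but this point is captured by the
  test whose components are the cylinders of \<sigma> followed by \<open>n\<close> zeros.\<close>

lemma nonrandom_dense: "\<exists>\<rho>. prefix \<sigma> \<rho> \<and> nonrandom \<rho>"
proof (rule ccontr)
  assume no: "\<nexists>\<rho>. prefix \<sigma> \<rho> \<and> nonrandom \<rho>"
  define X where "X = {i. bit_at \<sigma> i}"
  let ?Z = "\<lambda>i. i \<in> X"
  have pre: "pre ?Z (length \<sigma> + n) = \<sigma> @ replicate n False" for n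
    by (rule nth_equalityI) (auto simp: X_def bit_at_def nth_append)
  have "?Z \<notin> opn nonrandom"
  proof
    assume "?Z \<in> opn nonrandom"
    then obtain m where "nonrandom (pre ?Z m)" unfolding opn_def by blast
    then have "nonrandom (pre ?Z (length \<sigma> + m))"
      by (rule ext_closed_pre[OF ext_closed_nonrandom]) simp
    with no pre[of m] show False by (metis prefixI)
  qed
  then have "Martin_Loef_random X" by (rule Martin_Loef_random_if_avoids_nonrandom)
  moreover have "decidable {} (\<lambda>m. dstr (p2 (p1 m)) = \<sigma> @ replicate (p1 (p1 m)) False)"
    by (intro comp_intros scomp_intros)
  moreover have "opn (\<lambda>\<tau>. \<tau> = \<sigma> @ replicate n False) = cylinder (\<sigma> @ replicate n False)" for n
    using UN_cylinder_eq_opn[of "\<lambda>\<tau>. \<tau> = \<sigma> @ replicate n False"] by simp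
  then have "measure coin_measure (opn (\<lambda>\<tau>. \<exists>s::nat. \<tau> = \<sigma> @ replicate n False)) \<le> (1 / 2) ^ n" for n
    by (simp add: measure_cylinder power_decreasing)
  ultimately have "\<exists>n. ?Z \<notin> opn (\<lambda>\<tau>. \<exists>s::nat. \<tau> = \<sigma> @ replicate n False)"
    by (rule Martin_Loef_random_avoids)
  with pre show False unfolding opn_def by auto
qed

section \<open>An optimal prefix-free machine\<close>

definition hit :: "nat \<Rightarrow> bool list \<Rightarrow> nat \<Rightarrow> bool" where
  "hit e p s \<longleftrightarrow> (\<exists>y<s. ev0 s e (string_code p) y)"

text \<open>Program \<open>e\<close> is made prefix-free: \<open>p\<close> stays in its domain if \<open>e\<close> halts on \<open>p\<close> strictly
  earlier than on every other string comparable with \<open>p\<close>.\<close>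

definition accepts :: "nat \<Rightarrow> bool list \<Rightarrow> nat \<Rightarrow> bool" where
  "accepts e p s \<longleftrightarrow> hit e p s \<and> (\<forall>r<s. \<not> hit e p r) \<and>
    (\<forall>q<s. dstr q \<noteq> p \<and> (prefix (dstr q) p \<or> prefix p (dstr q)) \<longrightarrow> \<not> hit e (dstr q) s)"

text \<open>The string \<sigma> is split as \<open>e\<close> zeros, a one and a description
  \<open>p\<close>; the witness \<open>w\<close> codes \<open>e\<close>, the output and the stage at
  which \<open>p\<close> is accepted.\<close>

definition found :: "bool list \<Rightarrow> nat \<Rightarrow> bool" where
  "found \<sigma> w \<longleftrightarrow> take (p1 w) \<sigma> = replicate (p1 w) False \<and> bit_at \<sigma> (p1 w) \<and>
    accepts (p1 w) (drop (Suc (p1 w)) \<sigma>) (p2 (p2 w)) \<and>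
    ev0 (p2 (p2 w)) (p1 w) (string_code (drop (Suc (p1 w)) \<sigma>)) (p1 (p2 w))"

definition universal_machine :: "bool list \<Rightarrow> bool list option" where
  "universal_machine \<sigma> =
    (if \<exists>w. found \<sigma> w then Some (dstr (p1 (p2 (LEAST w. found \<sigma> w)))) else None)"

lemma hit_mono: "hit e p s \<Longrightarrow> s \<le> t \<Longrightarrow> hit e p t"
  unfolding hit_def using ev0_mono less_le_trans by blast

lemma hit_bound: "hit e p s \<Longrightarrow> string_code p < s"
  unfolding hit_def using ev0_bound by blast

lemma dec_hit:
  assumes "computable X e" "scomputable X p" "computable X s"
  shows "decidable X (\<lambda>n. hit (e n) (p n) (s n))"
proof -
  have "decidable X (\<lambda>n. hit (p1 n) (dstr (p1 (p2 n))) (p2 (p2 n)))"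
    unfolding hit_def by (intro comp_intros scomp_intros dec_ev0)
  from dec_compose[OF this, of "\<lambda>n. prod_encode (e n, prod_encode (string_code (p n), s n))"] assms
  show ?thesis by (simp add: comp_pair comp_string_code)
qed

lemma dec_found: "decidable X (\<lambda>n. found (dstr (p1 n)) (p2 n))"
  unfolding found_def accepts_def by (intro comp_intros scomp_intros dec_hit dec_ev0)

text \<open>The index is the position of the first one, which comparable strings in the domain
  share.\<close>

lemma found_index_unique:
  assumes "found \<sigma> w" "found \<tau> v" "prefix \<sigma> \<tau>"
  shows "p1 w = p1 v"
proof -
  have *: "p1 w < length \<sigma>" "\<sigma> ! p1 w" "\<And>i. i < p1 w \<Longrightarrow> \<not> \<sigma> ! i"
    "p1 v < length \<tau>" "\<tau> ! p1 v" "\<And>i. i < p1 v \<Longrightarrow> \<not> \<tau> ! i"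
    using assms(1,2) unfolding found_def bit_at_def by (metis nth_replicate nth_take)+
  have "\<sigma> ! i = \<tau> ! i" if "i < length \<sigma>" for i using assms(3) that by (auto simp: prefix_def nth_append)
  with * show ?thesis by (metis linorder_neqE_nat order.strict_trans)
qed

lemma found_accepts: "found \<sigma> w \<Longrightarrow> accepts (p1 w) (drop (Suc (p1 w)) \<sigma>) (p2 (p2 w))"
  by (simp add: found_def)

lemma found_decompose: "found \<sigma> w \<Longrightarrow> \<sigma> = replicate (p1 w) False @ True # drop (Suc (p1 w)) \<sigma>"
  unfolding found_def bit_at_def by (metis Cons_nth_drop_Suc append_take_drop_id)

text \<open>Of two comparable accepted strings, the one accepted no later has already halted at the
  stage of the other and blocks it.\<close>

lemma accepts_incomparable:
  assumes "accepts e p s" "accepts e q t" "prefix p q \<or> prefix q p"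
  shows "p = q"
proof (rule ccontr)
  have *: "\<not> s \<le> t" if "accepts e p s" "accepts e q t" "prefix p q \<or> prefix q p" "p \<noteq> q" for p q s t
  proof
    assume "s \<le> t"
    with that(1) have "hit e p t" unfolding accepts_def using hit_mono by blast
    with that(2-4) hit_bound[OF this] show False unfolding accepts_def
      by (metis dstr_string_code)
  qed
  assume "p \<noteq> q"
  with *[OF assms] *[OF assms(2,1)] assms(3) show False by (metis nle_le)
qed

lemma prefix_free_universal: "prefix_free (dom universal_machine)"
  unfolding prefix_free_def
proof (intro ballI impI)
  fix \<sigma> \<tau> assume "\<sigma> \<in> dom universal_machine" "\<tau> \<in> dom universal_machine" and p: "prefix \<sigma> \<tau>"
  then obtain w v where wv: "found \<sigma> w" "found \<tau> v"
    unfolding universal_machine_def by (auto simp: dom_def split: if_splits)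
  have eq: "p1 w = p1 v" by (rule found_index_unique[OF wv p])
  have "prefix (drop (Suc (p1 w)) \<sigma>) (drop (Suc (p1 w)) \<tau>)" using p by (auto simp: prefix_def)
  then have "drop (Suc (p1 w)) \<sigma> = drop (Suc (p1 v)) \<tau>"
    using accepts_incomparable found_accepts[OF wv(1)] found_accepts[OF wv(2)] eq by metis
  then show "\<sigma> = \<tau>" using found_decompose[OF wv(1)] found_decompose[OF wv(2)] eq by metis
qed

lemma computable_machine_search:
  assumes "decidable {} (\<lambda>m. P (p1 m) (p2 m))" "computable {} g"
    and "\<And>\<sigma>. M \<sigma> = (if \<exists>s. P (string_code \<sigma>) s
        then Some (dstr (g (LEAST s. P (string_code \<sigma>) s))) else None)"
  shows "computable_machine M"
proof -
  from partial_search[OF assms(1,2)] obtain c where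
    c: "\<And>n y. eval {} c n y \<longleftrightarrow> (\<exists>s. P n s) \<and> y = g (LEAST s. P n s)" by blast
  have "M \<sigma> = Some \<tau> \<longleftrightarrow> eval {} c (string_code \<sigma>) (string_code \<tau>)" for \<sigma> \<tau>
    unfolding c assms(3) by (auto simp del: string_code_dstr) (metis dstr_string_code string_code_dstr)+
  then show ?thesis unfolding computable_machine_def by blast
qed

lemma computable_universal: "computable_machine universal_machine"
  by (rule computable_machine_search[where P = "\<lambda>n. found (dstr n)" and g = "\<lambda>w. p1 (p2 w)"])
    (intro dec_found comp_intros | simp add: universal_machine_def)+

text \<open>When the domain of \<open>M\<close> is prefix-free, no comparable string ever halts, so
  the filter accepts every description at its first halting stage.\<close>

lemma universal_simulates:
  assumes M: "prefix_free (dom M)" "\<And>\<sigma> \<tau>. M \<sigma> = Some \<tau> \<longleftrightarrow> eval {} c (string_code \<sigma>) (string_code \<tau>)"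
    and p: "M p = Some \<tau>"
  shows "universal_machine (replicate (goedel_number c) False @ True # p) = Some \<tau>"
proof -
  let ?e = "goedel_number c" and ?\<sigma> = "replicate (goedel_number c) False @ True # p"
  have hit_dom: "q \<in> dom M" if "hit ?e q s" for q s
    using that ev0_sound M(2)[of q] unfolding hit_def by (metis domI string_code_dstr)
  from p obtain s0 where s0: "ev0 s0 ?e (string_code p) (string_code \<tau>)"
    unfolding M(2) eval_empty_iff_ev0 by blast
  then have ex: "\<exists>s. hit ?e p s" unfolding hit_def using ev0_bound by blast
  define s where "s = (LEAST s. hit ?e p s)"
  have s: "hit ?e p s" "\<And>r. r < s \<Longrightarrow> \<not> hit ?e p r"
    unfolding s_def using LeastI_ex[OF ex] not_less_Least by blast+
  have out: "y = string_code \<tau>" if "ev0 r ?e (string_code p) y" for r y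
    using eval_deterministic[OF ev0_sound[OF that] ev0_sound[OF s0]] .
  from s(1) have y: "ev0 s ?e (string_code p) (string_code \<tau>)" unfolding hit_def using out by blast
  have "p \<in> dom M" using p by blast
  then have "accepts ?e p s" unfolding accepts_def
    using s hit_dom M(1) unfolding prefix_free_def by blast
  then have f: "found ?\<sigma> (prod_encode (?e, prod_encode (string_code \<tau>, s)))"
    unfolding found_def using y by (simp add: bit_at_def nth_append)
  \<comment> \<open>The least witness may differ from the one just exhibited, but it has the same
    index and, by determinism, the same output.\<close>
  let ?w = "LEAST w. found ?\<sigma> w"
  have w: "found ?\<sigma> ?w" using f by (rule LeastI)
  have "p1 ?w = ?e" using found_index_unique[OF w f] by simp
  with w have "ev0 (p2 (p2 ?w)) ?e (string_code p) (p1 (p2 ?w))" unfolding found_def by simp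
  from out[OF this] show ?thesis unfolding universal_machine_def using f by auto
qed

lemma machine_complexity_le: "M \<sigma> = Some \<tau> \<Longrightarrow> machine_complexity M \<tau> \<le> enat (length \<sigma>)"
  unfolding machine_complexity_def by (rule INF_lower) simp

lemma machine_complexity_attained:
  assumes "machine_complexity M \<tau> \<le> enat k"
  shows "\<exists>\<sigma>. M \<sigma> = Some \<tau> \<and> length \<sigma> \<le> k"
proof -
  let ?A = "(\<lambda>\<sigma>. enat (length \<sigma>)) ` {\<sigma>. M \<sigma> = Some \<tau>}"
  have "?A \<noteq> {}"
  proof
    assume "?A = {}"
    then have "machine_complexity M \<tau> = \<infinity>" unfolding machine_complexity_def Inf_enat_def by simp
    with assms show False by simp
  qed
  then have "Inf ?A \<in> ?A" unfolding Inf_enat_def by (auto intro: LeastI)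
  then show ?thesis using assms unfolding machine_complexity_def by auto
qed

lemma optimal_universal_machine: "optimal_prefix_free_machine universal_machine"
  unfolding optimal_prefix_free_machine_def prefix_free_machine_def
proof (intro conjI computable_universal prefix_free_universal allI impI, elim conjE)
  fix M assume "computable_machine M" and pf: "prefix_free (dom M)"
  then obtain c where c: "\<And>\<sigma> \<tau>. M \<sigma> = Some \<tau> \<longleftrightarrow> eval {} c (string_code \<sigma>) (string_code \<tau>)"
    unfolding computable_machine_def by blast
  \<comment> \<open>The length of the block of zeros with its closing one.\<close>
  let ?d = "Suc (goedel_number c)"
  have "machine_complexity universal_machine \<tau> \<le> machine_complexity M \<tau> + enat ?d" for \<tau>
  proof (cases "machine_complexity M \<tau>")
    case (enat k)
    with machine_complexity_attained[of M \<tau> k] obtain p where p: "M p = Some \<tau>" "length p \<le> k" by auto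
    from machine_complexity_le[of universal_machine, OF universal_simulates[OF pf c p(1)]] p(2) enat show ?thesis
      by (simp add: order.trans)
  qed simp
  then show "\<exists>d. \<forall>\<tau>. machine_complexity universal_machine \<tau> \<le> machine_complexity M \<tau> + enat d" by blast
qed

lemma optimal_reference_machine: "optimal_prefix_free_machine reference_machine"
  unfolding reference_machine_def
  by (rule someI[of optimal_prefix_free_machine, OF optimal_universal_machine])

lemma prefix_free_reference_machine: "prefix_free (dom reference_machine)"
  using optimal_reference_machine
  unfolding optimal_prefix_free_machine_def prefix_free_machine_def by blast

lemma K_le_machine:
  assumes "prefix_free_machine M"
  shows "\<exists>d. \<forall>\<sigma> \<tau>. M \<sigma> = Some \<tau> \<longrightarrow> K \<tau> \<le> enat (length \<sigma> + d)"
proof -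
  from optimal_reference_machine assms obtain d where
    d: "\<And>\<tau>. K \<tau> \<le> machine_complexity M \<tau> + enat d"
    unfolding optimal_prefix_free_machine_def K_def by blast
  have "K \<tau> \<le> enat (length \<sigma> + d)" if "M \<sigma> = Some \<tau>" for \<sigma> \<tau>
    using d[of \<tau>] add_right_mono[OF machine_complexity_le[of M, OF that], of "enat d"]
    by (simp add: order.trans)
  then show ?thesis by blast
qed

section \<open>Approximating the complexity from above\<close>

definition K_stage :: "nat \<Rightarrow> bool list \<Rightarrow> nat \<Rightarrow> nat \<Rightarrow> bool" where
  "K_stage e \<tau> k s \<longleftrightarrow> (\<exists>p<s. length (dstr p) \<le> k \<and> ev0 s e p (string_code \<tau>))"

lemma K_stage_mono: "K_stage e \<tau> k s \<Longrightarrow> s \<le> t \<Longrightarrow> K_stage e \<tau> k t"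
  unfolding K_stage_def using ev0_mono less_le_trans by blast

text \<open>The reference machine is a choice among optimal machines; \<open>e\<close> is the number
  of some program computing it, and a short description is confirmed at a finite stage.\<close>

lemma K_approximation: "\<exists>e. \<forall>\<tau> k. K \<tau> \<le> enat k \<longleftrightarrow> (\<exists>s. K_stage e \<tau> k s)"
proof -
  from optimal_reference_machine obtain c where
    c: "\<And>\<sigma> \<tau>. reference_machine \<sigma> = Some \<tau> \<longleftrightarrow> eval {} c (string_code \<sigma>) (string_code \<tau>)"
    unfolding optimal_prefix_free_machine_def prefix_free_machine_def computable_machine_def by blast
  have "K \<tau> \<le> enat k \<longleftrightarrow> (\<exists>s. K_stage (goedel_number c) \<tau> k s)" for \<tau> k
  proof
    assume "K \<tau> \<le> enat k"
    then obtain \<sigma> where \<sigma>: "reference_machine \<sigma> = Some \<tau>" "length \<sigma> \<le> k"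
      unfolding K_def using machine_complexity_attained by blast
    then obtain s where "ev0 s (goedel_number c) (string_code \<sigma>) (string_code \<tau>)"
      unfolding c eval_empty_iff_ev0 by blast
    with \<sigma>(2) ev0_bound show "\<exists>s. K_stage (goedel_number c) \<tau> k s"
      unfolding K_stage_def by (metis dstr_string_code)
  next
    assume "\<exists>s. K_stage (goedel_number c) \<tau> k s"
    then obtain s p where p: "length (dstr p) \<le> k" "ev0 s (goedel_number c) p (string_code \<tau>)"
      unfolding K_stage_def by blast
    then have "reference_machine (dstr p) = Some \<tau>" unfolding c using ev0_sound by simp
    with p(1) show "K \<tau> \<le> enat k"
      unfolding K_def by (meson enat_ord_simps(1) machine_complexity_le order.trans)
  qed
  then show ?thesis by blast
qed

lemma dec_K_stage:
  assumes "scomputable X f" "computable X k" "computable X s"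
  shows "decidable X (\<lambda>n. K_stage e (f n) (k n) (s n))"
proof -
  have "decidable X (\<lambda>n. K_stage e (dstr (p1 n)) (p1 (p2 n)) (p2 (p2 n)))"
    unfolding K_stage_def by (intro comp_intros scomp_intros dec_ev0)
  from dec_compose[OF this, of "\<lambda>n. prod_encode (string_code (f n), prod_encode (k n, s n))"] assms
  show ?thesis by (simp add: comp_pair comp_string_code)
qed

lemma Kraft: "finite F \<Longrightarrow> prefix_free F \<Longrightarrow> (\<Sum>\<sigma>\<in>F. (1 / 2 :: real) ^ length \<sigma>) \<le> 1"
  using measure_UN_cylinder coin.prob_le_1 by metis

text \<open>Distinct strings have distinct shortest descriptions.\<close>

lemma Kraft_K:
  assumes "finite S" "\<And>\<tau>. \<tau> \<in> S \<Longrightarrow> K \<tau> \<le> enat (k \<tau>)"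
  shows "(\<Sum>\<tau>\<in>S. (1 / 2 :: real) ^ k \<tau>) \<le> 1"
proof -
  have "\<forall>\<tau>\<in>S. \<exists>\<sigma>. reference_machine \<sigma> = Some \<tau> \<and> length \<sigma> \<le> k \<tau>"
    using assms(2) unfolding K_def using machine_complexity_attained by blast
  then obtain d where d: "\<And>\<tau>. \<tau> \<in> S \<Longrightarrow> reference_machine (d \<tau>) = Some \<tau>"
    "\<And>\<tau>. \<tau> \<in> S \<Longrightarrow> length (d \<tau>) \<le> k \<tau>" by metis
  have inj: "inj_on d S" by (rule inj_onI) (metis d(1) option.inject)
  have "prefix_free (d ` S)"
    using prefix_free_reference_machine d(1) unfolding prefix_free_def by (auto intro: domI)
  have "(\<Sum>\<tau>\<in>S. (1 / 2 :: real) ^ k \<tau>) \<le> (\<Sum>\<tau>\<in>S. (1 / 2) ^ length (d \<tau>))"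
    using d(2) by (intro sum_mono power_decreasing) auto
  also have "\<dots> = (\<Sum>\<sigma>\<in>d ` S. (1 / 2) ^ length \<sigma>)" by (simp add: sum.reindex[OF inj])
  also have "\<dots> \<le> 1" using assms(1) \<open>prefix_free (d ` S)\<close> by (intro Kraft) auto
  finally show ?thesis .
qed

section \<open>Forcing with random sets of intermediate density\<close>

definition local_density :: "(nat \<Rightarrow> bool) set \<Rightarrow> bool list \<Rightarrow> real" where
  "local_density A \<sigma> = measure coin_measure (A \<inter> cylinder \<sigma>) * 2 ^ length \<sigma>"

abbreviation randoms :: "(nat \<Rightarrow> bool) set" where
  "randoms \<equiv> - opn nonrandom"

lemma sets_randoms [measurable]: "- opn H \<in> sets coin_measure"
  using sets.compl_sets[OF sets_opn[of H]] by (simp add: Compl_eq_Diff_UNIV)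

lemma measure_eq_local_density: "measure coin_measure (A \<inter> cylinder \<sigma>) = local_density A \<sigma> * (1 / 2) ^ length \<sigma>"
  by (simp add: local_density_def power_one_over)

lemma local_density_mono:
  "A \<inter> cylinder \<sigma> \<subseteq> B \<Longrightarrow> B \<in> sets coin_measure \<Longrightarrow> local_density A \<sigma> \<le> local_density B \<sigma>"
  unfolding local_density_def
  by (intro mult_right_mono coin.finite_measure_mono) auto

lemma local_density_le_1: "local_density A \<sigma> \<le> 1"
proof -
  have "measure coin_measure (A \<inter> cylinder \<sigma>) \<le> measure coin_measure (cylinder \<sigma>)"
    by (intro coin.finite_measure_mono) auto
  then show ?thesis by (simp add: local_density_def measure_cylinder field_simps power_one_over)
qed

lemma cylinder_split: "cylinder \<sigma> = cylinder (\<sigma> @ [b]) \<union> cylinder (\<sigma> @ [\<not> b])"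
  by (auto simp: cylinder_def nth_append less_Suc_eq)

text \<open>The density at a string is the mean of the densities at its two children, and that of
  the sibling is at most 1. In particular a density above 3/4 cannot fall below 1/2 in one
  step.\<close>

lemma local_density_child:
  assumes A: "A \<in> sets coin_measure"
  shows "2 * local_density A \<sigma> - 1 \<le> local_density A (\<sigma> @ [b])"
proof -
  have "measure coin_measure (A \<inter> cylinder \<sigma>) \<le>
      measure coin_measure (A \<inter> cylinder (\<sigma> @ [b])) + measure coin_measure (A \<inter> cylinder (\<sigma> @ [\<not> b]))"
    unfolding cylinder_split[of \<sigma> b] Int_Un_distrib
    by (intro measure_Un_le) (use A in auto)
  then have "2 * local_density A \<sigma> \<le> local_density A (\<sigma> @ [b]) + local_density A (\<sigma> @ [\<not> b])"
    by (auto dest: mult_left_mono[of _ _ "2 * 2 ^ length \<sigma>"] simp: local_density_def algebra_simps)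
  with local_density_le_1[of A "\<sigma> @ [\<not> b]"] show ?thesis by linarith
qed

lemma local_density_randoms_nonrandom: "nonrandom \<sigma> \<Longrightarrow> local_density randoms \<sigma> = 0"
proof -
  assume "nonrandom \<sigma>"
  then have "cylinder \<sigma> \<subseteq> opn nonrandom" using UN_cylinder_eq_opn[of nonrandom] by blast
  then have "randoms \<inter> cylinder \<sigma> = {}" by blast
  then show ?thesis by (simp add: local_density_def)
qed

section \<open>Points and strings along which the density stays high\<close>

definition tube :: "bool list \<Rightarrow> real \<Rightarrow> (nat \<Rightarrow> bool) set" where
  "tube \<sigma> d = {Z \<in> cylinder \<sigma>. \<forall>k\<ge>length \<sigma>. d \<le> local_density randoms (pre Z k)}"

definition above :: "bool list \<Rightarrow> real \<Rightarrow> bool list \<Rightarrow> bool" where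
  "above \<sigma> d \<tau> \<longleftrightarrow> prefix \<sigma> \<tau> \<and> (\<forall>k. length \<sigma> \<le> k \<and> k \<le> length \<tau> \<longrightarrow> d \<le> local_density randoms (take k \<tau>))"

lemma above_refl: "d \<le> local_density randoms \<sigma> \<Longrightarrow> above \<sigma> d \<sigma>"
  by (auto simp: above_def)

lemma above_trans:
  assumes "above \<sigma> d \<rho>" "above \<rho> e \<tau>" "d \<le> e"
  shows "above \<sigma> d \<tau>"
  unfolding above_def
proof (intro conjI allI impI)
  show "prefix \<sigma> \<tau>" using assms(1,2) prefix_order.trans unfolding above_def by blast
  fix k assume k: "length \<sigma> \<le> k \<and> k \<le> length \<tau>"
  show "d \<le> local_density randoms (take k \<tau>)"
  proof (cases "k \<le> length \<rho>")
    case True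
    then have "take k \<tau> = take k \<rho>" using assms(2) by (auto simp: above_def prefix_def)
    with assms(1) True k show ?thesis by (simp add: above_def)
  next
    case False
    then have "e \<le> local_density randoms (take k \<tau>)" using assms(2) k by (simp add: above_def)
    with assms(3) show ?thesis by simp
  qed
qed

lemma above_weaken: "above \<sigma> e \<tau> \<Longrightarrow> d \<le> e \<Longrightarrow> above \<sigma> d \<tau>"
  unfolding above_def by force

lemma sets_tube [measurable]: "tube \<sigma> d \<in> sets coin_measure"
proof -
  have "tube \<sigma> d = cylinder \<sigma> \<inter> (\<Inter>k. {Z. length \<sigma> \<le> k \<longrightarrow> d \<le> local_density randoms (pre Z k)})"
    by (auto simp: tube_def)
  moreover have "{Z. length \<sigma> \<le> k \<longrightarrow> d \<le> local_density randoms (pre Z k)} \<in> sets coin_measure" for k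
    by (rule sets_coin_measure)
  ultimately show ?thesis by auto
qed

lemma tube_subset_randoms:
  assumes "0 < d"
  shows "tube \<sigma> d \<subseteq> randoms"
proof
  fix Z assume Z: "Z \<in> tube \<sigma> d"
  show "Z \<in> randoms"
  proof
    assume "Z \<in> opn nonrandom"
    then obtain m where "nonrandom (pre Z m)" unfolding opn_def by blast
    then have "nonrandom (pre Z (m + length \<sigma>))"
      by (rule ext_closed_pre[OF ext_closed_nonrandom]) simp
    from local_density_randoms_nonrandom[OF this] Z assms show False
      unfolding tube_def by (metis (no_types, lifting) le_add2 mem_Collect_eq not_less)
  qed
qed

text \<open>A random point above \<rho> that leaves the tube passes through a minimal string of
  density below \<open>d\<close>. These strings are incomparable, so such points fill at most the
  proportion \<open>d\<close> of the cylinder of \<rho>.\<close>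

lemma local_density_tube:
  assumes "above \<sigma> d \<rho>" "0 \<le> d"
  shows "local_density randoms \<rho> - d \<le> local_density (tube \<sigma> d) \<rho>"
proof -
  let ?G = "\<lambda>\<tau>. prefix \<rho> \<tau> \<and> local_density randoms \<tau> < d"
  let ?A = "{\<tau>. ?G \<tau> \<and> (\<forall>\<tau>'. strict_prefix \<tau>' \<tau> \<longrightarrow> \<not> ?G \<tau>')}"
  have "randoms \<inter> cylinder \<rho> \<subseteq> (tube \<sigma> d \<inter> cylinder \<rho>) \<union> (\<Union>\<tau>\<in>?A. randoms \<inter> cylinder \<tau>)"
  proof
    fix Z assume Z: "Z \<in> randoms \<inter> cylinder \<rho>"
    show "Z \<in> (tube \<sigma> d \<inter> cylinder \<rho>) \<union> (\<Union>\<tau>\<in>?A. randoms \<inter> cylinder \<tau>)"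
    proof (cases "\<exists>m. ?G (pre Z m)")
      case True
      then obtain m where "?G (pre Z m)" by blast
      from minimal_prefix_exists[of ?G, OF this] obtain \<tau> where "prefix \<tau> (pre Z m)" "\<tau> \<in> ?A" by blast
      then have "Z \<in> cylinder \<tau>" using cylinder_mono by fastforce
      with Z \<open>\<tau> \<in> ?A\<close> show ?thesis by blast
    next
      case False
      have "d \<le> local_density randoms (pre Z k)" if "length \<sigma> \<le> k" for k
      proof (cases "k \<le> length \<rho>")
        case True
        then have "pre Z k = take k \<rho>" using Z by (simp add: in_cylinder_iff flip: take_pre) (metis take_pre min.absorb1)
        with assms(1) that True show ?thesis by (simp add: above_def)
      next
        case F: False
        then have "prefix \<rho> (pre Z k)" using Z by (intro in_cylinder_prefix) auto
        with False show ?thesis by force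
      qed
      moreover have "Z \<in> cylinder \<sigma>" using Z assms(1) cylinder_mono unfolding above_def by blast
      ultimately show ?thesis using Z unfolding tube_def by blast
    qed
  qed
  moreover have sets: "(\<Union>\<tau>\<in>?A. randoms \<inter> cylinder \<tau>) \<in> sets coin_measure"
    by (rule sets.countable_UN') (auto intro: countable_subset[OF subset_UNIV])
  ultimately have "measure coin_measure (randoms \<inter> cylinder \<rho>) \<le>
      measure coin_measure ((tube \<sigma> d \<inter> cylinder \<rho>) \<union> (\<Union>\<tau>\<in>?A. randoms \<inter> cylinder \<tau>))"
    by (intro coin.finite_measure_mono) auto
  also have "\<dots> \<le> measure coin_measure (tube \<sigma> d \<inter> cylinder \<rho>) +
      measure coin_measure (\<Union>\<tau>\<in>?A. randoms \<inter> cylinder \<tau>)"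
    using sets by (intro measure_Un_le) auto
  also have "measure coin_measure (\<Union>\<tau>\<in>?A. randoms \<inter> cylinder \<tau>) \<le>
      d * measure coin_measure (\<Union>\<tau>\<in>?A. cylinder \<tau>)"
    using assms(2) by (intro measure_UN_prefix_free_le prefix_free_minimal)
      (auto simp: measure_eq_local_density intro!: mult_right_mono)
  also have "\<dots> \<le> d * measure coin_measure (cylinder \<rho>)"
    using assms(2) cylinder_mono by (intro mult_left_mono coin.finite_measure_mono sets_cylinder) blast+
  finally have "local_density randoms \<rho> * (1 / 2) ^ length \<rho> \<le>
      local_density (tube \<sigma> d) \<rho> * (1 / 2) ^ length \<rho> + d * (1 / 2) ^ length \<rho>"
    by (simp add: measure_eq_local_density measure_cylinder)
  then have "local_density randoms \<rho> * (1 / 2) ^ length \<rho> \<le> (local_density (tube \<sigma> d) \<rho> + d) * (1 / 2) ^ length \<rho>"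
    by (simp add: distrib_right)
  then have "local_density randoms \<rho> \<le> local_density (tube \<sigma> d) \<rho> + d"
    by (rule mult_right_le_imp_le) simp
  then show ?thesis by linarith
qed

text \<open>The tube has positive measure and is approximated from outside by the clopen sets
  \<open>Q m\<close>. If every string reachable from \<sigma> had density at most 3/4, the tube
  would fill at most 3/4 of each \<open>Q m\<close>, contradicting the approximation.\<close>

lemma local_density_ascend:
  assumes "0 < d" "d < local_density randoms \<sigma>"
  shows "\<exists>\<rho>. above \<sigma> d \<rho> \<and> 3 / 4 < local_density randoms \<rho>"
proof -
  define Q where "Q m = {Z \<in> cylinder \<sigma>. \<forall>k. length \<sigma> \<le> k \<and> k \<le> m \<longrightarrow> d \<le> local_density randoms (pre Z k)}" for m
  let ?T = "tube \<sigma> d"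
  have setsQ [measurable]: "Q m \<in> sets coin_measure" for m
  proof -
    have "Q m = cylinder \<sigma> \<inter> (\<Inter>k. {Z. length \<sigma> \<le> k \<and> k \<le> m \<longrightarrow> d \<le> local_density randoms (pre Z k)})"
      by (auto simp: Q_def)
    moreover have "{Z. length \<sigma> \<le> k \<and> k \<le> m \<longrightarrow> d \<le> local_density randoms (pre Z k)} \<in> sets coin_measure" for k
      by (rule sets_coin_measure)
    ultimately show ?thesis by auto
  qed
  have "0 < local_density ?T \<sigma>" using local_density_tube[of \<sigma> d \<sigma>] above_refl[of d \<sigma>] assms by simp
  moreover have "?T \<inter> cylinder \<sigma> = ?T" by (auto simp: tube_def)
  ultimately have pos: "0 < measure coin_measure ?T" by (simp add: local_density_def zero_less_mult_iff)
  have "?T = (\<Inter>m. Q m)" by (auto simp: tube_def Q_def)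
  moreover have "decseq Q" unfolding decseq_def Q_def by auto
  ultimately have "(\<lambda>m. measure coin_measure (Q m)) \<longlonglongrightarrow> measure coin_measure ?T"
    using coin.finite_Lim_measure_decseq[of Q] setsQ by (simp add: image_subset_iff)
  \<comment> \<open>The factor 4/3 is the reciprocal of the density bound 3/4 refuted at the
    end.\<close>
  moreover have "measure coin_measure ?T < 4 / 3 * measure coin_measure ?T" using pos by simp
  ultimately have "\<forall>\<^sub>F m in sequentially. measure coin_measure (Q m) < 4 / 3 * measure coin_measure ?T"
    by (rule order_tendstoD(2))
  then obtain m where m: "length \<sigma> \<le> m" "measure coin_measure (Q m) < 4 / 3 * measure coin_measure ?T"
    unfolding eventually_sequentially by (meson le_cases)
  show ?thesis
  proof (rule ccontr)
    assume no: "\<nexists>\<rho>. above \<sigma> d \<rho> \<and> 3 / 4 < local_density randoms \<rho>"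
    let ?S = "{\<rho>. length \<rho> = m \<and> above \<sigma> d \<rho>}"
    have QS: "Z \<in> Q m \<longleftrightarrow> pre Z m \<in> ?S" for Z
      using m(1) by (auto simp: Q_def above_def in_cylinder_iff prefix_pre_iff min_def)
    have "?T \<subseteq> (\<Union>\<rho>\<in>?S. randoms \<inter> cylinder \<rho>)"
    proof
      fix Z assume Z: "Z \<in> ?T"
      then have "Z \<in> Q m" by (auto simp: tube_def Q_def)
      then have "pre Z m \<in> ?S" unfolding QS .
      moreover have "Z \<in> randoms \<inter> cylinder (pre Z m)"
        using Z tube_subset_randoms[OF assms(1)] by auto
      ultimately show "Z \<in> (\<Union>\<rho>\<in>?S. randoms \<inter> cylinder \<rho>)" by blast
    qed
    moreover have "(\<Union>\<rho>\<in>?S. randoms \<inter> cylinder \<rho>) \<in> sets coin_measure"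
      using finite_strings_length by (intro sets.finite_UN) auto
    ultimately have "measure coin_measure ?T \<le> measure coin_measure (\<Union>\<rho>\<in>?S. randoms \<inter> cylinder \<rho>)"
      by (intro coin.finite_measure_mono)
    also have "\<dots> \<le> 3 / 4 * measure coin_measure (\<Union>\<rho>\<in>?S. cylinder \<rho>)"
    proof (rule measure_UN_prefix_free_le)
      show "prefix_free ?S" unfolding prefix_free_def by (auto intro: prefix_eq_length)
      show "measure coin_measure (randoms \<inter> cylinder \<rho>) \<le> 3 / 4 * (1 / 2) ^ length \<rho>" if "\<rho> \<in> ?S" for \<rho>
        unfolding measure_eq_local_density using that no by (intro mult_right_mono) (auto simp: not_less)
    qed auto
    also have "(\<Union>\<rho>\<in>?S. cylinder \<rho>) \<subseteq> Q m"
    proof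
      fix Z assume "Z \<in> (\<Union>\<rho>\<in>?S. cylinder \<rho>)"
      then have "pre Z m \<in> ?S" by (auto simp: in_cylinder_iff)
      then show "Z \<in> Q m" unfolding QS .
    qed
    then have "3 / 4 * measure coin_measure (\<Union>\<rho>\<in>?S. cylinder \<rho>) \<le> 3 / 4 * measure coin_measure (Q m)"
      by (intro mult_left_mono coin.finite_measure_mono) auto
    finally show False using m(2) by simp
  qed
qed

text \<open>Some extension is nonrandom and has density 0. On the way to it, the first string of
  density at most 3/4 follows one of density above 3/4, so its density is still at least
  1/2.\<close>

lemma local_density_descend:
  assumes "3 / 4 < local_density randoms \<rho>"
  shows "\<exists>\<tau>. above \<rho> (1 / 2) \<tau> \<and> length \<rho> < length \<tau> \<and> local_density randoms \<tau> \<le> 3 / 4"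
proof -
  obtain \<eta> where \<eta>: "prefix \<rho> \<eta>" "nonrandom \<eta>" using nonrandom_dense by blast
  let ?P = "\<lambda>k. length \<rho> \<le> k \<and> local_density randoms (take k \<eta>) \<le> 3 / 4"
  define n where "n = (LEAST k. ?P k)"
  have P: "?P (length \<eta>)" using local_density_randoms_nonrandom[OF \<eta>(2)] prefix_length_le[OF \<eta>(1)] by simp
  then have n: "?P n" unfolding n_def by (rule LeastI)
  have nle: "n \<le> length \<eta>" unfolding n_def using P by (rule Least_le)
  have less: "3 / 4 < local_density randoms (take k \<eta>)" if "length \<rho> \<le> k" "k < n" for k
    using not_less_Least[of k ?P] that unfolding n_def by (auto simp: not_le)
  have "take (length \<rho>) \<eta> = \<rho>" using \<eta>(1) by (auto simp: prefix_def)
  with n assms have "n \<noteq> length \<rho>" by auto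
  with n have gt: "length \<rho> < n" by simp
  then obtain r where r: "n = Suc r" "length \<rho> \<le> r" by (cases n) auto
  have "take n \<eta> = take r \<eta> @ [\<eta> ! r]" using r(1) nle by (simp add: take_Suc_conv_app_nth)
  then have ge: "1 / 2 \<le> local_density randoms (take n \<eta>)"
    using local_density_child[of randoms "take r \<eta>" "\<eta> ! r"] less[of r] r by simp
  have "above \<rho> (1 / 2) (take n \<eta>)" unfolding above_def
  proof (intro conjI allI impI)
    show "prefix \<rho> (take n \<eta>)" using \<eta>(1) gt by (auto simp: prefix_def)
    fix k assume "length \<rho> \<le> k \<and> k \<le> length (take n \<eta>)"
    then have "length \<rho> \<le> k" "k \<le> n" by auto
    then show "1 / 2 \<le> local_density randoms (take k (take n \<eta>))"
      using less[of k] ge by (cases "k = n") auto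
  qed
  with gt nle n show ?thesis by (intro exI[of _ "take n \<eta>"]) auto
qed

lemma local_density_oscillate:
  assumes "0 < d" "d < 1 / 2" "d < local_density randoms \<sigma>"
  shows "\<exists>\<tau>. above \<sigma> d \<tau> \<and> length \<sigma> < length \<tau> \<and> 1 / 2 \<le> local_density randoms \<tau> \<and> local_density randoms \<tau> \<le> 3 / 4"
proof -
  obtain \<rho> where \<rho>: "above \<sigma> d \<rho>" "3 / 4 < local_density randoms \<rho>" using local_density_ascend assms by blast
  obtain \<tau> where \<tau>: "above \<rho> (1 / 2) \<tau>" "length \<rho> < length \<tau>" "local_density randoms \<tau> \<le> 3 / 4"
    using local_density_descend[OF \<rho>(2)] by blast
  have "length \<sigma> \<le> length \<rho>" using \<rho>(1) by (simp add: above_def prefix_length_le)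
  moreover have "1 / 2 \<le> local_density randoms \<tau>" using \<tau>(1) \<tau>(2) unfolding above_def
    by (metis le_refl less_imp_le take_all)
  ultimately show ?thesis using above_trans[OF \<rho>(1) \<tau>(1)] assms(2) \<tau> by (intro exI[of _ \<tau>]) auto
qed

text \<open>Either a tube around \<sigma> with bound \<open>c\<close> misses the open set, and the
  lower bound is raised to some \<open>e\<close> above \<open>c\<close>; or some point of the tube
  enters the open set, and the string is extended along that point while \<open>d\<close> is
  kept.\<close>

lemma forcing_step:
  assumes "0 < d" "d < 1 / 2" "d < local_density randoms \<sigma>"
  shows "\<exists>\<tau> e. above \<sigma> d \<tau> \<and> length \<sigma> < length \<tau> \<and> d \<le> e \<and> e < 1 / 2 \<and> e < local_density randoms \<tau> \<and>
    local_density randoms \<tau> \<le> 3 / 4 \<and>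
    ((\<exists>m\<le>length \<tau>. B (take m \<tau>)) \<or>
     (\<exists>c. d \<le> c \<and> c < e \<and> tube \<sigma> c \<inter> opn B = {} \<and> above \<sigma> e \<tau>))"
proof -
  \<comment> \<open>The gap between \<open>c\<close> and \<open>e\<close> becomes the positive
    density of the complement of the open set.\<close>
  obtain e where e: "d < e" "e < 1 / 2" "e < local_density randoms \<sigma>"
    using dense[of d "min (1 / 2) (local_density randoms \<sigma>)"] assms by auto
  obtain c where c: "d < c" "c < e" using dense e(1) by blast
  show ?thesis
  proof (cases "tube \<sigma> c \<inter> opn B = {}")
    case True
    obtain \<tau> where \<tau>: "above \<sigma> e \<tau>" "length \<sigma> < length \<tau>" "1 / 2 \<le> local_density randoms \<tau>" "local_density randoms \<tau> \<le> 3 / 4"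
      using local_density_oscillate[of e \<sigma>] e assms(1) by auto
    have "above \<sigma> d \<tau>" using above_weaken[OF \<tau>(1)] e(1) by simp
    moreover have "\<exists>c. d \<le> c \<and> c < e \<and> tube \<sigma> c \<inter> opn B = {} \<and> above \<sigma> e \<tau>"
      using \<tau>(1) c True by (intro exI[of _ c]) auto
    ultimately show ?thesis using \<tau> e by (intro exI[of _ \<tau>] exI[of _ e]) auto
  next
    case False
    then obtain Z m where Z: "Z \<in> tube \<sigma> c" and m: "B (pre Z m)" unfolding opn_def by blast
    let ?\<rho> = "pre Z (length \<sigma> + m)"
    have ab: "above \<sigma> c ?\<rho>" unfolding above_def
      using Z by (auto simp: tube_def min_def intro: in_cylinder_prefix)
    moreover have "c \<le> local_density randoms ?\<rho>" using Z by (simp add: tube_def)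
    ultimately obtain \<tau> where \<tau>: "above ?\<rho> d \<tau>" "length ?\<rho> < length \<tau>"
        "1 / 2 \<le> local_density randoms \<tau>" "local_density randoms \<tau> \<le> 3 / 4"
      using local_density_oscillate[of d ?\<rho>] assms c by auto
    have "take m \<tau> = take m ?\<rho>" using \<tau>(1) by (auto simp: above_def prefix_def)
    then have "B (take m \<tau>)" using m by (simp add: min_def)
    have "above \<sigma> d \<tau>" using above_trans[OF above_weaken[OF ab] \<tau>(1)] c by simp
    moreover have "\<exists>m\<le>length \<tau>. B (take m \<tau>)"
      using \<open>B (take m \<tau>)\<close> \<tau>(2) by (intro exI[of _ m]) simp
    ultimately show ?thesis using \<tau> assms by (intro exI[of _ \<tau>] exI[of _ d]) auto
  qed
qed

text \<open>Conditions are pairs of a string and a bound below 1/2 that the density at the string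
  exceeds; the step with number \<open>i\<close> settles the \<open>i\<close>-th open set. The point
  is the limit of the strings.\<close>

theorem generic_point:
  fixes B :: "nat \<Rightarrow> bool list \<Rightarrow> bool"
  shows "\<exists>Z. Z \<in> randoms \<and> (\<forall>N. \<exists>k\<ge>N. local_density randoms (pre Z k) \<le> 3 / 4) \<and>
    (\<forall>i. Z \<in> opn (B i) \<or> (\<exists>e>0. \<exists>N. \<forall>k\<ge>N. e \<le> local_density (- opn (B i)) (pre Z k)))"
proof -
  define cond where "cond s \<longleftrightarrow> 0 < snd s \<and> snd s < 1 / 2 \<and> snd s < local_density randoms (fst s)"
    for s :: "bool list \<times> real"
  define step where "step i s t \<longleftrightarrow> above (fst s) (snd s) (fst t) \<and> length (fst s) < length (fst t) \<and>
      snd s \<le> snd t \<and> local_density randoms (fst t) \<le> 3 / 4 \<and>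
      ((\<exists>m\<le>length (fst t). B i (take m (fst t))) \<or>
       (\<exists>c. snd s \<le> c \<and> c < snd t \<and> tube (fst s) c \<inter> opn (B i) = {} \<and> above (fst s) (snd t) (fst t)))"
    for i and s t :: "bool list \<times> real"
  have "local_density randoms [] = 1 - measure coin_measure (opn nonrandom)"
    using coin.prob_compl[OF sets_opn[of nonrandom]]
    by (simp add: local_density_def cylinder_def Compl_eq_Diff_UNIV)
  then have "1 / 4 < local_density randoms []" using measure_nonrandom by simp
  \<comment> \<open>The random points have measure at least 1/2, which leaves room for the initial
    bound 1/4.\<close>
  then have "\<exists>s. cond s" by (intro exI[of _ "([], 1 / 4)"]) (simp add: cond_def)
  moreover have "\<exists>t. cond t \<and> step i s t" if "cond s" for s i
  proof -
    have "0 < snd s" "snd s < 1 / 2" "snd s < local_density randoms (fst s)"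
      using that by (simp_all add: cond_def)
    from forcing_step[OF this, of "B i"] obtain \<tau> e where
      "above (fst s) (snd s) \<tau> \<and> length (fst s) < length \<tau> \<and> snd s \<le> e \<and> e < 1 / 2 \<and>
        e < local_density randoms \<tau> \<and> local_density randoms \<tau> \<le> 3 / 4 \<and>
        ((\<exists>m\<le>length \<tau>. B i (take m \<tau>)) \<or>
         (\<exists>c. snd s \<le> c \<and> c < e \<and> tube (fst s) c \<inter> opn (B i) = {} \<and> above (fst s) e \<tau>))"
      by (elim exE)
    then have "cond (\<tau>, e) \<and> step i s (\<tau>, e)" using that by (simp add: cond_def step_def)
    then show ?thesis by blast
  qed
  ultimately obtain f where f: "\<And>i. cond (f i)" "\<And>i. step i (f i) (f (Suc i))"
    using dependent_nat_choice[of "\<lambda>_. cond" step] by metis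
  define \<sigma> where "\<sigma> i = fst (f i)" for i
  define d where "d i = snd (f i)" for i
  have d: "0 < d i" "d i < 1 / 2" "d i < local_density randoms (\<sigma> i)" for i
    using f(1)[of i] by (auto simp: cond_def d_def \<sigma>_def)
  have st: "above (\<sigma> i) (d i) (\<sigma> (Suc i))" "length (\<sigma> i) < length (\<sigma> (Suc i))" "d i \<le> d (Suc i)"
      "local_density randoms (\<sigma> (Suc i)) \<le> 3 / 4"
      "(\<exists>m\<le>length (\<sigma> (Suc i)). B i (take m (\<sigma> (Suc i)))) \<or>
       (\<exists>c. d i \<le> c \<and> c < d (Suc i) \<and> tube (\<sigma> i) c \<inter> opn (B i) = {} \<and>
         above (\<sigma> i) (d (Suc i)) (\<sigma> (Suc i)))" for i
    using f(2)[of i] by (auto simp: step_def d_def \<sigma>_def)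
  have ab: "above (\<sigma> i) (d i) (\<sigma> (i + n)) \<and> d i \<le> d (i + n)" for i n
  proof (induction n)
    case 0
    then show ?case using d(3)[of i] by (simp add: above_refl)
  next
    case (Suc n)
    then show ?case using above_trans[OF _ st(1)[of "i + n"]] st(3)[of "i + n"] by force
  qed
  have len: "n \<le> length (\<sigma> n)" for n
  proof (induction n)
    case (Suc n)
    then show ?case using st(2)[of n] by simp
  qed simp
  have pref: "prefix (\<sigma> i) (\<sigma> j)" if "i \<le> j" for i j
    using ab[of i "j - i"] that by (simp add: above_def)
  \<comment> \<open>The string \<open>\<sigma> (Suc i)\<close> has length above \<open>i\<close>,
    and all the strings are comparable.\<close>
  define Z where "Z i = \<sigma> (Suc i) ! i" for i
  have nth: "\<sigma> n ! i = Z i" if "i < length (\<sigma> n)" for i n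
  proof -
    have "i < length (\<sigma> (Suc i))" using len[of "Suc i"] by simp
    moreover have "prefix (\<sigma> n) (\<sigma> (Suc i)) \<or> prefix (\<sigma> (Suc i)) (\<sigma> n)" using pref nle_le by metis
    ultimately show ?thesis using that by (auto simp: Z_def prefix_def nth_append)
  qed
  have preZ: "pre Z (length (\<sigma> n)) = \<sigma> n" for n
    by (rule nth_equalityI) (auto simp: nth)
  have take: "take k (\<sigma> n) = pre Z k" if "k \<le> length (\<sigma> n)" for k n
    using take_pre[of k Z "length (\<sigma> n)"] that by (simp add: preZ min_def)
  have dens: "d n \<le> local_density randoms (pre Z k)" if "length (\<sigma> n) \<le> k" for n k
  proof -
    have k: "k \<le> length (\<sigma> (n + k))" using len[of "n + k"] by simp
    then have "d n \<le> local_density randoms (take k (\<sigma> (n + k)))"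
      using ab[of n k] that unfolding above_def by blast
    then show ?thesis using take[OF k] by simp
  qed
  have "Z \<in> randoms"
  proof
    assume "Z \<in> opn nonrandom"
    then obtain m where "nonrandom (pre Z m)" unfolding opn_def by blast
    then have "nonrandom (pre Z (m + length (\<sigma> 0)))"
      by (rule ext_closed_pre[OF ext_closed_nonrandom]) simp
    from local_density_randoms_nonrandom[OF this] dens[of 0 "m + length (\<sigma> 0)"] d(1)[of 0] show False by simp
  qed
  moreover have "\<exists>k\<ge>N. local_density randoms (pre Z k) \<le> 3 / 4" for N
    using st(4)[of N] len[of "Suc N"] preZ[of "Suc N"]
    by (intro exI[of _ "length (\<sigma> (Suc N))"]) simp
  moreover have "Z \<in> opn (B i) \<or> (\<exists>e>0. \<exists>N. \<forall>k\<ge>N. e \<le> local_density (- opn (B i)) (pre Z k))" for i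
    using st(5)[of i]
  proof
    assume "\<exists>m\<le>length (\<sigma> (Suc i)). B i (take m (\<sigma> (Suc i)))"
    then show ?thesis using take unfolding opn_def by force
  next
    assume "\<exists>c. d i \<le> c \<and> c < d (Suc i) \<and> tube (\<sigma> i) c \<inter> opn (B i) = {} \<and>
        above (\<sigma> i) (d (Suc i)) (\<sigma> (Suc i))"
    then obtain c where c: "d i \<le> c" "c < d (Suc i)" "tube (\<sigma> i) c \<inter> opn (B i) = {}"
      "above (\<sigma> i) (d (Suc i)) (\<sigma> (Suc i))" by blast
    have ge: "d (Suc i) \<le> local_density randoms (pre Z k)" if "length (\<sigma> i) \<le> k" for k
    proof (cases "k \<le> length (\<sigma> (Suc i))")
      case True
      with c(4) that have "d (Suc i) \<le> local_density randoms (take k (\<sigma> (Suc i)))"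
        unfolding above_def by blast
      with take[OF True] show ?thesis by simp
    qed (intro dens, simp)
    \<comment> \<open>The tube with bound \<open>c\<close> lies in the complement of the open set,
      and \<open>local_density_tube\<close> turns the surplus of the density over \<open>c\<close>
      into density of the tube.\<close>
    have "d (Suc i) - c \<le> local_density (- opn (B i)) (pre Z k)" if "length (\<sigma> i) \<le> k" for k
    proof -
      have "above (\<sigma> i) c (pre Z k)" unfolding above_def
      proof (intro conjI allI impI)
        show "prefix (\<sigma> i) (pre Z k)" using that preZ[of i] by (metis prefix_pre)
        fix j assume "length (\<sigma> i) \<le> j \<and> j \<le> length (pre Z k)"
        then show "c \<le> local_density randoms (take j (pre Z k))"
          using ge[of j] c(2) by (simp add: min_def)
      qed
      then have "local_density randoms (pre Z k) - c \<le> local_density (tube (\<sigma> i) c) (pre Z k)"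
        using c(1) d(1)[of i] by (intro local_density_tube) auto
      also have "\<dots> \<le> local_density (- opn (B i)) (pre Z k)"
        using c(3) by (intro local_density_mono) auto
      finally show ?thesis using ge[OF that] by linarith
    qed
    then have "\<exists>e>0. \<exists>N. \<forall>k\<ge>N. e \<le> local_density (- opn (B i)) (pre Z k)"
      using c(2) by (intro exI[of _ "d (Suc i) - c"]) auto
    then show ?thesis ..
  qed
  ultimately show ?thesis by blast
qed

section \<open>K-trivial sets as paths through thin trees\<close>

text \<open>These strings form a decidable prefix-free set whose disjoint cylinders make up
  \<open>opn nonrandom\<close>.\<close>

definition minimal_nonrandom :: "bool list \<Rightarrow> bool" where
  "minimal_nonrandom \<rho> \<longleftrightarrow> nonrandom \<rho> \<and> (\<forall>k<length \<rho>. \<not> nonrandom (take k \<rho>))"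

lemma dec_minimal_nonrandom:
  assumes "scomputable X f"
  shows "decidable X (\<lambda>n. minimal_nonrandom (f n))"
proof -
  have "decidable X (\<lambda>n. minimal_nonrandom (dstr n))"
    unfolding minimal_nonrandom_def by (intro comp_intros scomp_intros dec_nonrandom)
  from dec_compose[OF this comp_string_code[OF assms]] show ?thesis by simp
qed

lemma minimal_nonrandom_prefix:
  assumes "minimal_nonrandom \<rho>" "nonrandom \<sigma>" "prefix \<sigma> \<rho>"
  shows "\<sigma> = \<rho>"
proof (rule ccontr)
  assume "\<sigma> \<noteq> \<rho>"
  then have "length \<sigma> < length \<rho>" "take (length \<sigma>) \<rho> = \<sigma>"
    using assms(3) by (auto simp: prefix_def)
  with assms(1,2) show False unfolding minimal_nonrandom_def by metis
qed

lemma prefix_free_minimal_nonrandom: "prefix_free {\<rho>. minimal_nonrandom \<rho>}"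
  unfolding prefix_free_def
  using minimal_nonrandom_prefix by (auto simp: minimal_nonrandom_def)

lemma minimal_nonrandom_exists:
  "nonrandom \<sigma> \<Longrightarrow> \<exists>\<rho>. prefix \<rho> \<sigma> \<and> minimal_nonrandom \<rho>"
proof -
  assume "nonrandom \<sigma>"
  from minimal_prefix_exists[of nonrandom, OF this] obtain \<rho> where
    \<rho>: "prefix \<rho> \<sigma>" "nonrandom \<rho>" "\<forall>\<tau>. strict_prefix \<tau> \<rho> \<longrightarrow> \<not> nonrandom \<tau>" by blast
  have "strict_prefix (take k \<rho>) \<rho>" if "k < length \<rho>" for k
    using that by (metis length_take min.absorb4 order_less_irrefl strict_prefixI take_is_prefix)
  with \<rho> show ?thesis unfolding minimal_nonrandom_def by blast
qed

text \<open>A minimal nonrandom string \<open>\<rho>\<close> is itself a description of its code number.\<close>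

lemma K_nat_minimal_nonrandom:
  "\<exists>d. \<forall>c. minimal_nonrandom (dstr c) \<longrightarrow> K_nat c \<le> enat (length (dstr c) + d)"
proof -
  let ?M = "\<lambda>\<rho>. if minimal_nonrandom \<rho> then Some (replicate (string_code \<rho>) False) else None"
  \<comment> \<open>\<open>K_nat\<close> represents \<open>n\<close> by \<open>n\<close> zeros,
    whose code plus one is \<open>2 ^ n\<close>; the search finds this code.\<close>
  let ?P = "\<lambda>n s. minimal_nonrandom (dstr n) \<and> Suc s = 2 ^ n"
  have least: "(LEAST s. ?P n s) = string_code (replicate n False)" if "minimal_nonrandom (dstr n)" for n
    using that string_code_replicate_False[of n] by (intro Least_equality) auto
  have "computable_machine ?M"
  proof (rule computable_machine_search[where P = ?P and g = "\<lambda>s. s"])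
    show "decidable {} (\<lambda>m. ?P (p1 m) (p2 m))"
      by (intro comp_intros scomp_intros dec_minimal_nonrandom)
    show "computable {} (\<lambda>s. s)" by (rule comp_id)
    fix \<sigma>
    have "\<exists>s. Suc s = 2 ^ n" for n using string_code_replicate_False by blast
    then show "?M \<sigma> = (if \<exists>s. ?P (string_code \<sigma>) s
        then Some (dstr (LEAST s. ?P (string_code \<sigma>) s)) else None)"
      using least[of "string_code \<sigma>"] by auto
  qed
  moreover have "dom ?M = {\<rho>. minimal_nonrandom \<rho>}" by (auto simp: dom_def)
  ultimately have "prefix_free_machine ?M"
    unfolding prefix_free_machine_def using prefix_free_minimal_nonrandom by simp
  from K_le_machine[OF this] obtain d where
    d: "\<And>\<sigma> \<tau>. ?M \<sigma> = Some \<tau> \<Longrightarrow> K \<tau> \<le> enat (length \<sigma> + d)" by blast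
  have "K_nat c \<le> enat (length (dstr c) + d)" if "minimal_nonrandom (dstr c)" for c
    unfolding K_nat_def using that by (intro d) simp
  then show ?thesis by blast
qed

text \<open>Only levels \<open>c\<close> that code a minimal nonrandom string impose a condition.
  For each of them the complexity bound limits the size of the level through the Kraft
  inequality.\<close>

definition thin_tree :: "nat \<Rightarrow> nat \<Rightarrow> bool list \<Rightarrow> nat \<Rightarrow> bool" where
  "thin_tree e d \<tau> s \<longleftrightarrow>
    (\<forall>c\<le>length \<tau>. minimal_nonrandom (dstr c) \<longrightarrow> K_stage e (take c \<tau>) (length (dstr c) + d) s)"

lemma thin_tree_mono: "thin_tree e d \<tau> s \<Longrightarrow> s \<le> t \<Longrightarrow> thin_tree e d \<tau> t"
  unfolding thin_tree_def using K_stage_mono by blast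

lemma thin_tree_take: "thin_tree e d \<tau> s \<Longrightarrow> thin_tree e d (take n \<tau>) s"
  unfolding thin_tree_def by (auto simp: min_def)

lemma dec_thin_tree:
  assumes "scomputable X f" "computable X s"
  shows "decidable X (\<lambda>n. thin_tree e d (f n) (s n))"
proof -
  have "decidable X (\<lambda>n. thin_tree e d (dstr (p1 n)) (p2 n))"
    unfolding thin_tree_def by (intro comp_intros scomp_intros dec_minimal_nonrandom dec_K_stage)
  from dec_compose[OF this, of "\<lambda>n. prod_encode (string_code (f n), s n)"] assms
  show ?thesis by (simp add: comp_pair comp_string_code)
qed

text \<open>At a level \<open>c\<close> coding a minimal nonrandom string, the constant of
  triviality adds to the constant bounding \<open>K_nat c\<close> in terms of the length of that
  string. Finitely many levels are confirmed by a common stage.\<close>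

lemma K_trivial_path:
  assumes "K_trivial A" and e: "\<And>\<tau> k. K \<tau> \<le> enat k \<longleftrightarrow> (\<exists>s. K_stage e \<tau> k s)"
  shows "\<exists>d. \<forall>n. \<exists>s. thin_tree e d (pre (\<lambda>i. i \<in> A) n) s"
proof -
  from assms(1) obtain b where b: "\<And>n. K (initial_segment A n) \<le> K_nat n + enat b"
    unfolding K_trivial_def by blast
  obtain d where d: "\<And>c. minimal_nonrandom (dstr c) \<Longrightarrow> K_nat c \<le> enat (length (dstr c) + d)"
    using K_nat_minimal_nonrandom by blast
  let ?A = "pre (\<lambda>i. i \<in> A)"
  have "\<exists>s. K_stage e (?A c) (length (dstr c) + (d + b)) s" if "minimal_nonrandom (dstr c)" for c
  proof -
    have "K (?A c) \<le> K_nat c + enat b" using b by (simp add: initial_segment_eq_pre)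
    also have "\<dots> \<le> enat (length (dstr c) + d) + enat b" using d[OF that] by (rule add_right_mono)
    finally show ?thesis unfolding e[symmetric] by (simp add: add.assoc)
  qed
  then obtain t where t: "\<And>c. minimal_nonrandom (dstr c) \<Longrightarrow>
      K_stage e (?A c) (length (dstr c) + (d + b)) (t c)" by metis
  have "thin_tree e (d + b) (?A n) (\<Sum>c\<le>n. t c)" for n
    unfolding thin_tree_def
  proof (intro allI impI)
    fix c assume c: "c \<le> length (?A n)" "minimal_nonrandom (dstr c)"
    then have "t c \<le> (\<Sum>c\<le>n. t c)" by (intro member_le_sum) auto
    from K_stage_mono[OF t[OF c(2)] this] c(1)
    show "K_stage e (take c (?A n)) (length (dstr c) + (d + b)) (\<Sum>c\<le>n. t c)"
      by (simp add: min_def)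
  qed
  then show ?thesis by blast
qed

lemma prefix_take: "prefix \<rho> \<alpha> \<Longrightarrow> length \<rho> \<le> n \<Longrightarrow> prefix \<rho> (take n \<alpha>)"
  by (rule prefix_length_prefix[OF _ take_is_prefix]) (auto dest: prefix_length_le)

text \<open>Adding one string \<eta> to the set creates at most one new branching, namely where
  \<eta> leaves the prefixes of the old strings.\<close>

lemma card_branchings:
  fixes S :: "bool list set"
  shows "finite S \<Longrightarrow> finite {\<tau>. \<forall>b. \<exists>\<alpha>\<in>S. prefix (\<tau> @ [b]) \<alpha>} \<and>
    card {\<tau>. \<forall>b. \<exists>\<alpha>\<in>S. prefix (\<tau> @ [b]) \<alpha>} \<le> card S"
proof (induction S rule: finite_induct)
  case (insert \<eta> S)
  let ?B = "\<lambda>S. {\<tau>. \<forall>b. \<exists>\<alpha>\<in>S. prefix (\<tau> @ [b]) \<alpha>}"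
  have new: "\<exists>b. prefix (\<tau> @ [b]) \<eta> \<and> (\<forall>\<alpha>\<in>S. \<not> prefix (\<tau> @ [b]) \<alpha>) \<and> (\<exists>\<alpha>\<in>S. prefix (\<tau> @ [\<not> b]) \<alpha>)"
    if \<tau>: "\<tau> \<in> ?B (insert \<eta> S)" "\<tau> \<notin> ?B S" for \<tau>
  proof -
    from \<tau>(2) obtain b where b: "\<forall>\<alpha>\<in>S. \<not> prefix (\<tau> @ [b]) \<alpha>" by blast
    with \<tau>(1) have p: "prefix (\<tau> @ [b]) \<eta>" by blast
    then have "\<not> prefix (\<tau> @ [\<not> b]) \<eta>" by (auto simp: prefix_def)
    with \<tau>(1) have "\<exists>\<alpha>\<in>S. prefix (\<tau> @ [\<not> b]) \<alpha>" by blast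
    with b p show ?thesis by blast
  qed
  \<comment> \<open>If two new branchings had different lengths, the child of the shorter one along
    \<eta> would be a prefix of the longer one, hence of an old string.\<close>
  have longer: "\<not> length \<tau> < length \<tau>'"
    if B: "\<tau> \<in> ?B (insert \<eta> S)" "\<tau> \<notin> ?B S" "\<tau>' \<in> ?B (insert \<eta> S)" "\<tau>' \<notin> ?B S" for \<tau> \<tau>'
  proof
    assume less: "length \<tau> < length \<tau>'"
    obtain b where b: "prefix (\<tau> @ [b]) \<eta>" "\<forall>\<alpha>\<in>S. \<not> prefix (\<tau> @ [b]) \<alpha>" using new[OF B(1,2)] by blast
    obtain b' \<alpha> where b': "prefix (\<tau>' @ [b']) \<eta>" "\<alpha> \<in> S" "prefix (\<tau>' @ [\<not> b']) \<alpha>"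
      using new[OF B(3,4)] by blast
    have "prefix \<tau>' \<eta>" "prefix \<tau>' \<alpha>" using b'(1,3) by (auto dest: append_prefixD)
    have "prefix (\<tau> @ [b]) \<tau>'"
      by (rule prefix_length_prefix[OF b(1) \<open>prefix \<tau>' \<eta>\<close>]) (use less in simp)
    with \<open>prefix \<tau>' \<alpha>\<close> b(2) b'(2) show False
      using prefix_order.trans[of "\<tau> @ [b]" \<tau>' \<alpha>] by blast
  qed
  have same: "\<tau> = \<tau>'"
    if B: "\<tau> \<in> ?B (insert \<eta> S)" "\<tau> \<notin> ?B S" "\<tau>' \<in> ?B (insert \<eta> S)" "\<tau>' \<notin> ?B S" for \<tau> \<tau>'
  proof -
    have "prefix \<tau> \<eta>" "prefix \<tau>' \<eta>" using new[OF B(1,2)] new[OF B(3,4)] append_prefixD by blast+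
    moreover have "length \<tau> = length \<tau>'" using longer[OF B] longer[OF B(3,4,1,2)] by linarith
    ultimately show ?thesis by (metis prefix_iff_take)
  qed
  obtain \<tau>\<^sub>0 where "?B (insert \<eta> S) \<subseteq> insert \<tau>\<^sub>0 (?B S)"
  proof (cases "?B (insert \<eta> S) \<subseteq> ?B S")
    case False
    then obtain \<tau> where "\<tau> \<in> ?B (insert \<eta> S)" "\<tau> \<notin> ?B S" by blast
    with same show ?thesis by (intro that[of \<tau>]) blast
  qed (use that in blast)
  moreover have "finite (insert \<tau>\<^sub>0 (?B S))" "card (insert \<tau>\<^sub>0 (?B S)) \<le> Suc (card S)"
    using insert.IH by (auto simp: card_insert_if)
  ultimately have "finite (?B (insert \<eta> S))" "card (?B (insert \<eta> S)) \<le> Suc (card S)"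
    by (meson finite_subset, meson card_mono le_trans)
  with insert.hyps show ?case by simp
qed simp

section \<open>Computing K-trivial sets\<close>

text \<open>Minimal nonrandom strings with codes from \<open>x + 1\<close> to \<open>y\<close> cover at least an eighth of the
  cylinder of \<open>\<sigma>\<close>; the inequality is multiplied by \<open>2\<close> to the power \<open>length \<sigma> + y\<close> to stay within the
  natural numbers.\<close>

definition gain :: "nat \<Rightarrow> nat \<Rightarrow> bool list \<Rightarrow> bool" where
  "gain x y \<sigma> \<longleftrightarrow> (2::nat) ^ y \<le> 8 * (\<Sum>c<Suc y.
    of_bool (x < c \<and> minimal_nonrandom (dstr c) \<and> prefix \<sigma> (dstr c)) * 2 ^ (length \<sigma> + y - length (dstr c)))"

definition gain_strings :: "nat \<Rightarrow> nat \<Rightarrow> bool list set" where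
  "gain_strings x y = {\<rho>. x < string_code \<rho> \<and> string_code \<rho> \<le> y \<and> minimal_nonrandom \<rho>}"

lemma gain_strings_eq: "gain_strings x y = dstr ` {c. x < c \<and> c \<le> y \<and> minimal_nonrandom (dstr c)}"
  unfolding gain_strings_def by (auto simp: image_iff) (metis dstr_string_code)

lemma finite_gain_strings: "finite (gain_strings x y)"
  unfolding gain_strings_eq by simp

text \<open>Division by \<open>2 ^ (length \<sigma> + y)\<close> turns the integer inequality of
  \<open>gain\<close> into this one between measures.\<close>

lemma gain_iff:
  "gain x y \<sigma> \<longleftrightarrow>
    (1 / 2 :: real) ^ length \<sigma> \<le> 8 * (\<Sum>\<rho>\<in>{\<rho> \<in> gain_strings x y. prefix \<sigma> \<rho>}. (1 / 2) ^ length \<rho>)"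
proof -
  let ?C = "{c. c < Suc y \<and> x < c \<and> minimal_nonrandom (dstr c) \<and> prefix \<sigma> (dstr c)}"
  have "(\<Sum>c<Suc y. of_bool (x < c \<and> minimal_nonrandom (dstr c) \<and> prefix \<sigma> (dstr c)) *
        2 ^ (length \<sigma> + y - length (dstr c)))
      = (\<Sum>c\<in>?C. 2 ^ (length \<sigma> + y - length (dstr c)) :: nat)" (is "?S = _")
    using sum.inter_filter[of "{..<Suc y}" "\<lambda>c. 2 ^ (length \<sigma> + y - length (dstr c)) :: nat"
        "\<lambda>c. x < c \<and> minimal_nonrandom (dstr c) \<and> prefix \<sigma> (dstr c)"]
    by (simp add: of_bool_def if_distrib[of "\<lambda>x. x * _"] del: sum.lessThan_Suc cong: if_cong)
  then have "real ?S = (\<Sum>c\<in>?C. 2 ^ (length \<sigma> + y - length (dstr c)))" by simp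
  also have "\<dots> = (\<Sum>c\<in>?C. 2 ^ (length \<sigma> + y) * (1 / 2) ^ length (dstr c))"
  proof (rule sum.cong[OF refl])
    fix c assume "c \<in> ?C"
    \<comment> \<open>A string is no longer than its code, so the truncated subtraction in the
      exponent is exact.\<close>
    then have "length (dstr c) \<le> length \<sigma> + y" using length_dstr_le[of c] by simp
    then show "(2 :: real) ^ (length \<sigma> + y - length (dstr c)) = 2 ^ (length \<sigma> + y) * (1 / 2) ^ length (dstr c)"
      by (simp add: power_diff power_one_over)
  qed
  also have "\<dots> = 2 ^ (length \<sigma> + y) * (\<Sum>\<rho>\<in>dstr ` ?C. (1 / 2) ^ length \<rho>)"
    by (subst sum.reindex) (auto simp: inj_on_def sum_distrib_left)
  also have "dstr ` ?C = {\<rho> \<in> gain_strings x y. prefix \<sigma> \<rho>}"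
    unfolding gain_strings_eq by auto
  finally have S: "real ?S = 2 ^ (length \<sigma> + y) * (\<Sum>\<rho>\<in>{\<rho> \<in> gain_strings x y. prefix \<sigma> \<rho>}. (1 / 2) ^ length \<rho>)" .
  have "gain x y \<sigma> \<longleftrightarrow> real (2 ^ y) \<le> real (8 * ?S)"
    unfolding gain_def by (simp only: of_nat_le_iff)
  also have "\<dots> \<longleftrightarrow> 2 ^ y * 1 \<le> (2::real) ^ y * (2 ^ length \<sigma> * (8 * (\<Sum>\<rho>\<in>{\<rho> \<in> gain_strings x y. prefix \<sigma> \<rho>}. (1 / 2) ^ length \<rho>)))"
    using S by (simp add: power_add algebra_simps del: sum.lessThan_Suc)
  also have "\<dots> \<longleftrightarrow> 1 \<le> 2 ^ length \<sigma> * (8 * (\<Sum>\<rho>\<in>{\<rho> \<in> gain_strings x y. prefix \<sigma> \<rho>}. (1 / 2 :: real) ^ length \<rho>))"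
    by (rule mult_le_cancel_left_pos) simp
  also have "\<dots> \<longleftrightarrow> (1 / 2 :: real) ^ length \<sigma> \<le> 8 * (\<Sum>\<rho>\<in>{\<rho> \<in> gain_strings x y. prefix \<sigma> \<rho>}. (1 / 2) ^ length \<rho>)"
    by (simp add: power_one_over divide_le_eq mult_ac)
  finally show ?thesis .
qed

lemma gain_mono: "gain x y \<sigma> \<Longrightarrow> y \<le> z \<Longrightarrow> gain x z \<sigma>"
proof -
  assume "gain x y \<sigma>" "y \<le> z"
  have "(\<Sum>\<rho>\<in>{\<rho> \<in> gain_strings x y. prefix \<sigma> \<rho>}. (1 / 2 :: real) ^ length \<rho>) \<le>
      (\<Sum>\<rho>\<in>{\<rho> \<in> gain_strings x z. prefix \<sigma> \<rho>}. (1 / 2) ^ length \<rho>)"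
  proof (rule sum_mono2)
    show "finite {\<rho> \<in> gain_strings x z. prefix \<sigma> \<rho>}" by (simp add: finite_gain_strings)
  qed (use \<open>y \<le> z\<close> in \<open>auto simp: gain_strings_def\<close>)
  with \<open>gain x y \<sigma>\<close> show ?thesis unfolding gain_iff by linarith
qed

lemma dec_gain:
  assumes "computable X x" "computable X y" "scomputable X f"
  shows "decidable X (\<lambda>n. gain (x n) (y n) (f n))"
proof -
  have "decidable X (\<lambda>n. gain (p1 n) (p1 (p2 n)) (dstr (p2 (p2 n))))"
    unfolding gain_def by (intro comp_intros scomp_intros dec_minimal_nonrandom)
  from dec_compose[OF this, of "\<lambda>n. prod_encode (x n, prod_encode (y n, string_code (f n)))"] assms
  show ?thesis by (simp add: comp_pair comp_string_code)
qed

text \<open>The threshold of an eighth enters the maximal inequality as the factor 8.\<close>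

lemma measure_gain:
  "measure coin_measure (opn (gain x y)) \<le> 8 * (\<Sum>\<rho>\<in>gain_strings x y. (1 / 2) ^ length \<rho>)"
  by (rule maximal_inequality[OF finite_gain_strings]) (auto simp: gain_iff)

text \<open>At a prefix with density of the randoms at most 3/4, minimal nonrandom extensions cover
  at least a quarter of the cylinder, so finitely many cover more than an eighth. A prefix longer
  than \<open>x\<close> forces their codes above \<open>x\<close>.\<close>

lemma gain_exists:
  assumes Z: "Z \<in> randoms" and osc: "\<And>N. \<exists>k\<ge>N. local_density randoms (pre Z k) \<le> 3 / 4"
  shows "\<exists>y k. gain x y (pre Z k)"
proof (rule ccontr)
  assume no: "\<nexists>y k. gain x y (pre Z k)"
  obtain k where k: "Suc x \<le> k" "local_density randoms (pre Z k) \<le> 3 / 4" using osc by blast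
  let ?\<sigma> = "pre Z k"
  let ?R = "{\<rho>. minimal_nonrandom \<rho> \<and> prefix ?\<sigma> \<rho>}"
  have "cylinder ?\<sigma> = (randoms \<inter> cylinder ?\<sigma>) \<union> (opn nonrandom \<inter> cylinder ?\<sigma>)" by blast
  then have "measure coin_measure (cylinder ?\<sigma>) \<le>
      measure coin_measure (randoms \<inter> cylinder ?\<sigma>) + measure coin_measure (opn nonrandom \<inter> cylinder ?\<sigma>)"
    using measure_Un_le[of "randoms \<inter> cylinder ?\<sigma>" coin_measure "opn nonrandom \<inter> cylinder ?\<sigma>"] by simp
  moreover have "measure coin_measure (randoms \<inter> cylinder ?\<sigma>) \<le> 3 / 4 * (1 / 2) ^ k"
    unfolding measure_eq_local_density using k(2) by (simp add: mult_right_mono)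
  ultimately have ge: "1 / 4 * (1 / 2) ^ k \<le> measure coin_measure (opn nonrandom \<inter> cylinder ?\<sigma>)"
    by (simp add: measure_cylinder)
  have "opn nonrandom \<inter> cylinder ?\<sigma> \<subseteq> (\<Union>\<rho>\<in>?R. cylinder \<rho>)"
  proof
    fix Y assume Y: "Y \<in> opn nonrandom \<inter> cylinder ?\<sigma>"
    then obtain m where "nonrandom (pre Y m)" unfolding opn_def by blast
    then obtain \<rho> where \<rho>: "prefix \<rho> (pre Y m)" "minimal_nonrandom \<rho>" using minimal_nonrandom_exists by blast
    then have Y\<rho>: "Y \<in> cylinder \<rho>" using cylinder_mono by fastforce
    have "\<not> prefix \<rho> ?\<sigma>"
    proof
      assume "prefix \<rho> ?\<sigma>"
      then have "nonrandom ?\<sigma>" using \<rho>(2) ext_closedD[OF ext_closed_nonrandom]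
        unfolding minimal_nonrandom_def by blast
      with Z show False unfolding opn_def by blast
    qed
    moreover have "prefix ?\<sigma> \<rho> \<or> prefix \<rho> ?\<sigma>" using Y Y\<rho> comparable_if_cylinders_meet by blast
    ultimately show "Y \<in> (\<Union>\<rho>\<in>?R. cylinder \<rho>)" using \<rho>(2) Y\<rho> by blast
  qed
  then have "measure coin_measure (opn nonrandom \<inter> cylinder ?\<sigma>) \<le> measure coin_measure (\<Union>\<rho>\<in>?R. cylinder \<rho>)"
    unfolding UN_cylinder_eq_opn by (intro coin.finite_measure_mono sets_opn)
  also have "\<dots> \<le> 1 / 8 * (1 / 2) ^ k"
  proof (rule measure_UN_strings_le[OF sets_cylinder])
    fix m
    \<comment> \<open>This \<open>?y\<close> bounds the codes of all strings of length at most
      \<open>m\<close>.\<close>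
    let ?F = "{\<rho>. \<rho> \<in> ?R \<and> length \<rho> \<le> m}" and ?y = "2 ^ Suc m :: nat"
    have sub: "?F \<subseteq> {\<rho> \<in> gain_strings x ?y. prefix ?\<sigma> \<rho>}"
    proof
      fix \<rho> assume \<rho>: "\<rho> \<in> ?F"
      then have "k \<le> length \<rho>" using prefix_length_le by force
      then have "x < string_code \<rho>" using k(1) length_le_string_code[of \<rho>] by linarith
      moreover have "(2::nat) ^ Suc (length \<rho>) \<le> ?y" using \<rho> by (intro power_increasing) auto
      then have "string_code \<rho> \<le> ?y" using string_code_less[of \<rho>] by linarith
      ultimately show "\<rho> \<in> {\<rho> \<in> gain_strings x ?y. prefix ?\<sigma> \<rho>}" using \<rho> by (simp add: gain_strings_def)
    qed
    have pf: "prefix_free ?F" using prefix_free_minimal_nonrandom by (auto simp: prefix_free_def)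
    have "measure coin_measure (\<Union>\<rho>\<in>?F. cylinder \<rho>) = (\<Sum>\<rho>\<in>?F. (1 / 2) ^ length \<rho>)"
      by (rule measure_UN_cylinder[OF finite_strings_length_le pf])
    also have "\<dots> \<le> (\<Sum>\<rho>\<in>{\<rho> \<in> gain_strings x ?y. prefix ?\<sigma> \<rho>}. (1 / 2) ^ length \<rho>)"
      using sub finite_gain_strings by (intro sum_mono2) auto
    also have "\<dots> \<le> 1 / 8 * (1 / 2) ^ k"
      using no[simplified, rule_format, of ?y k] unfolding gain_iff by (simp add: not_le)
    finally show "measure coin_measure (\<Union>\<rho>\<in>?F. cylinder \<rho>) \<le> 1 / 8 * (1 / 2) ^ k" .
  qed
  finally show False using ge zero_less_power[of "1 / 2 :: real" k] by linarith
qed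

text \<open>The oracles with a prefix satisfying \<open>confused e d \<tau>\<close> are those that may follow the wrong child
  of \<open>\<tau>\<close> in the tree.\<close>

definition confused :: "nat \<Rightarrow> nat \<Rightarrow> bool list \<Rightarrow> bool list \<Rightarrow> bool" where
  "confused e d \<tau> \<sigma> \<longleftrightarrow> (\<exists>a<length \<sigma>. \<exists>b<length \<sigma>.
    prefix (\<tau> @ [False]) (dstr a) \<and> prefix (\<tau> @ [True]) (dstr b) \<and>
    length (dstr a) = length (dstr b) \<and>
    thin_tree e d (dstr a) (length \<sigma>) \<and> thin_tree e d (dstr b) (length \<sigma>) \<and>
    (\<exists>k\<le>length \<sigma>. gain (length \<tau>) (length (dstr a)) (take k \<sigma>)))"

lemma dec_confused: "decidable X (\<lambda>n. confused e d (dstr (p1 n)) (dstr (p2 n)))"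
  unfolding confused_def by (intro comp_intros scomp_intros dec_thin_tree dec_gain)

lemma ext_closed_confused: "ext_closed (confused e d \<tau>)"
  unfolding ext_closed_def
proof (intro allI impI)
  fix \<sigma> \<sigma>' assume c: "confused e d \<tau> \<sigma>" and p: "prefix \<sigma> \<sigma>'"
  from c obtain a b k where abk: "a < length \<sigma>" "b < length \<sigma>"
      "prefix (\<tau> @ [False]) (dstr a)" "prefix (\<tau> @ [True]) (dstr b)"
      "length (dstr a) = length (dstr b)" "thin_tree e d (dstr a) (length \<sigma>)"
      "thin_tree e d (dstr b) (length \<sigma>)" "k \<le> length \<sigma>"
      "gain (length \<tau>) (length (dstr a)) (take k \<sigma>)"
    unfolding confused_def by blast
  have l: "length \<sigma> \<le> length \<sigma>'" using p by (rule prefix_length_le)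
  have "take k \<sigma>' = take k \<sigma>" using p abk(8) by (auto simp: prefix_def)
  then have "gain (length \<tau>) (length (dstr a)) (take k \<sigma>')" using abk(9) by simp
  then show "confused e d \<tau> \<sigma>'"
    unfolding confused_def using abk thin_tree_mono[OF _ l] l
    by (intro exI[of _ a] exI[of _ b] conjI exI[of _ k]) auto
qed

section \<open>The measure of the confused oracles\<close>

definition splits :: "nat \<Rightarrow> nat \<Rightarrow> bool list \<Rightarrow> nat \<Rightarrow> bool" where
  "splits e d \<tau> y \<longleftrightarrow> (\<forall>b. \<exists>\<alpha>. length \<alpha> = y \<and> (\<exists>s. thin_tree e d \<alpha> s) \<and> prefix (\<tau> @ [b]) \<alpha>)"

lemma splits_le: "splits e d \<tau> y \<Longrightarrow> length \<tau> < c \<Longrightarrow> c \<le> y \<Longrightarrow> splits e d \<tau> c"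
  unfolding splits_def
proof
  fix b assume *: "\<forall>b. \<exists>\<alpha>. length \<alpha> = y \<and> (\<exists>s. thin_tree e d \<alpha> s) \<and> prefix (\<tau> @ [b]) \<alpha>"
    "length \<tau> < c" "c \<le> y"
  then obtain \<alpha> s where "length \<alpha> = y" "thin_tree e d \<alpha> s" "prefix (\<tau> @ [b]) \<alpha>" by blast
  with *(2,3) show "\<exists>\<alpha>. length \<alpha> = c \<and> (\<exists>s. thin_tree e d \<alpha> s) \<and> prefix (\<tau> @ [b]) \<alpha>"
    using thin_tree_take[of e d \<alpha> s c]
    by (intro exI[of _ "take c \<alpha>"]) (auto intro: prefix_take)
qed

text \<open>The sets given by \<open>gain\<close> grow with \<open>y\<close>, so the largest level
  below \<open>m\<close> at which \<tau> splits covers all confusion. By truncation \<tau> splits at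
  every level between its length and that one, so each weight in the bound belongs to a splitting
  level.\<close>

lemma measure_confused:
  "measure coin_measure {Z. confused e d \<tau> (pre Z m)} \<le>
    8 * (\<Sum>c\<in>{c. c < m \<and> minimal_nonrandom (dstr c) \<and> length \<tau> < c \<and> splits e d \<tau> c}. (1 / 2) ^ length (dstr c))"
proof -
  let ?Y = "{y. y < m \<and> splits e d \<tau> y}"
  have conf: "\<exists>y\<in>?Y. \<exists>k. gain (length \<tau>) y (pre Z k)" if "confused e d \<tau> (pre Z m)" for Z
  proof -
    from that obtain a b k where "a < length (pre Z m)"
      and abk: "prefix (\<tau> @ [False]) (dstr a)" "prefix (\<tau> @ [True]) (dstr b)"
      "length (dstr a) = length (dstr b)" "thin_tree e d (dstr a) (length (pre Z m))"
      "thin_tree e d (dstr b) (length (pre Z m))" "gain (length \<tau>) (length (dstr a)) (take k (pre Z m))"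
      unfolding confused_def by blast
    then have am: "a < m" by simp
    have "splits e d \<tau> (length (dstr a))" unfolding splits_def
    proof
      fix c show "\<exists>\<alpha>. length \<alpha> = length (dstr a) \<and> (\<exists>s. thin_tree e d \<alpha> s) \<and> prefix (\<tau> @ [c]) \<alpha>"
        using abk by (cases c) metis+
    qed
    moreover have "length (dstr a) < m" using length_dstr_le[of a] am by linarith
    ultimately show ?thesis using abk(6) unfolding take_pre by blast
  qed
  show ?thesis
  proof (cases "?Y = {}")
    case True
    then have "{Z. confused e d \<tau> (pre Z m)} = {}" using conf by blast
    then have "measure coin_measure {Z. confused e d \<tau> (pre Z m)} = 0" by (simp only: measure_empty)
    then show ?thesis by (simp add: sum_nonneg)
  next
    case False
    have fin: "finite ?Y" by simp
    from Max_in[OF fin False] Max_ge[OF fin] obtain y where y: "y < m" "splits e d \<tau> y" and max: "\<And>z. z \<in> ?Y \<Longrightarrow> z \<le> y" by blast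
    have "{Z. confused e d \<tau> (pre Z m)} \<subseteq> opn (gain (length \<tau>) y)"
    proof safe
      fix Z assume "confused e d \<tau> (pre Z m)"
      then obtain z k where zk: "z \<in> ?Y" "gain (length \<tau>) z (pre Z k)" using conf by blast
      from gain_mono[OF zk(2) max[OF zk(1)]] show "Z \<in> opn (gain (length \<tau>) y)" unfolding opn_def by blast
    qed
    then have "measure coin_measure {Z. confused e d \<tau> (pre Z m)} \<le>
        measure coin_measure (opn (gain (length \<tau>) y))"
      by (intro coin.finite_measure_mono sets_opn)
    also have "\<dots> \<le> 8 * (\<Sum>\<rho>\<in>gain_strings (length \<tau>) y. (1 / 2) ^ length \<rho>)" by (rule measure_gain)
    also have "(\<Sum>\<rho>\<in>gain_strings (length \<tau>) y. (1 / 2 :: real) ^ length \<rho>) =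
        (\<Sum>c\<in>{c. length \<tau> < c \<and> c \<le> y \<and> minimal_nonrandom (dstr c)}. (1 / 2) ^ length (dstr c))"
      unfolding gain_strings_eq by (subst sum.reindex) (auto simp: inj_on_def)
    also have "8 * \<dots> \<le> 8 * (\<Sum>c\<in>{c. c < m \<and> minimal_nonrandom (dstr c) \<and> length \<tau> < c \<and> splits e d \<tau> c}.
        (1 / 2) ^ length (dstr c))"
    proof (intro mult_left_mono sum_mono2)
      show "{c. length \<tau> < c \<and> c \<le> y \<and> minimal_nonrandom (dstr c)} \<subseteq>
          {c. c < m \<and> minimal_nonrandom (dstr c) \<and> length \<tau> < c \<and> splits e d \<tau> c}"
        using y splits_le by auto
    qed auto
    finally show ?thesis .
  qed
qed

text \<open>After exchanging the sums, each level \<open>c\<close> is charged its weight times the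
  number of nodes splitting there, which is at most the size of the level. The Kraft inequality
  bounds the total weight of the levels by \<open>2 ^ d\<close>.\<close>

lemma sum_measure_confused:
  assumes e: "\<And>\<tau> k. K \<tau> \<le> enat k \<longleftrightarrow> (\<exists>s. K_stage e \<tau> k s)"
  shows "(\<Sum>i<N. measure coin_measure {Z. confused e d (dstr i) (pre Z m)}) \<le> 8 * 2 ^ d"
proof -
  let ?w = "\<lambda>c. (1 / 2 :: real) ^ length (dstr c)"
  let ?C = "{c. c < m \<and> minimal_nonrandom (dstr c)}"
  let ?sp = "\<lambda>i c. length (dstr i) < c \<and> splits e d (dstr i) c"
  define S where "S c = {\<alpha>. length \<alpha> = c \<and> (\<exists>s. thin_tree e d \<alpha> s)}" for c
  have finS: "finite (S c)" for c unfolding S_def by (rule finite_strings_length)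
  have inner: "(\<Sum>c\<in>{c. c < m \<and> minimal_nonrandom (dstr c) \<and> ?sp i c}. ?w c) =
      (\<Sum>c\<in>?C. of_bool (?sp i c) * ?w c)" for i
    by (rule sum.mono_neutral_cong_left) auto
  have "(\<Sum>i<N. measure coin_measure {Z. confused e d (dstr i) (pre Z m)}) \<le>
      (\<Sum>i<N. 8 * (\<Sum>c\<in>?C. of_bool (?sp i c) * ?w c))"
    unfolding inner[symmetric] by (intro sum_mono measure_confused)
  also have "\<dots> = 8 * (\<Sum>c\<in>?C. (\<Sum>i<N. of_bool (?sp i c)) * ?w c)"
    by (simp only: sum_distrib_left[symmetric] sum_distrib_right sum.swap[of _ ?C])
  also have "\<dots> \<le> 8 * (\<Sum>c\<in>?C. real (card (S c)) * ?w c)"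
  proof (intro mult_left_mono sum_mono mult_right_mono)
    fix c
    let ?I = "{i. i < N \<and> ?sp i c}" and ?B = "{\<tau>. \<forall>b. \<exists>\<alpha>\<in>S c. prefix (\<tau> @ [b]) \<alpha>}"
    have "dstr ` ?I \<subseteq> ?B" by (auto simp: splits_def S_def)
    then have "card (dstr ` ?I) \<le> card (S c)"
      using card_branchings[OF finS] card_mono order.trans by blast
    then have "card ?I \<le> card (S c)" by (simp add: card_image inj_on_def)
    moreover have "(\<Sum>i<N. of_bool (?sp i c) :: real) = card ?I"
      by (simp add: of_bool_def sum.If_cases Int_def)
    ultimately show "(\<Sum>i<N. of_bool (?sp i c)) \<le> real (card (S c))" by simp
  qed auto
  also have "(\<Sum>c\<in>?C. real (card (S c)) * ?w c) = (\<Sum>c\<in>?C. \<Sum>\<alpha>\<in>S c. ?w (length \<alpha>))"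
    by (intro sum.cong refl) (simp add: S_def)
  also have "\<dots> = (\<Sum>\<alpha>\<in>(\<Union>c\<in>?C. S c). ?w (length \<alpha>))"
    using finS by (intro sum.UNION_disjoint[symmetric]) (auto simp: S_def)
  \<comment> \<open>The exponent is enlarged by \<open>d\<close> to become the complexity bound that
    membership in the tree guarantees.\<close>
  also have "\<dots> = 2 ^ d * (\<Sum>\<alpha>\<in>(\<Union>c\<in>?C. S c). (1 / 2) ^ (length (dstr (length \<alpha>)) + d))"
    by (simp add: sum_distrib_left power_add power_one_over)
  also have "\<dots> \<le> 2 ^ d * 1"
  proof (intro mult_left_mono Kraft_K)
    show "finite (\<Union>c\<in>?C. S c)" using finS by auto
    show "K \<tau> \<le> enat (length (dstr (length \<tau>)) + d)" if "\<tau> \<in> (\<Union>c\<in>?C. S c)" for \<tau>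
    proof -
      from that obtain s where "minimal_nonrandom (dstr (length \<tau>))" "thin_tree e d \<tau> s"
        by (auto simp: S_def)
      then have "K_stage e (take (length \<tau>) \<tau>) (length (dstr (length \<tau>)) + d) s"
        unfolding thin_tree_def by blast
      then show ?thesis unfolding e by auto
    qed
  qed auto
  finally show ?thesis by simp
qed

text \<open>This is the belief of \<open>X\<close> in the node \<tau>. The gain is measured from the
  level of the parent, so that both children are judged by the same lower end.\<close>

definition supported :: "nat \<Rightarrow> nat \<Rightarrow> nat set \<Rightarrow> bool list \<Rightarrow> nat \<Rightarrow> bool" where
  "supported e d X \<tau> s \<longleftrightarrow> (\<exists>a<s. prefix \<tau> (dstr a) \<and> thin_tree e d (dstr a) s \<and>
    (\<exists>k<s. gain (length \<tau> - 1) (length (dstr a)) (initial_segment X k)))"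

lemma supported_mono: "supported e d X \<tau> s \<Longrightarrow> s \<le> t \<Longrightarrow> supported e d X \<tau> t"
  unfolding supported_def using thin_tree_mono less_le_trans by blast

lemma dec_supported:
  assumes "scomputable X f" "computable X s"
  shows "decidable X (\<lambda>n. supported e d X (f n) (s n))"
proof -
  have "decidable X (\<lambda>n. supported e d X (dstr (p1 n)) (p2 n))"
    unfolding supported_def
    by (intro comp_intros scomp_intros dec_thin_tree dec_gain scomp_initial_segment)
  from dec_compose[OF this, of "\<lambda>n. prod_encode (string_code (f n), s n)"] assms
  show ?thesis by (simp add: comp_pair comp_string_code)
qed

text \<open>The extensions supporting the two children may have different lengths. Both are cut to
  the shorter length, at which the gain was witnessed by one of them.\<close>

lemma supported_both_confused:
  assumes "supported e d X (\<tau> @ [False]) s" "supported e d X (\<tau> @ [True]) t"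
  shows "(\<lambda>i. i \<in> X) \<in> opn (confused e d \<tau>)"
proof -
  let ?Z = "\<lambda>i. i \<in> X"
  from assms(1) obtain a k where a: "prefix (\<tau> @ [False]) (dstr a)" "thin_tree e d (dstr a) s"
      "gain (length \<tau>) (length (dstr a)) (pre ?Z k)"
    unfolding supported_def initial_segment_eq_pre by auto
  from assms(2) obtain b l where b: "prefix (\<tau> @ [True]) (dstr b)" "thin_tree e d (dstr b) t"
      "gain (length \<tau>) (length (dstr b)) (pre ?Z l)"
    unfolding supported_def initial_segment_eq_pre by auto
  define y where "y = min (length (dstr a)) (length (dstr b))"
  obtain j where j: "gain (length \<tau>) y (pre ?Z j)"
  proof (cases "length (dstr a) \<le> length (dstr b)")
    case True
    with a(3) show ?thesis by (intro that[of k]) (simp add: y_def min_def)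
  next
    case False
    with b(3) show ?thesis by (intro that[of l]) (simp add: y_def min_def)
  qed
  let ?a = "string_code (take y (dstr a))" and ?b = "string_code (take y (dstr b))"
  have "length \<tau> < y" using a(1) b(1) unfolding y_def by (auto dest: prefix_length_le)
  have ly: "length (take y (dstr a)) = y" by (simp add: y_def)
  have pr: "prefix (\<tau> @ [False]) (take y (dstr a))" "prefix (\<tau> @ [True]) (take y (dstr b))"
    using a(1) b(1) \<open>length \<tau> < y\<close> by (auto intro: prefix_take)
  define m where "m = Suc (s + t + ?a + ?b + j)"
  have "confused e d \<tau> (pre ?Z m)" unfolding confused_def
  proof (intro exI conjI)
    show "?a < length (pre ?Z m)" "?b < length (pre ?Z m)" "j \<le> length (pre ?Z m)"
      by (simp_all add: m_def)
    show "thin_tree e d (dstr ?a) (length (pre ?Z m))" "thin_tree e d (dstr ?b) (length (pre ?Z m))"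
      using thin_tree_mono[OF thin_tree_take[OF a(2)], of m y] thin_tree_mono[OF thin_tree_take[OF b(2)], of m y]
      by (simp_all add: m_def)
    show "gain (length \<tau>) (length (dstr ?a)) (take j (pre ?Z m))"
      using j ly by (simp add: m_def)
  qed (use pr in \<open>simp_all add: y_def\<close>)
  then show ?thesis unfolding opn_def by blast
qed

text \<open>Only finitely many nodes are confused, and \<open>n0\<close> exceeds all their codes.
  From level \<open>n0\<close> on, a wrong bit in a supported path would make both children of a
  node supported and that node confused.\<close>

theorem K_trivial_computable_from:
  assumes X: "(\<lambda>i. i \<in> X) \<in> randoms"
    and osc: "\<And>N. \<exists>k\<ge>N. local_density randoms (pre (\<lambda>i. i \<in> X) k) \<le> 3 / 4"
    and A: "K_trivial A"
  shows "A \<le>\<^sub>T X"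
proof -
  let ?Z = "\<lambda>i. i \<in> X" and ?A = "pre (\<lambda>i. i \<in> A)"
  have random: "Martin_Loef_random X" using X by (intro Martin_Loef_random_if_avoids_nonrandom) auto
  obtain e where e: "\<And>\<tau> k. K \<tau> \<le> enat k \<longleftrightarrow> (\<exists>s. K_stage e \<tau> k s)" using K_approximation by blast
  obtain d where d: "\<And>n. \<exists>s. thin_tree e d (?A n) s" using K_trivial_path[OF A e] by blast
  have "finite {i. ?Z \<in> opn (confused e d (dstr i))}"
    by (rule Solovay_finite[OF random dec_confused ext_closed_confused sum_measure_confused[OF e]])
  then obtain n0 where n0: "\<And>i. ?Z \<in> opn (confused e d (dstr i)) \<Longrightarrow> i < n0"
    unfolding finite_nat_set_iff_bounded by blast
  have sup: "\<exists>s. supported e d X (?A (Suc n)) s" for n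
  proof -
    obtain y k where g: "gain n y (pre ?Z k)" using gain_exists[OF X osc] by blast
    let ?a = "?A (Suc n + y)"
    obtain s where s: "thin_tree e d ?a s" using d by blast
    define t where "t = Suc (s + k + string_code ?a)"
    have "supported e d X (?A (Suc n)) t" unfolding supported_def
    proof (intro exI conjI)
      show "string_code ?a < t" "k < t" by (simp_all add: t_def)
      show "prefix (?A (Suc n)) (dstr (string_code ?a))"
        unfolding dstr_string_code by (rule prefix_pre) simp
      show "thin_tree e d (dstr (string_code ?a)) t"
        using thin_tree_mono[OF s, of t] by (simp add: t_def)
      show "gain (length (?A (Suc n)) - 1) (length (dstr (string_code ?a))) (initial_segment X k)"
        using gain_mono[OF g, of "Suc n + y"] by (simp add: initial_segment_eq_pre del: upt_Suc)
    qed
    then show ?thesis by blast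
  qed
  \<comment> \<open>The algorithm hard-wires the first \<open>n0\<close> bits of \<open>A\<close>
    and afterwards accepts only nodes supported at every level.\<close>
  define good where "good \<tau> s \<longleftrightarrow> n0 \<le> length \<tau> \<and> take n0 \<tau> = ?A n0 \<and>
    (\<forall>j<length \<tau>. n0 \<le> j \<longrightarrow> supported e d X (take (Suc j) \<tau>) s)" for \<tau> s
  have good_ex: "\<exists>s. good (?A n) s" if "n0 \<le> n" for n
  proof -
    obtain t where t: "\<And>j. supported e d X (?A (Suc j)) (t j)" using sup by metis
    have "supported e d X (?A (Suc j)) (\<Sum>j<n. t j)" if "j < n" for j
      using that by (intro supported_mono[OF t] member_le_sum) auto
    then have "good (?A n) (\<Sum>j<n. t j)"
      unfolding good_def using that by (simp add: min_def del: upt_Suc)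
    then show ?thesis by blast
  qed
  have good_eq: "\<tau> = ?A (length \<tau>)" if g: "good \<tau> s" for \<tau> s
  proof -
    have "take j \<tau> = ?A j" if "n0 \<le> j" "j \<le> length \<tau>" for j
      using that
    proof (induction j rule: dec_induct)
      case base
      then show ?case using g by (simp add: good_def)
    next
      case (step j)
      then have IH: "take j \<tau> = ?A j" and j: "j < length \<tau>" by simp_all
      then have take: "take (Suc j) \<tau> = ?A j @ [\<tau> ! j]" by (simp add: take_Suc_conv_app_nth)
      obtain t where t: "supported e d X (?A j @ [j \<in> A]) t" using sup[of j] by auto
      have s: "supported e d X (?A j @ [\<tau> ! j]) s"
        using g j step.hyps unfolding good_def take[symmetric] by blast
      have "\<tau> ! j \<longleftrightarrow> j \<in> A"
      proof (rule ccontr)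
        assume "\<not> (\<tau> ! j \<longleftrightarrow> j \<in> A)"
        then have "?Z \<in> opn (confused e d (?A j))"
          using s t supported_both_confused[of e d X "?A j"] by (cases "j \<in> A") auto
        then have "string_code (?A j) < n0" using n0[of "string_code (?A j)"] by simp
        \<comment> \<open>A code is at least the length of its string, which is at least
          \<open>n0\<close> here.\<close>
        then show False using length_le_string_code[of "?A j"] step.hyps by simp
      qed
      then show ?case using take by simp
    qed
    from this[of "length \<tau>"] g show ?thesis by (simp add: good_def)
  qed
  \<comment> \<open>The length covers position \<open>n\<close> as well as the hard-wired
    part.\<close>
  let ?P = "\<lambda>n w. length (dstr (p1 w)) = n0 + Suc n \<and> good (dstr (p1 w)) (p2 w)"
  have ex: "\<exists>w. ?P n w" for n
  proof -
    obtain s where "good (?A (n0 + Suc n)) s" using good_ex[of "n0 + Suc n"] by auto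
    then show ?thesis by (intro exI[of _ "prod_encode (string_code (?A (n0 + Suc n)), s)"]) simp
  qed
  have "decidable X (\<lambda>m. ?P (p1 m) (p2 m))"
    unfolding good_def by (intro comp_intros scomp_intros dec_supported)
  then have "computable X (\<lambda>n. LEAST w. ?P n w)" using ex by (rule comp_Least)
  then have "decidable X (\<lambda>n. bit_at (dstr (p1 (LEAST w. ?P n w))) n)"
    by (intro dec_bit_at scomp_intros comp_intros)
  moreover have bit: "bit_at \<tau> n \<longleftrightarrow> n \<in> A" if "length \<tau> = n0 + Suc n" "good \<tau> s" for \<tau> s n
  proof -
    have "\<tau> = ?A (n0 + Suc n)" using good_eq[OF that(2)] unfolding that(1) .
    then have "\<tau> ! n = ?A (n0 + Suc n) ! n" by (rule arg_cong)
    then show ?thesis unfolding bit_at_def that(1) by (simp del: upt_Suc)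
  qed
  have "bit_at (dstr (p1 (LEAST w. ?P n w))) n \<longleftrightarrow> n \<in> A" for n
    using LeastI_ex[OF ex[of n]] bit by blast
  ultimately show ?thesis by (simp add: turing_reducible_iff_dec)
qed

section \<open>Incompleteness from positive lower density\<close>

primrec const_code :: "nat \<Rightarrow> code" where
  "const_code 0 = Zero"
| "const_code (Suc n) = Comp Succ (const_code n)"

lemma eval_const_code: "eval X (const_code n) m n"
proof (induction n)
  case (Suc n)
  from eval_Comp[OF Suc eval_Succ] show ?case by simp
qed (simp add: eval_Zero)

text \<open>The program \<open>Comp c (const_code n)\<close> ignores its input, so it halts on its
  own number exactly if \<open>n\<close> is in \<open>W\<close>.\<close>

lemma comp_enumerable_reducible:
  assumes "halting_problem \<le>\<^sub>T X" "comp_enumerable W"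
  shows "W \<le>\<^sub>T X"
proof -
  from assms(2) obtain c where c: "\<And>n. n \<in> W \<longleftrightarrow> (\<exists>y. eval {} c n y)"
    unfolding comp_enumerable_def by blast
  let ?h = "\<lambda>n. goedel_number (Comp c (const_code n))"
  have iff: "?h n \<in> halting_problem \<longleftrightarrow> n \<in> W" for n
  proof -
    have "?h n \<in> halting_problem \<longleftrightarrow> (\<exists>y. eval {} (Comp c (const_code n)) (?h n) y)"
      unfolding halting_problem_def by (auto simp del: goedel_number.simps simp: goedel_number_eq_iff)
    also have "\<dots> \<longleftrightarrow> (\<exists>y. eval {} c n y)"
    proof
      assume "\<exists>y. eval {} (Comp c (const_code n)) (?h n) y"
      then obtain y m where "eval {} (const_code n) (?h n) m" "eval {} c m y"
        by (auto elim: eval.cases)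
      then show "\<exists>y. eval {} c n y" using eval_deterministic[OF _ eval_const_code] by blast
    qed (blast intro: eval_Comp eval_const_code)
    finally show ?thesis using c by simp
  qed
  \<comment> \<open>The number of the constant program is a primitive recursive function of
    \<open>n\<close>.\<close>
  have g: "goedel_number (const_code n) = rec_nat (prod_encode (0, 0))
      (\<lambda>k r. prod_encode (6, prod_encode (prod_encode (1, 0), r))) n" for n
    by (induction n) simp_all
  have "computable X ?h"
    unfolding goedel_number.simps(7) g by (intro comp_rec comp_intros)
  with assms(1) have "decidable X (\<lambda>n. ?h n \<in> halting_problem)"
    unfolding turing_reducible_iff_dec by (rule dec_compose)
  then show ?thesis unfolding iff turing_reducible_iff_dec .
qed

text \<open>For \<open>w = \<langle>e, \<langle>j, \<sigma>\<rangle>\<rangle>\<close>, the strings \<open>\<rho>\<close> with \<open>hits w \<rho>\<close> generate the set of those oracles extending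
  \<open>\<sigma>\<close> for which program \<open>e\<close> answers 0 on input \<open>w\<close>. The set \<open>traps\<close> contains \<open>w\<close> as soon as these oracles
  make up more than the proportion \<open>1 - 2\<^sup>-\<^sup>j\<close> of the cylinder, which makes their answer wrong.\<close>

definition hits :: "nat \<Rightarrow> bool list \<Rightarrow> bool" where
  "hits w \<rho> \<longleftrightarrow> prefix (dstr (p2 (p2 w))) \<rho> \<and> ev \<rho> (length \<rho>) (p1 w) w 0"

definition few_hits :: "nat \<Rightarrow> nat \<Rightarrow> bool" where
  "few_hits w m \<longleftrightarrow>
    2 ^ p1 (p2 w) * card {\<rho>. length \<rho> = m \<and> hits w \<rho>} * 2 ^ length (dstr (p2 (p2 w))) + 2 ^ m \<le> 2 ^ p1 (p2 w) * 2 ^ m"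

definition traps :: "nat set" where
  "traps = {w. \<exists>m. \<not> few_hits w m}"

lemma ext_closed_hits: "ext_closed (hits w)"
  unfolding ext_closed_def hits_def
  by (meson ev_mono prefix_length_le prefix_order.trans)

lemma dec_hits:
  assumes "computable X f" "scomputable X g"
  shows "decidable X (\<lambda>n. hits (f n) (g n))"
proof -
  have "decidable X (\<lambda>n. hits (p1 n) (dstr (p2 n)))"
    unfolding hits_def by (intro comp_intros scomp_intros dec_ev)
  from dec_compose[OF this, of "\<lambda>n. prod_encode (f n, string_code (g n))"] assms
  show ?thesis by (simp add: comp_pair comp_string_code)
qed

lemma dec_few_hits:
  assumes "computable X f" "computable X g"
  shows "decidable X (\<lambda>n. few_hits (f n) (g n))"
proof -
  have "decidable X (\<lambda>n. few_hits (p1 n) (p2 n))"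
    unfolding few_hits_def by (intro comp_intros scomp_intros comp_card_strings dec_hits)
  from dec_compose[OF this, of "\<lambda>n. prod_encode (f n, g n)"] assms
  show ?thesis by (simp add: comp_pair)
qed

lemma comp_enumerable_traps: "comp_enumerable traps"
  unfolding traps_def by (intro comp_enumerable_dec_ex comp_intros dec_few_hits)

abbreviation query :: "nat \<Rightarrow> nat \<Rightarrow> bool list \<Rightarrow> nat" where
  "query e j \<sigma> \<equiv> prod_encode (e, prod_encode (j, string_code \<sigma>))"

text \<open>Multiplying by \<open>2 ^ j * 2 ^ length \<sigma>\<close> and moving the negative term
  to the other side gives the integer inequality of \<open>few_hits\<close>.\<close>

lemma few_hits_query:
  "few_hits (query e j \<sigma>) m \<longleftrightarrow>
    real (card {\<rho>. length \<rho> = m \<and> hits (query e j \<sigma>) \<rho>}) \<le> (1 - (1 / 2) ^ j) * (1 / 2) ^ length \<sigma> * 2 ^ m"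
proof -
  let ?c = "card {\<rho>. length \<rho> = m \<and> hits (query e j \<sigma>) \<rho>}"
  have "(2 ^ j * 2 ^ length \<sigma>) * ((1 - (1 / 2) ^ j) * (1 / 2) ^ length \<sigma> * 2 ^ m) =
      (2 ^ length \<sigma> * (1 / 2) ^ length \<sigma>) * ((2 ^ j - 2 ^ j * (1 / 2) ^ j) * (2 :: real) ^ m)"
    by (simp add: algebra_simps)
  also have "\<dots> = 2 ^ j * 2 ^ m - 2 ^ m"
    by (simp add: algebra_simps flip: power_mult_distrib)
  finally have eq: "(2 ^ j * 2 ^ length \<sigma>) * ((1 - (1 / 2) ^ j) * (1 / 2) ^ length \<sigma> * 2 ^ m) =
      2 ^ j * 2 ^ m - (2 :: real) ^ m" .
  have "few_hits (query e j \<sigma>) m \<longleftrightarrow> real (2 ^ j * ?c * 2 ^ length \<sigma> + 2 ^ m) \<le> real (2 ^ j * 2 ^ m)"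
    unfolding few_hits_def of_nat_le_iff by simp
  also have "\<dots> \<longleftrightarrow> (2 ^ j * 2 ^ length \<sigma>) * real ?c \<le>
      (2 ^ j * 2 ^ length \<sigma>) * ((1 - (1 / 2) ^ j) * (1 / 2) ^ length \<sigma> * 2 ^ m)"
    unfolding eq by (simp add: algebra_simps)
  also have "\<dots> \<longleftrightarrow> real ?c \<le> (1 - (1 / 2) ^ j) * (1 / 2) ^ length \<sigma> * 2 ^ m"
    by (rule mult_le_cancel_left_pos) simp
  finally show ?thesis .
qed

section \<open>A Martin-Loef test from iterated hits\<close>

definition successor :: "nat \<Rightarrow> nat \<Rightarrow> bool list \<Rightarrow> bool list \<Rightarrow> bool" where
  "successor e j \<sigma> \<rho> \<longleftrightarrow> hits (query e j \<sigma>) \<rho> \<and>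
    (\<forall>l<length \<rho>. \<not> hits (query e j \<sigma>) (take l \<rho>)) \<and> few_hits (query e j \<sigma>) (length \<rho>)"

primrec descendants :: "nat \<Rightarrow> nat \<Rightarrow> nat \<Rightarrow> bool list \<Rightarrow> bool list set" where
  "descendants e j 0 \<sigma> = {\<sigma>}"
| "descendants e j (Suc k) \<sigma> = (\<Union>\<rho>\<in>{\<rho>. successor e j \<sigma> \<rho>}. descendants e j k \<rho>)"

lemma sets_UN_cylinder: "(\<Union>\<tau>\<in>S. cylinder \<tau>) \<in> sets coin_measure"
  using sets_opn[of "\<lambda>\<tau>. \<tau> \<in> S"] UN_cylinder_eq_opn[of "\<lambda>\<tau>. \<tau> \<in> S"] by simp

lemma prefix_free_successor: "prefix_free {\<rho>. successor e j \<sigma> \<rho>}"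
  unfolding prefix_free_def
proof (intro ballI impI, rule ccontr)
  fix \<rho> \<rho>' assume s: "\<rho> \<in> {\<rho>. successor e j \<sigma> \<rho>}" "\<rho>' \<in> {\<rho>. successor e j \<sigma> \<rho>}"
    and p: "prefix \<rho> \<rho>'" "\<rho> \<noteq> \<rho>'"
  have l: "length \<rho> < length \<rho>'" "take (length \<rho>) \<rho>' = \<rho>" using p by (auto simp: prefix_def)
  have "hits (query e j \<sigma>) \<rho>" using s(1) by (simp add: successor_def)
  moreover have "\<not> hits (query e j \<sigma>) (take (length \<rho>) \<rho>')" using s(2) l(1) by (simp add: successor_def)
  ultimately show False unfolding l(2) by contradiction
qed

text \<open>The condition \<open>few_hits\<close> at the length of \<rho> is exactly the one in
  \<open>trim\<close>, so the successors stay within the permitted proportion even when \<sigma>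
  yields an element of \<open>traps\<close>.\<close>

lemma measure_successor:
  "measure coin_measure (\<Union>\<rho>\<in>{\<rho>. successor e j \<sigma> \<rho>}. cylinder \<rho>) \<le> (1 - (1 / 2) ^ j) * (1 / 2) ^ length \<sigma>"
proof -
  let ?T = "trim ((1 - (1 / 2) ^ j) * (1 / 2) ^ length \<sigma>) (hits (query e j \<sigma>))"
  have "?T \<rho>" if "successor e j \<sigma> \<rho>" for \<rho>
    using that unfolding successor_def few_hits_query trim_def by (intro exI[of _ "length \<rho>"]) simp
  then have "(\<Union>\<rho>\<in>{\<rho>. successor e j \<sigma> \<rho>}. cylinder \<rho>) \<subseteq> opn ?T"
    using UN_cylinder_eq_opn[of ?T] by blast
  then have "measure coin_measure (\<Union>\<rho>\<in>{\<rho>. successor e j \<sigma> \<rho>}. cylinder \<rho>) \<le> measure coin_measure (opn ?T)"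
    by (intro coin.finite_measure_mono sets_opn)
  also have "\<dots> \<le> (1 - (1 / 2) ^ j) * (1 / 2) ^ length \<sigma>"
    by (intro measure_trim ext_closed_hits mult_nonneg_nonneg) (simp_all add: power_le_one)
  finally show ?thesis .
qed

text \<open>Each generation shrinks the measure by the factor \<open>1 - (1 / 2) ^ j\<close>,
  relative to every cylinder of the previous generation.\<close>

lemma measure_descendants:
  "measure coin_measure (\<Union>\<tau>\<in>descendants e j k \<sigma>. cylinder \<tau>) \<le> (1 - (1 / 2) ^ j) ^ k * (1 / 2) ^ length \<sigma>"
proof (induction k arbitrary: \<sigma>)
  case 0
  then show ?case by (simp add: measure_cylinder)
next
  case (Suc k)
  have nonneg: "(0::real) \<le> (1 - (1 / 2) ^ j) ^ k" by (simp add: power_le_one)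
  have "measure coin_measure (\<Union>\<tau>\<in>descendants e j (Suc k) \<sigma>. cylinder \<tau>) =
      measure coin_measure (\<Union>\<rho>\<in>{\<rho>. successor e j \<sigma> \<rho>}. \<Union>\<tau>\<in>descendants e j k \<rho>. cylinder \<tau>)"
    by simp
  also have "\<dots> \<le> (1 - (1 / 2) ^ j) ^ k * measure coin_measure (\<Union>\<rho>\<in>{\<rho>. successor e j \<sigma> \<rho>}. cylinder \<rho>)"
    by (rule measure_UN_prefix_free_le[OF prefix_free_successor sets_UN_cylinder nonneg Suc.IH])
  also have "\<dots> \<le> (1 - (1 / 2) ^ j) ^ k * ((1 - (1 / 2) ^ j) * (1 / 2) ^ length \<sigma>)"
    by (rule mult_left_mono[OF measure_successor nonneg])
  finally show ?case by (simp add: mult_ac)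
qed

lemma in_descendants_iff:
  "\<tau> \<in> descendants e j k \<sigma> \<longleftrightarrow> (\<exists>f. f 0 = \<sigma> \<and> (\<forall>i<k. successor e j (f i) (f (Suc i))) \<and> f k = \<tau>)"
proof (induction k arbitrary: \<sigma>)
  case 0
  then show ?case by auto
next
  case (Suc k)
  show ?case
  proof
    assume "\<tau> \<in> descendants e j (Suc k) \<sigma>"
    then obtain \<rho> f where f: "successor e j \<sigma> \<rho>" "f 0 = \<rho>" "\<forall>i<k. successor e j (f i) (f (Suc i))" "f k = \<tau>"
      using Suc.IH by auto
    then show "\<exists>f. f 0 = \<sigma> \<and> (\<forall>i<Suc k. successor e j (f i) (f (Suc i))) \<and> f (Suc k) = \<tau>"
      by (intro exI[of _ "case_nat \<sigma> f"]) (auto split: nat.splits)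
  next
    assume "\<exists>f. f 0 = \<sigma> \<and> (\<forall>i<Suc k. successor e j (f i) (f (Suc i))) \<and> f (Suc k) = \<tau>"
    then obtain f where f: "f 0 = \<sigma>" "\<forall>i<Suc k. successor e j (f i) (f (Suc i))" "f (Suc k) = \<tau>" by blast
    then have "\<tau> \<in> descendants e j k (f (Suc 0))"
      unfolding Suc.IH by (intro exI[of _ "\<lambda>i. f (Suc i)"]) auto
    with f show "\<tau> \<in> descendants e j (Suc k) \<sigma>" by auto
  qed
qed

text \<open>Nested pairs code sequences, so that a whole chain of successors becomes a single
  witness for which a search can be made.\<close>

definition seq_at :: "nat \<Rightarrow> nat \<Rightarrow> nat" where
  "seq_at z i = p1 (rec_nat z (\<lambda>_ r. p2 r) i)"

lemma comp_seq_at: "computable X f \<Longrightarrow> computable X g \<Longrightarrow> computable X (\<lambda>n. seq_at (f n) (g n))"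
  unfolding seq_at_def by (intro comp_p1 comp_rec comp_p2 comp_id)

lemma seq_at_pair: "seq_at (prod_encode (a, z)) 0 = a" "seq_at (prod_encode (a, z)) (Suc i) = seq_at z i"
proof -
  have "rec_nat (prod_encode (a, z)) (\<lambda>_ r. p2 r) (Suc i) = rec_nat z (\<lambda>_ r. p2 r) i"
    by (induction i) auto
  then show "seq_at (prod_encode (a, z)) (Suc i) = seq_at z i" unfolding seq_at_def by (rule arg_cong)
qed (simp add: seq_at_def)

lemma seq_at_exists: "\<exists>z. \<forall>i\<le>k. seq_at z i = f i"
proof (induction k arbitrary: f)
  case 0
  show ?case by (intro exI[of _ "prod_encode (f 0, 0)"]) (simp add: seq_at_pair)
next
  case (Suc k)
  from Suc.IH[of "\<lambda>i. f (Suc i)"] obtain z where z: "\<forall>i\<le>k. seq_at z i = f (Suc i)" by blast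
  have "\<forall>i\<le>Suc k. seq_at (prod_encode (f 0, z)) i = f i"
  proof (intro allI impI)
    fix i assume "i \<le> Suc k"
    with z show "seq_at (prod_encode (f 0, z)) i = f i" by (cases i) (auto simp: seq_at_pair)
  qed
  then show ?case by blast
qed

lemma descendants_enumeration:
  "\<tau> \<in> descendants e j k \<sigma> \<longleftrightarrow> (\<exists>z. seq_at z 0 = string_code \<sigma> \<and>
    (\<forall>i<k. successor e j (dstr (seq_at z i)) (dstr (seq_at z (Suc i)))) \<and> seq_at z k = string_code \<tau>)"
proof
  assume "\<tau> \<in> descendants e j k \<sigma>"
  then obtain f where f: "f 0 = \<sigma>" "\<forall>i<k. successor e j (f i) (f (Suc i))" "f k = \<tau>"
    unfolding in_descendants_iff by blast
  obtain z where "\<forall>i\<le>k. seq_at z i = string_code (f i)" using seq_at_exists[of k "\<lambda>i. string_code (f i)"] by blast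
  with f show "\<exists>z. seq_at z 0 = string_code \<sigma> \<and>
    (\<forall>i<k. successor e j (dstr (seq_at z i)) (dstr (seq_at z (Suc i)))) \<and> seq_at z k = string_code \<tau>"
    by (intro exI[of _ z]) auto
next
  assume "\<exists>z. seq_at z 0 = string_code \<sigma> \<and>
    (\<forall>i<k. successor e j (dstr (seq_at z i)) (dstr (seq_at z (Suc i)))) \<and> seq_at z k = string_code \<tau>"
  then obtain z where "seq_at z 0 = string_code \<sigma>"
    "\<forall>i<k. successor e j (dstr (seq_at z i)) (dstr (seq_at z (Suc i)))" "seq_at z k = string_code \<tau>" by blast
  then show "\<tau> \<in> descendants e j k \<sigma>"
    unfolding in_descendants_iff by (intro exI[of _ "\<lambda>i. dstr (seq_at z i)"]) auto
qed

lemma dec_successor: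
  assumes "scomputable X f" "scomputable X g"
  shows "decidable X (\<lambda>n. successor e j (f n) (g n))"
proof -
  have "decidable X (\<lambda>n. successor e j (dstr (p1 n)) (dstr (p2 n)))"
    unfolding successor_def by (intro comp_intros scomp_intros dec_hits dec_few_hits)
  from dec_compose[OF this, of "\<lambda>n. prod_encode (string_code (f n), string_code (g n))"] assms
  show ?thesis by (simp add: comp_pair comp_string_code)
qed

text \<open>With \<open>q\<close> so large that \<open>q\<close> generations shrink the measure
  below one half, the generations \<open>n * q\<close> form a Martin-Loef test.\<close>

lemma random_leaves_descendants:
  assumes X: "Martin_Loef_random X"
  shows "\<exists>k. \<forall>\<tau>\<in>descendants e j k \<sigma>. (\<lambda>i. i \<in> X) \<notin> cylinder \<tau>"
proof -
  let ?r = "1 - (1 / 2 :: real) ^ j"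
  obtain q where q: "?r ^ q < 1 / 2" using real_arch_pow_inv[of "1 / 2" ?r] by auto
  define D where "D n \<tau> z \<longleftrightarrow> seq_at z 0 = string_code \<sigma> \<and>
    (\<forall>i<n * q. successor e j (dstr (seq_at z i)) (dstr (seq_at z (Suc i)))) \<and> seq_at z (n * q) = string_code \<tau>"
    for n \<tau> z
  have eq: "opn (\<lambda>\<tau>. \<exists>z. D n \<tau> z) = (\<Union>\<tau>\<in>descendants e j (n * q) \<sigma>. cylinder \<tau>)" for n
    unfolding D_def descendants_enumeration[symmetric] UN_cylinder_eq_opn[symmetric] by simp
  have "\<exists>n. (\<lambda>i. i \<in> X) \<notin> opn (\<lambda>\<tau>. \<exists>z. D n \<tau> z)"
  proof (rule Martin_Loef_random_avoids[OF X])
    show "decidable {} (\<lambda>m. D (p1 (p1 m)) (dstr (p2 (p1 m))) (p2 m))"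
      unfolding D_def by (intro comp_intros scomp_intros comp_seq_at dec_successor)
    fix n
    have "measure coin_measure (opn (\<lambda>\<tau>. \<exists>z. D n \<tau> z)) \<le> ?r ^ (n * q) * (1 / 2) ^ length \<sigma>"
      unfolding eq by (rule measure_descendants)
    also have "\<dots> \<le> ?r ^ (n * q) * 1"
      by (intro mult_left_mono) (simp_all add: power_le_one)
    also have "?r ^ (n * q) * 1 = (?r ^ q) ^ n"
      by (simp only: mult_1_right mult.commute[of n q] power_mult)
    also have "\<dots> \<le> (1 / 2) ^ n"
      using q by (intro power_mono) (simp_all add: power_le_one)
    finally show "measure coin_measure (opn (\<lambda>\<tau>. \<exists>z. D n \<tau> z)) \<le> (1 / 2) ^ n" .
  qed
  then show ?thesis unfolding eq by blast
qed

text \<open>The errors counted are answers 0 on elements of \<open>traps\<close>; any such error is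
  visible on a finite part of the oracle.\<close>

definition refuted :: "nat \<Rightarrow> bool list \<Rightarrow> bool" where
  "refuted e \<rho> \<longleftrightarrow> (\<exists>w\<in>traps. ev \<rho> (length \<rho>) e w 0)"

lemma incomplete_if_positive_density:
  assumes X: "(\<lambda>i. i \<in> X) \<in> randoms"
    and dens: "\<And>e. (\<lambda>i. i \<in> X) \<in> opn (refuted e) \<or>
      (\<exists>\<epsilon>>0. \<exists>N. \<forall>k\<ge>N. \<epsilon> \<le> local_density (- opn (refuted e)) (pre (\<lambda>i. i \<in> X) k))"
  shows "\<not> halting_problem \<le>\<^sub>T X"
proof
  assume "halting_problem \<le>\<^sub>T X"
  then have "traps \<le>\<^sub>T X" using comp_enumerable_traps by (rule comp_enumerable_reducible)
  then obtain c where c: "\<And>n. eval X c n (of_bool (n \<in> traps))" unfolding turing_reducible_def by blast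
  let ?e = "goedel_number c" and ?Z = "\<lambda>i. i \<in> X"
  have random: "Martin_Loef_random X" using X by (intro Martin_Loef_random_if_avoids_nonrandom) auto
  have "?Z \<notin> opn (refuted ?e)"
  proof
    assume "?Z \<in> opn (refuted ?e)"
    then obtain m w where "w \<in> traps" "ev (pre ?Z m) m ?e w 0"
      unfolding opn_def refuted_def by auto
    then have "eval X c w 0" using ev_sound by (simp add: initial_segment_eq_pre)
    from eval_deterministic[OF this c] \<open>w \<in> traps\<close> show False by simp
  qed
  with dens obtain \<epsilon> N where \<epsilon>: "0 < \<epsilon>"
    "\<And>k. N \<le> k \<Longrightarrow> \<epsilon> \<le> local_density (- opn (refuted ?e)) (pre ?Z k)" by blast
  \<comment> \<open>The proportion \<open>(1 / 2) ^ j\<close> left over by a trap is smaller than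
    the density of the unrefuted oracles at \<open>X\<close>.\<close>
  obtain j where j: "(1 / 2) ^ j < \<epsilon>" using real_arch_pow_inv[of \<epsilon> "1 / 2"] \<epsilon>(1) by auto
  \<comment> \<open>If the query were in \<open>traps\<close>, all oracles answering 0 on it would
    be refuted; filling more than \<open>1 - (1 / 2) ^ j\<close> of the cylinder, they would leave
    too little room for the unrefuted ones.\<close>
  have notin: "query ?e j (pre ?Z k) \<notin> traps" if "N \<le> k" for k
  proof
    let ?\<sigma> = "pre ?Z k"
    let ?w = "query ?e j ?\<sigma>"
    assume w: "?w \<in> traps"
    then obtain m where "\<not> few_hits ?w m" unfolding traps_def by blast
    then have gt: "(1 - (1 / 2) ^ j) * (1 / 2) ^ k < measure coin_measure {Y. hits ?w (pre Y m)}"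
      unfolding few_hits_query measure_level by (simp add: less_divide_eq)
    let ?A = "{Y. hits ?w (pre Y m)}" and ?B = "- opn (refuted ?e) \<inter> cylinder ?\<sigma>"
    have "Y \<in> opn (refuted ?e) \<and> Y \<in> cylinder ?\<sigma>" if "hits ?w (pre Y m)" for Y
    proof
      show "Y \<in> opn (refuted ?e)"
        using that w unfolding opn_def refuted_def hits_def by auto
      have "prefix ?\<sigma> (pre Y m)" using that unfolding hits_def by simp
      then show "Y \<in> cylinder ?\<sigma>" using cylinder_mono pre_in_cylinder by blast
    qed
    then have "?A \<union> ?B \<subseteq> cylinder ?\<sigma>" "?A \<inter> ?B = {}" by blast+
    moreover have "?A \<in> sets coin_measure" "?B \<in> sets coin_measure" by measurable
    ultimately have "measure coin_measure ?A + measure coin_measure ?B \<le> measure coin_measure (cylinder ?\<sigma>)"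
      using coin.finite_measure_Union[of ?A ?B] coin.finite_measure_mono[of "?A \<union> ?B" "cylinder ?\<sigma>"] by simp
    moreover have "\<epsilon> * (1 / 2) ^ k \<le> measure coin_measure ?B"
      unfolding measure_eq_local_density using \<epsilon>(2)[OF that] by (simp add: mult_right_mono)
    moreover have "(1 / 2) ^ j * (1 / 2) ^ k < \<epsilon> * (1 / 2 :: real) ^ k"
      using j by (intro mult_strict_right_mono) auto
    moreover have "(1 - (1 / 2) ^ j) * (1 / 2 :: real) ^ k = (1 / 2) ^ k - (1 / 2) ^ j * (1 / 2) ^ k"
      by (simp add: algebra_simps)
    ultimately show False using gt by (simp add: measure_cylinder)
  qed
  \<comment> \<open>Since the query is not in \<open>traps\<close>, the program answers 0 on it with
    oracle \<open>X\<close>, and \<open>few_hits\<close> holds at every length; the first prefix of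
    \<open>X\<close> that hits is therefore a successor.\<close>
  have next_hit: "\<exists>l\<ge>k. successor ?e j (pre ?Z k) (pre ?Z l)" if "N \<le> k" for k
  proof -
    let ?w = "query ?e j (pre ?Z k)"
    have "eval X c ?w 0" using c[of ?w] notin[OF that] by simp
    then obtain s where s: "ev (pre ?Z s) s ?e ?w 0"
      unfolding eval_iff_ev initial_segment_eq_pre by blast
    have "hits ?w (pre ?Z (k + s))"
      unfolding hits_def using ev_mono[OF s prefix_pre, of "k + s" "k + s"] by (simp add: prefix_pre)
    then have ex: "\<exists>l. hits ?w (pre ?Z l)" ..
    define l where "l = (LEAST l. hits ?w (pre ?Z l))"
    have l: "hits ?w (pre ?Z l)" unfolding l_def using ex by (rule LeastI_ex)
    have "\<not> hits ?w (pre ?Z i)" if "i < l" for i using that not_less_Least unfolding l_def by blast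
    moreover have "few_hits ?w l" using notin[OF that] unfolding traps_def by blast
    ultimately have "successor ?e j (pre ?Z k) (pre ?Z l)"
      using l unfolding successor_def by (simp add: min_def)
    moreover have "k \<le> l" using l unfolding hits_def by (auto dest: prefix_length_le)
    ultimately show ?thesis by blast
  qed
  \<comment> \<open>Iterating the step keeps a prefix of \<open>X\<close> in every generation, which
    no random set allows.\<close>
  have "\<exists>\<tau>\<in>descendants ?e j n (pre ?Z k). ?Z \<in> cylinder \<tau>" if "N \<le> k" for n k
    using that
  proof (induction n arbitrary: k)
    case (Suc n)
    from next_hit[OF Suc.prems] obtain l where l: "k \<le> l" "successor ?e j (pre ?Z k) (pre ?Z l)" by blast
    from Suc.IH[of l] l Suc.prems show ?case by fastforce
  qed simp
  with random_leaves_descendants[OF random, of ?e j "pre ?Z N"] show False by blast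
qed

theorem theorem1:
  shows "\<exists>X :: nat set. Martin_Loef_random X \<and> \<not> halting_problem \<le>\<^sub>T X \<and>
           (\<forall>A. K_trivial A \<longrightarrow> A \<le>\<^sub>T X)"
proof -
  from generic_point[of refuted] obtain Z where Z: "Z \<in> randoms"
      "\<And>N. \<exists>k\<ge>N. local_density randoms (pre Z k) \<le> 3 / 4"
      "\<And>e. Z \<in> opn (refuted e) \<or> (\<exists>\<epsilon>>0. \<exists>N. \<forall>k\<ge>N. \<epsilon> \<le> local_density (- opn (refuted e)) (pre Z k))"
    by blast
  define X where "X = {i. Z i}"
  have X: "Z = (\<lambda>i. i \<in> X)" by (simp add: X_def)
  have "Martin_Loef_random X" using Z(1) unfolding X by (intro Martin_Loef_random_if_avoids_nonrandom) auto
  moreover have "\<not> halting_problem \<le>\<^sub>T X" using Z(1,3) unfolding X by (rule incomplete_if_positive_density)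
  moreover have "A \<le>\<^sub>T X" if "K_trivial A" for A
    using Z(1,2) that unfolding X by (rule K_trivial_computable_from)
  ultimately show ?thesis by blast
qed

end
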